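(* The function $\widetilde\Phi:\mathrm{SL}(2,\mathbb{Q})\to\mathbb{Q}$ is uniquely characterized by the identity $$\tfrac12\operatorname{Re}\widetilde{GV}(\gamma_1,\gamma_2)+e(\gamma_1,\gamma_2)=\widetilde\Phi(\gamma_1\gamma_2)-\widetilde\Phi(\gamma_1)-\widetilde\Phi(\gamma_2),\qquad\text{for all }\gamma_1,\gamma_2\in\mathrm{SL}(2,\mathbb{Q});$$ that is, $\widetilde\Phi$ satisfies this identity and is the only function on $\mathrm{SL}(2,\mathbb{Q})$ satisfying it.
   Context: **The cocycle $\widetilde{GV}$.** Let $(f|\gamma)(z)=\det(\gamma)^{k/2}(cz+d)^{-k}f(\gamma z)$ for $f$ of weight $k$ and $\gamma=\begin{pmatrix}a&b\\c&d\end{pmatrix}\in\mathrm{GL}^+(2,\mathbb{Q})$. Put $\mu_\gamma(z)=\frac1{12\pi i}\frac{d}{dz}\log\frac{\Delta|\gamma}{\Delta}$ with $\Delta=\eta^{24}$ (weight 12); $\mu_\gamma$ is a holomorphic weight $2$ modular form of some level. For a weight $2$ modular form $f$ of level $N$ with expansion $f(z)=\sum_{n\ge0}a_ne^{2\pi inz/N}$ let $\mathbf{a}_0(f)=a_0$ and $\widetilde f=f-\mathbf{a}_0(f)$. Then, for any $z_0\in\mathbb{H}$ (the value does not depend on $z_0$), $$\widetilde{GV}(\gamma_1,\gamma_2)=\int_{z_0}^{\gamma_2z_0}\mu_{\gamma_1}dz+z_0\,\mathbf{a}_0(\mu_{\gamma_1}-\mu_{\gamma_1}|\gamma_2)+\int_{z_0}^{i\infty}\big(\widetilde{\mu_{\gamma_1}|\gamma_2}-\widetilde{\mu_{\gamma_1}}\big)dz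 .$$ **The Petersson cocycle $e$.** For $g_1,g_2\in\mathrm{SL}(2,\mathbb{R})$, with $j(g,z)=cz+d$, $$e(g_1,g_2)=\frac1{2\pi i}\big(\log j(g_2,z)+\log j(g_1,g_2z)-\log j(g_1g_2,z)\big),$$ where the logarithm is chosen with $\operatorname{Im}\log\in[-\pi,\pi)$; this is independent of $z\in\mathbb{H}$. **The function $\widetilde\Phi$.** Let $\mathbf{B}_1(x)=x-[x]-\frac12$ and, for coprime integers $m,n$ with $n\ge1$, let $s(\frac mn)=\sum_{j=1}^{n-1}\mathbf{B}_1(\frac jn)\mathbf{B}_1(\frac{mj}n)$. For $\sigma=\begin{pmatrix}a&b\\c&d\end{pmatrix}\in\mathrm{SL}(2,\mathbb{Z})$ define $$\widetilde\Phi(\sigma)=\begin{cases}\dfrac{b}{12d}+\dfrac{1-\operatorname{sign}(d)}4&\text{if }c=0,\\[2mm]\dfrac{a+d}{12c}-\operatorname{sign}(c)\Big(\dfrac14+s\big(\tfrac a{|c|}\big)\Big)&\text{if }c\ne0.\end{cases}$$ For upper triangular $\beta=\begin{pmatrix}a&b\\0&d\end{pmatrix}\in\mathrm{GL}^+(2,\mathbb{Q})$ define $\widetilde\Phi(\beta)=\frac b{12d}+\frac{1-\operatorname{sign}(d)}4$. For $\gamma\in\mathrm{GL}^+(2,\mathbb{Q})$, write $\gamma=\sigma\beta$ with $\sigma\in\mathrm{SL}(2,\mathbb{Z})$ and $\beta\in\mathrm{GL}^+(2,\mathbb{Q})$ upper triangular with positive diagonal entries, and define $\widetilde\Phi(\gamma)=\widetilde\Phi(\sigma)+\widetilde\Phi(\beta)$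 (this is independent of the factorization). *)

theory Defs
  imports "HOL-Complex_Analysis.Complex_Analysis"
begin

section \<open>Matrix groups and their action on the upper half-plane\<close>

definition upper_half_plane :: "complex set" where
  "upper_half_plane = {z. Im z > 0}"

definition GL2Q_pos :: "(rat^2^2) set" where
  "GL2Q_pos = {\<gamma>. det \<gamma> > 0}"

definition SL2Q :: "(rat^2^2) set" where
  "SL2Q = {\<gamma>. det \<gamma> = 1}"

text \<open>SL(2,Z), regarded as a subset of the rational matrices.\<close>

definition SL2Z :: "(rat^2^2) set" where
  "SL2Z = {\<gamma>. det \<gamma> = 1 \<and> (\<forall>i j. \<gamma> $ i $ j \<in> \<int>)}"

definition real_matrix :: "rat^2^2 \<Rightarrow> real^2^2" where
  "real_matrix = map_matrix of_rat"

definition mobius :: "real^2^2 \<Rightarrow> complex \<Rightarrow> complex" where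
  "mobius g = moebius (of_real (g $ 1 $ 1)) (of_real (g $ 1 $ 2))
                      (of_real (g $ 2 $ 1)) (of_real (g $ 2 $ 2))"

definition autj :: "real^2^2 \<Rightarrow> complex \<Rightarrow> complex" where
  "autj g z = of_real (g $ 2 $ 1) * z + of_real (g $ 2 $ 2)"

definition slash :: "int \<Rightarrow> (complex \<Rightarrow> complex) \<Rightarrow> rat^2^2 \<Rightarrow> complex \<Rightarrow> complex" where
  "slash k f \<gamma> z =
     of_real (det (real_matrix \<gamma>) powr (of_int k / 2))
       * autj (real_matrix \<gamma>) z powi (- k) * f (mobius (real_matrix \<gamma>) z)"


section \<open>The cocycle GV\<close>

definition dedekind_eta :: "complex \<Rightarrow> complex" where
  "dedekind_eta z = exp (2 * of_real pi * \<i> * z / 24)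
     * (\<Prod>n. 1 - exp (2 * of_real pi * \<i> * of_nat (Suc n) * z))"

definition modular_Delta :: "complex \<Rightarrow> complex" where
  "modular_Delta z = dedekind_eta z ^ 24"

text \<open>
  The derivative of the logarithm of a nonvanishing holomorphic function \<open>F\<close> (for any
  local branch of the logarithm) is rendered as the logarithmic derivative \<open>F' / F\<close>.
\<close>

definition GV_mu :: "rat^2^2 \<Rightarrow> complex \<Rightarrow> complex" where
  "GV_mu \<gamma> z =
     (let F = (\<lambda>w. slash 12 modular_Delta \<gamma> w / modular_Delta w)
      in 1 / (12 * of_real pi * \<i>) * (deriv F z / F z))"

definition has_q_expansion :: "(complex \<Rightarrow> complex) \<Rightarrow> nat \<Rightarrow> (nat \<Rightarrow> complex) \<Rightarrow> bool" where
  "has_q_expansion f N a \<longleftrightarrow> N > 0 \<and>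
     (\<forall>z\<in>upper_half_plane.
        (\<lambda>n. a n * exp (2 * of_real pi * \<i> * of_nat n * z / of_nat N)) sums f z)"

text \<open>The constant term does not depend on the width \<open>N\<close> used to expand \<open>f\<close>.\<close>

definition const_term :: "(complex \<Rightarrow> complex) \<Rightarrow> complex" where
  "const_term f = (THE c. \<exists>N a. has_q_expansion f N a \<and> c = a 0)"

definition drop_const :: "(complex \<Rightarrow> complex) \<Rightarrow> complex \<Rightarrow> complex" where
  "drop_const f z = f z - const_term f"

text \<open>The integral along the vertical ray from \<open>z\<^sub>0\<close> to \<open>i\<infinity>\<close>, parametrised by \<open>z\<^sub>0 + i t\<close>.\<close>

definition ray_integral :: "complex \<Rightarrow> (complex \<Rightarrow> complex) \<Rightarrow> complex" where
  "ray_integral z0 f = integral {0..} (\<lambda>t::real. f (z0 + \<i> * of_real t) * \<i>)"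

definition GV_at :: "complex \<Rightarrow> rat^2^2 \<Rightarrow> rat^2^2 \<Rightarrow> complex" where
  "GV_at z0 \<gamma>1 \<gamma>2 =
     contour_integral (linepath z0 (mobius (real_matrix \<gamma>2) z0)) (GV_mu \<gamma>1)
     + z0 * const_term (\<lambda>z. GV_mu \<gamma>1 z - slash 2 (GV_mu \<gamma>1) \<gamma>2 z)
     + ray_integral z0 (\<lambda>z. drop_const (slash 2 (GV_mu \<gamma>1) \<gamma>2) z - drop_const (GV_mu \<gamma>1) z)"

text \<open>The common value of \<open>GV_at z0 \<gamma>1 \<gamma>2\<close> at all base points \<open>z0\<close>.\<close>

definition GV :: "rat^2^2 \<Rightarrow> rat^2^2 \<Rightarrow> complex" where
  "GV \<gamma>1 \<gamma>2 = (THE v. \<forall>z0\<in>upper_half_plane. GV_at z0 \<gamma>1 \<gamma>2 = v)"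


section \<open>The Petersson cocycle\<close>

text \<open>
  Negative reals get argument \<open>-\<pi>\<close> here, whereas the library's \<^const>\<open>Ln\<close> gives them \<open>\<pi>\<close>.
\<close>

definition log_lower :: "complex \<Rightarrow> complex" where
  "log_lower z = (THE w. exp w = z \<and> - pi \<le> Im w \<and> Im w < pi)"

definition petersson_at :: "complex \<Rightarrow> real^2^2 \<Rightarrow> real^2^2 \<Rightarrow> complex" where
  "petersson_at z g1 g2 =
     1 / (2 * of_real pi * \<i>)
       * (log_lower (autj g2 z) + log_lower (autj g1 (mobius g2 z)) - log_lower (autj (g1 ** g2) z))"

definition petersson_e :: "real^2^2 \<Rightarrow> real^2^2 \<Rightarrow> complex" where
  "petersson_e g1 g2 = (THE v. \<forall>z\<in>upper_half_plane. petersson_at z g1 g2 = v)"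


section \<open>The function Phi\<close>

definition B1 :: "rat \<Rightarrow> rat" where
  "B1 x = x - of_int \<lfloor>x\<rfloor> - 1/2"

text \<open>\<^const>\<open>quotient_of\<close> returns the reduced fraction \<open>m / n\<close> with \<open>n \<ge> 1\<close>.\<close>

definition dedekind_s :: "rat \<Rightarrow> rat" where
  "dedekind_s x = (let (m, n) = quotient_of x in
     \<Sum>j = 1..n - 1. B1 (of_int j / of_int n) * B1 (of_int (m * j) / of_int n))"

definition Phi_upper :: "rat^2^2 \<Rightarrow> rat" where
  "Phi_upper \<beta> = \<beta> $ 1 $ 2 / (12 * \<beta> $ 2 $ 2) + (1 - sgn (\<beta> $ 2 $ 2)) / 4"

definition Phi_SL2Z :: "rat^2^2 \<Rightarrow> rat" where
  "Phi_SL2Z \<sigma> = (let a = \<sigma> $ 1 $ 1; b = \<sigma> $ 1 $ 2; c = \<sigma> $ 2 $ 1; d = \<sigma> $ 2 $ 2 in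
     if c = 0 then b / (12 * d) + (1 - sgn d) / 4
     else (a + d) / (12 * c) - sgn c * (1/4 + dedekind_s (a / \<bar>c\<bar>)))"

definition upper_pos :: "(rat^2^2) set" where
  "upper_pos = {\<beta> \<in> GL2Q_pos. \<beta> $ 2 $ 1 = 0 \<and> \<beta> $ 1 $ 1 > 0 \<and> \<beta> $ 2 $ 2 > 0}"

text \<open>
  The common value over all factorizations. It extends both \<open>Phi_SL2Z\<close> (take \<open>\<beta> = 1\<close>) and
  \<open>Phi_upper\<close> on all of the upper triangular matrices in \<open>GL2Q_pos\<close> (take \<open>\<sigma> = \<plusminus>1\<close>).
\<close>

definition Phi :: "rat^2^2 \<Rightarrow> rat" where
  "Phi \<gamma> = (THE v. \<forall>\<sigma>\<in>SL2Z. \<forall>\<beta>\<in>upper_pos. \<gamma> = \<sigma> ** \<beta> \<longrightarrow> v = Phi_SL2Z \<sigma> + Phi_upper \<beta>)"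

end

theory Submission
  imports Defs
begin

text \<open>
  Write \<open>L = log_eta\<close> for the logarithm of the Dedekind eta function given by
  \<open>L z = \<pi> \<i> z / 12 + (\<Sum>n. Ln (1 - q ^ Suc n))\<close> with \<open>q = exp (2 \<pi> \<i> z)\<close>, and put, for \<open>\<gamma>\<close> with
  automorphy factor \<open>j (\<gamma>, z) = c z + d\<close>,
  \<open>M\<^sub>\<gamma> z = (2 L (\<gamma> z) - 2 L z - log j (\<gamma>, z)) / (\<pi> \<i>)\<close> (\<open>eta_primitive\<close> below). Since
  \<open>\<Delta> = exp (24 L)\<close>, the weight 2 form \<open>\<mu>\<^sub>\<gamma>\<close> is the derivative of \<open>M\<^sub>\<gamma>\<close>. Near the cusp a primitive of a
  modular form of weight 2 behaves like \<open>A z + C\<close>, where \<open>A\<close> is the constant term of the form; call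
  \<open>C\<close> the constant term of the primitive. The three terms of \<open>GV (\<gamma>1, \<gamma>2)\<close> then telescope, for every
  base point, to the constant term of \<open>M\<^bsub>\<gamma>1\<^esub> \<circ> \<gamma>2\<close> minus that of \<open>M\<^bsub>\<gamma>1\<^esub>\<close> (lemma \<open>GV_value\<close>).

  From the definition of the Petersson cocycle, \<open>M\<^bsub>\<gamma>1\<^esub> \<circ> \<gamma>2 = M\<^bsub>\<gamma>1 \<gamma>2\<^esub> - M\<^bsub>\<gamma>2\<^esub> - 2 e (\<gamma>1, \<gamma>2)\<close>, and
  \<open>e\<close> is an integer. Hence \<open>Re GV / 2 + e\<close> is the coboundary of the function that sends \<open>\<gamma>\<close> to half of
  the real part of the constant term of \<open>M\<^sub>\<gamma>\<close>, and it remains to identify this function with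
  \<open>Phi\<close> (lemma \<open>cusp_primitive_Phi\<close>; it also shows that \<open>Phi\<close> is well defined). For
  \<open>\<gamma> = \<sigma> \<beta>\<close> with \<open>\<sigma>\<close> integral and \<open>\<beta>\<close> upper triangular, \<open>M\<^sub>\<gamma> = M\<^sub>\<sigma> \<circ> \<beta> + M\<^sub>\<beta>\<close>. The second summand is
  read off from \<open>L z = \<pi> \<i> z / 12 + o(1)\<close>. The first one is the constant \<open>2 Phi \<sigma>\<close>: this is Dedekind's
  transformation formula for \<open>log \<eta>\<close> (\<open>log_eta_transformation\<close>). It follows by the Euclidean algorithm
  on the first column of \<open>\<sigma>\<close> from the inversion formula \<open>L (-1/z) = L z + Ln z / 2 - \<pi> \<i> / 4\<close>
  (\<open>log_eta_inversion\<close>) together with the reciprocity law of Dedekind sums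
  (\<open>dedekind_reciprocity\<close>), which records how \<open>Phi\<close> changes at each step.

  The inversion formula is obtained by integrating the transformation law of the weight 2 Eisenstein
  series, a comparison of the two orders of summation of the conditionally convergent series
  \<open>\<Sum>\<^sub>m \<Sum>\<^sub>n 1 / (m z + n)\<^sup>2\<close> (\<open>eisenstein_exchange\<close>).

  Uniqueness holds because two solutions differ by a homomorphism from \<open>SL(2,\<rat>)\<close> to the additive
  group of complex numbers, and \<open>SL(2,\<rat>)\<close> is generated by elementary matrices, each of which is a
  commutator (\<open>SL2Q_hom_trivial\<close>).
\<close>

section \<open>Partial fractions and sums over a lattice quadrant\<close>

text \<open>
  A product majorant makes the double series absolutely summable, so both iterated sums equal its
  unordered sum.
\<close>

lemma sums_swap_order:
  fixes f :: "nat \<Rightarrow> nat \<Rightarrow> 'a::banach"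
  assumes bound: "\<And>m n. norm (f m n) \<le> a m * b n"
    and a: "summable a" "\<And>m. a m \<ge> 0" and b: "summable b" "\<And>n. b n \<ge> 0"
    and rows: "\<And>m. f m sums r m" and cols: "\<And>n. (\<lambda>m. f m n) sums c n"
  shows "\<exists>S. r sums S \<and> c sums S"
proof -
  have "(\<lambda>(m, n). a m * b n) summable_on (UNIV \<times> UNIV)"
  proof (rule summable_on_SigmaI)
    show "((\<lambda>n. case (m, n) of (m, n) \<Rightarrow> a m * b n) has_sum a m * suminf b) UNIV" for m
      using b by (auto intro!: has_sum_cmult_right norm_summable_imp_has_sum summable_sums)
    show "(\<lambda>m. a m * suminf b) summable_on UNIV"
      using a by (intro summable_on_cmult_left norm_summable_imp_summable_on) auto
  qed (use a b in auto)
  then have "(\<lambda>x. norm (case x of (m, n) \<Rightarrow> f m n)) summable_on (UNIV \<times> UNIV)"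
    by (rule Infinite_Sum.abs_summable_on_comparison_test') (use bound in auto)
  then have summ: "(\<lambda>(m, n). f m n) summable_on (UNIV \<times> UNIV)"
    by (rule abs_summable_summable)
  then obtain S where S: "((\<lambda>(m, n). f m n) has_sum S) (UNIV \<times> UNIV)"
    by (auto simp: summable_on_def)
  then have S': "((\<lambda>(n, m). f m n) has_sum S) (UNIV \<times> UNIV)"
    by (subst (asm) has_sum_swap) simp
  have sr: "summable (\<lambda>n. norm (f m n))" for m
    by (rule summable_comparison_test'[of "\<lambda>n. a m * b n" 0])
       (use bound b in \<open>auto intro: summable_mult\<close>)
  have sc: "summable (\<lambda>m. norm (f m n))" for n
    by (rule summable_comparison_test'[of "\<lambda>m. a m * b n" 0])
       (use bound a in \<open>auto intro: summable_mult2\<close>)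
  have "(r has_sum S) UNIV"
    by (rule has_sum_SigmaD[OF S]) (use norm_summable_imp_has_sum[OF sr rows] in auto)
  moreover have "(c has_sum S) UNIV"
    by (rule has_sum_SigmaD[OF S']) (use norm_summable_imp_has_sum[OF sc cols] in auto)
  ultimately show ?thesis
    using has_sum_imp_sums by blast
qed

text \<open>
  Logarithmic derivative of the reflection formula
  \<open>\<Gamma> (1 + w) \<Gamma> (1 - w) = \<pi> w / sin (\<pi> w)\<close>. The series for the digamma function on the left-hand side
  turns it into the partial fraction expansion of the cotangent.
\<close>

lemma Digamma_reflection:
  fixes w :: complex
  assumes w: "w \<notin> \<int>"
  shows "Digamma (1 - w) - Digamma (1 + w) = of_real pi * cot (of_real pi * w) - 1 / w"
proof -
  have w0: "w \<noteq> 0" using w by auto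
  have n1: "1 + w \<notin> \<int>\<^sub>\<le>\<^sub>0" "1 - w \<notin> \<int>\<^sub>\<le>\<^sub>0"
    using w by (auto elim!: nonpos_Ints_cases) 
       (metis Ints_1 Ints_diff Ints_of_int add_diff_cancel_left', metis Ints_1 Ints_diff Ints_of_int diff_diff_eq2 add_diff_cancel_left')
  have s0: "sin (of_real pi * w) \<noteq> 0"
    using w by (auto simp: sin_eq_0 field_simps)
  have G: "Gamma (1 + v) * Gamma (1 - v) = of_real pi * v / sin (of_real pi * v)" if "v \<notin> \<int>" for v :: complex
  proof -
    have "v \<noteq> 0" using that by auto
    have "v \<notin> \<int>\<^sub>\<le>\<^sub>0" using that nonpos_Ints_subset_Ints by blast
    then have "Gamma (1 + v) = v * Gamma v" 
      using Gamma_plus1[of v] by (simp add: add.commute)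
    then show ?thesis using Gamma_reflection_complex[of v] by (metis mult.assoc mult.commute times_divide_eq_right)
  qed
  have op: "open (- (\<int> :: complex set))" using closed_Ints by blast
  have "((\<lambda>v. Gamma (1 + v) * Gamma (1 - v)) has_field_derivative
          Gamma (1 + w) * Digamma (1 + w) * Gamma (1 - w) - Gamma (1 + w) * (Gamma (1 - w) * Digamma (1 - w))) (at w)"
    using n1 by (auto intro!: derivative_eq_intros)
  moreover have "((\<lambda>v. of_real pi * v / sin (of_real pi * v)) has_field_derivative
         (of_real pi * sin (of_real pi * w) - of_real pi * w * (of_real pi * cos (of_real pi * w))) / (sin (of_real pi * w))\<^sup>2) (at w)"
    using s0 by (auto intro!: derivative_eq_intros simp: power2_eq_square)
  then have "((\<lambda>v. Gamma (1 + v) * Gamma (1 - v)) has_field_derivative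
         (of_real pi * sin (of_real pi * w) - of_real pi * w * (of_real pi * cos (of_real pi * w))) / (sin (of_real pi * w))\<^sup>2) (at w)"
    by (rule has_field_derivative_transform_within_open[OF _ op]) (use w G in auto)
  ultimately have eq: "Gamma (1 + w) * Digamma (1 + w) * Gamma (1 - w) - Gamma (1 + w) * (Gamma (1 - w) * Digamma (1 - w))
     = (of_real pi * sin (of_real pi * w) - of_real pi * w * (of_real pi * cos (of_real pi * w))) / (sin (of_real pi * w))\<^sup>2"
    by (rule DERIV_unique)
  have "(Gamma (1 + w) * Gamma (1 - w)) * (Digamma (1 + w) - Digamma (1 - w)) = 
      (of_real pi * sin (of_real pi * w) - of_real pi * w * (of_real pi * cos (of_real pi * w))) / (sin (of_real pi * w))\<^sup>2"
    using eq by (simp add: algebra_simps)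
  then have "(of_real pi * w / sin (of_real pi * w)) * (Digamma (1 + w) - Digamma (1 - w)) = 
      (of_real pi * sin (of_real pi * w) - of_real pi * w * (of_real pi * cos (of_real pi * w))) / (sin (of_real pi * w))\<^sup>2"
    by (simp only: G[OF w])
  also have "\<dots> = (of_real pi * w / sin (of_real pi * w)) * (1 / w - of_real pi * cot (of_real pi * w))"
    using w0 s0 by (simp add: cot_def field_simps power2_eq_square)
  finally have "Digamma (1 + w) - Digamma (1 - w) = 1 / w - of_real pi * cot (of_real pi * w)"
    using w0 s0 by simp
  then show ?thesis by (simp add: algebra_simps)
qed

lemma cot_partial_fractions:
  fixes w :: complex
  assumes w: "w \<notin> \<int>"
  shows "(\<lambda>n. 1 / (of_nat (Suc n) + w) - 1 / (of_nat (Suc n) - w)) sums (of_real pi * cot (of_real pi * w) - 1 / w)"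
proof -
  have nz: "1 + w \<noteq> 0" "1 - w \<noteq> 0"
    using w by (metis Ints_minus Ints_1 add_eq_0_iff, auto)
  have "(\<lambda>m. (of_real (ln (real m)) - (\<Sum>n<m. inverse (1 - w + of_nat n))) -
             (of_real (ln (real m)) - (\<Sum>n<m. inverse (1 + w + of_nat n)))) \<longlonglongrightarrow> Digamma (1 - w) - Digamma (1 + w)"
    by (intro tendsto_diff Digamma_LIMSEQ nz)
  moreover have "(\<lambda>m. (of_real (ln (real m)) - (\<Sum>n<m. inverse (1 - w + of_nat n))) -
             (of_real (ln (real m)) - (\<Sum>n<m. inverse (1 + w + of_nat n)))) = 
       (\<lambda>m. \<Sum>n<m. 1 / (of_nat (Suc n) + w) - 1 / (of_nat (Suc n) - w))"
    by (auto simp: fun_eq_iff sum_subtractf inverse_eq_divide algebra_simps intro!: sum.cong)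
  ultimately show ?thesis
    unfolding sums_def Digamma_reflection[OF w] by simp
qed

text \<open>
  The derivative of the cotangent expansion; it is taken on the digamma side, where the derivative is
  a trigamma function whose series is known.
\<close>

lemma sin_squared_partial_fractions:
  fixes w :: complex
  assumes w: "w \<notin> \<int>"
  shows "(\<lambda>n. 1 / (w + of_nat (Suc n))\<^sup>2 + 1 / (w - of_nat (Suc n))\<^sup>2) sums
           (of_real pi ^ 2 / (sin (of_real pi * w))\<^sup>2 - 1 / w\<^sup>2)"
proof -
  have w0: "w \<noteq> 0" using w by auto
  have nz: "1 + w \<noteq> 0" "1 - w \<noteq> 0"
    using w by (metis Ints_minus Ints_1 add_eq_0_iff, auto)
  have n1: "1 + w \<notin> \<int>\<^sub>\<le>\<^sub>0" "1 - w \<notin> \<int>\<^sub>\<le>\<^sub>0"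
    using w by (auto elim!: nonpos_Ints_cases) 
       (metis Ints_1 Ints_diff Ints_of_int add_diff_cancel_left', metis Ints_1 Ints_diff Ints_of_int diff_diff_eq2 add_diff_cancel_left')
  have s0: "sin (of_real pi * w) \<noteq> 0"
    using w by (auto simp: sin_eq_0 field_simps)
  have op: "open (- (\<int> :: complex set))" using closed_Ints by blast
  have dD: "((\<lambda>v. Digamma (1 - v) - Digamma (1 + v)) has_field_derivative
           - Polygamma 1 (1 - w) - Polygamma 1 (1 + w)) (at w)"
    using n1 by (auto intro!: derivative_eq_intros)
  have "((\<lambda>v. of_real pi * cot (of_real pi * v) - 1 / v) has_field_derivative
        - (of_real pi ^ 2) / (sin (of_real pi * w))\<^sup>2 + 1 / w\<^sup>2) (at w)"
  proof -
    have "((\<lambda>v. cot (of_real pi * v)) has_field_derivative - inverse ((sin (of_real pi * w))\<^sup>2) * of_real pi) (at w)"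
      by (rule DERIV_chain2[where f = cot and g = "\<lambda>v. of_real pi * v", OF DERIV_cot[OF s0]]) (auto intro!: derivative_eq_intros)
    from DERIV_diff[OF DERIV_cmult[OF this, of "of_real pi"] DERIV_inverse[OF w0]] show ?thesis
      by (simp add: power2_eq_square field_simps)
  qed
  then have "((\<lambda>v. Digamma (1 - v) - Digamma (1 + v)) has_field_derivative
        - (of_real pi ^ 2) / (sin (of_real pi * w))\<^sup>2 + 1 / w\<^sup>2) (at w)"
    by (rule has_field_derivative_transform_within_open[OF _ op]) (use w Digamma_reflection in auto)
  with dD have eq: "- Polygamma 1 (1 - w) - Polygamma 1 (1 + w) = - (of_real pi ^ 2) / (sin (of_real pi * w))\<^sup>2 + 1 / w\<^sup>2"
    by (rule DERIV_unique)
  have "(\<lambda>k. inverse ((1 + w + of_nat k)^Suc 1) + inverse ((1 - w + of_nat k)^Suc 1)) sums 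
        ((-1) ^ Suc 1 * Polygamma 1 (1 + w) / fact 1 + (-1) ^ Suc 1 * Polygamma 1 (1 - w) / fact 1)"
    by (intro sums_add Polygamma_LIMSEQ nz) auto
  also have "(-1) ^ Suc 1 * Polygamma 1 (1 + w) / fact 1 + (-1) ^ Suc 1 * Polygamma 1 (1 - w) / fact 1 = 
        of_real pi ^ 2 / (sin (of_real pi * w))\<^sup>2 - 1 / w\<^sup>2"
    using eq by (simp add: algebra_simps)
  also have "(\<lambda>k. inverse ((1 + w + of_nat k)^Suc 1) + inverse ((1 - w + of_nat k)^Suc 1)) =
     (\<lambda>n. 1 / (w + of_nat (Suc n))\<^sup>2 + 1 / (w - of_nat (Suc n))\<^sup>2)"
  proof
    fix k 
    have "(1 - w + of_nat k)^Suc 1 = (w - of_nat (Suc k))\<^sup>2"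
      by (simp add: power2_eq_square algebra_simps)
    then show "inverse ((1 + w + of_nat k)^Suc 1) + inverse ((1 - w + of_nat k)^Suc 1) =
      1 / (w + of_nat (Suc k))\<^sup>2 + 1 / (w - of_nat (Suc k))\<^sup>2"
      by (simp add: power2_eq_square inverse_eq_divide add_ac)
  qed
  finally show ?thesis .
qed

text \<open>
  The factor \<open>m \<bar>x\<bar>\<close> (rather than \<open>m\<^sup>2 + x\<^sup>2\<close>) gives majorants that are products of a function of
  \<open>m\<close> and a function of \<open>x\<close>, as \<open>sums_swap_order\<close> requires. It comes from the arithmetic-geometric
  mean inequality applied to \<open>m\<^sup>2 \<bar>z\<bar>\<^sup>2 + x\<^sup>2\<close>.
\<close>

lemma norm_lattice_point_ge:
  assumes "m \<ge> 0"
  shows "(norm (of_real m * z + of_real x))\<^sup>2 \<ge> 2 * m * \<bar>x\<bar> * (norm z - \<bar>Re z\<bar>)"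
proof -
  have "(norm (of_real m * z + of_real x))\<^sup>2 = (m * norm z)\<^sup>2 + x\<^sup>2 + 2 * m * (x * Re z)"
    unfolding power_mult_distrib cmod_power2 by (simp add: power2_eq_square algebra_simps)
  moreover have "2 * m * (x * Re z) \<ge> - (2 * m * (\<bar>x\<bar> * \<bar>Re z\<bar>))"
  proof -
    have "x * Re z \<ge> - (\<bar>x\<bar> * \<bar>Re z\<bar>)" by (metis abs_ge_minus_self abs_mult minus_le_iff)
    then have "2 * m * (x * Re z) \<ge> 2 * m * (- (\<bar>x\<bar> * \<bar>Re z\<bar>))"
      using assms by (intro mult_left_mono) auto
    then show ?thesis by simp
  qed
  moreover have "(m * norm z)\<^sup>2 + x\<^sup>2 \<ge> 2 * (m * norm z) * \<bar>x\<bar>"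
    using sum_squares_bound[of "m * norm z" "\<bar>x\<bar>"] by simp
  ultimately show ?thesis by (simp add: algebra_simps)
qed

text \<open>
  The difference of \<open>1 / w\<^sup>2\<close> and the telescoping term \<open>1 / (w - 1/2) - 1 / (w + 1/2)\<close>, which is
  \<open>1 / (w\<^sup>2 - 1/4)\<close>, decays like \<open>w\<close> to the power \<open>-4\<close>.
\<close>

lemma lattice_term_bound:
  fixes z :: complex
  assumes z: "Im z > 0" and m: "m \<ge> 1" and x: "\<bar>x\<bar> \<ge> 1"
  defines "w \<equiv> of_real m * z + of_real x"
  shows "norm (1 / w\<^sup>2 - (1 / (w - 1/2) - 1 / (w + 1/2))) \<le> 1 / (8 * (norm z - \<bar>Re z\<bar>)\<^sup>2 * m\<^sup>2 * x\<^sup>2)"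
proof -
  define c where "c = norm z - \<bar>Re z\<bar>"
  have "\<bar>Re z\<bar>\<^sup>2 < (norm z)\<^sup>2"
    using z by (simp add: cmod_power2)
  then have c: "c > 0"
    unfolding c_def using power_less_imp_less_base by fastforce
  define K where "K = m * \<bar>x\<bar> * c"
  have K: "K > 0" using m x c unfolding K_def by auto
  have 0: "(norm w)\<^sup>2 \<ge> 2 * K"
    using norm_lattice_point_ge[of m x z] m unfolding w_def K_def c_def by (simp add: algebra_simps)
  have half: "(norm (of_real m * z + of_real y))\<^sup>2 \<ge> K" if "2 * \<bar>y\<bar> \<ge> \<bar>x\<bar>" for y
  proof -
    have "K \<le> m * (2 * \<bar>y\<bar>) * c" unfolding K_def 
      using that m c by (intro mult_right_mono mult_left_mono) auto
    then show ?thesis using norm_lattice_point_ge[of m y z] m unfolding c_def by simp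
  qed
  have 1: "(norm (w - 1/2))\<^sup>2 \<ge> K"
  proof -
    have "\<bar>x\<bar> \<le> 2 * \<bar>x - 1/2\<bar>" using x by (auto simp: abs_if split: if_splits)
    from half[OF this] show ?thesis unfolding w_def by (simp add: add_diff_eq)
  qed
  have 2: "(norm (w + 1/2))\<^sup>2 \<ge> K"
  proof -
    have "\<bar>x\<bar> \<le> 2 * \<bar>x + 1/2\<bar>" using x by (auto simp: abs_if split: if_splits)
    from half[OF this] show ?thesis unfolding w_def by (simp add: add.assoc)
  qed
  have "(norm (w - 1/2) * norm (w + 1/2))\<^sup>2 \<ge> K\<^sup>2"
    unfolding power_mult_distrib power2_eq_square[of K] using 1 2 K by (intro mult_mono) auto
  then have 3: "norm (w - 1/2) * norm (w + 1/2) \<ge> K"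
    by (rule power2_le_imp_le) auto
  have nz: "w \<noteq> 0" "w - 1/2 \<noteq> 0" "w + 1/2 \<noteq> 0"
  proof -
    show "w \<noteq> 0" using 0 K by auto
    show "w - 1/2 \<noteq> 0" using 1 K by (metis norm_zero not_less power_zero_numeral)
    show "w + 1/2 \<noteq> 0" using 2 K by (metis norm_zero not_less power_zero_numeral)
  qed
  have "1 / w\<^sup>2 - (1 / (w - 1/2) - 1 / (w + 1/2)) = - 1 / (4 * (w\<^sup>2 * ((w - 1/2) * (w + 1/2))))"
    using nz by (simp add: divide_simps power2_eq_square) (simp add: algebra_simps)?
  then have "norm (1 / w\<^sup>2 - (1 / (w - 1/2) - 1 / (w + 1/2))) = 1 / (4 * (norm w ^ 2 * (norm (w - 1/2) * norm (w + 1/2))))"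
    by (simp add: norm_divide norm_mult norm_power)
  also have "\<dots> \<le> 1 / (4 * ((2 * K) * K))"
  proof (intro divide_left_mono mult_left_mono mult_mono mult_pos_pos zero_less_power)
    show "0 < norm w" "0 < norm (w - 1/2)" "0 < norm (w + 1/2)"
      using nz by (simp_all only: zero_less_norm_iff not_False_eq_True)
  qed (use 0 3 K nz(1) in auto)
  also have "\<dots> = 1 / (8 * c\<^sup>2 * m\<^sup>2 * x\<^sup>2)"
    unfolding K_def by (simp add: power2_eq_square algebra_simps)
  finally show ?thesis unfolding c_def .
qed

lemma cot_conv_exp:
  assumes "sin y \<noteq> (0::complex)"
  shows "cot y = \<i> * (1 + exp (- 2 * \<i> * y)) / (1 - exp (- 2 * \<i> * y))"
proof -
  define E where "E = exp (\<i> * y)"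
  have E: "E \<noteq> 0" "exp (-(\<i> * y)) = 1 / E" "exp (- 2 * \<i> * y) = 1 / E\<^sup>2"
    unfolding E_def by (auto simp: exp_minus power2_eq_square exp_add[symmetric] field_simps)
  have "E - 1 / E \<noteq> 0" using assms unfolding sin_exp_eq E_def[symmetric] E(2) by auto
  then have "E\<^sup>2 - 1 \<noteq> 0" using E(1) by (auto simp: field_simps power2_eq_square)
  then show ?thesis
    unfolding cot_def sin_exp_eq cos_exp_eq E(2,3) E_def[symmetric] using E(1) 
    by (simp add: divide_simps power2_eq_square) (simp add: algebra_simps)?
qed

lemma sin_squared_conv_exp:
  fixes w :: complex
  shows "of_real pi ^ 2 / (sin (of_real pi * w))\<^sup>2 = - 4 * of_real pi ^ 2 * (exp (2 * of_real pi * \<i> * w) / (1 - exp (2 * of_real pi * \<i> * w))\<^sup>2)"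
proof -
  define E where "E = exp (\<i> * (of_real pi * w))"
  have E: "E \<noteq> 0" "exp (-(\<i> * (of_real pi * w))) = 1 / E" "exp (2 * of_real pi * \<i> * w) = E\<^sup>2"
    unfolding E_def by (auto simp: exp_minus power2_eq_square exp_add[symmetric] field_simps)
  have "(sin (of_real pi * w))\<^sup>2 = - ((1 - E\<^sup>2)\<^sup>2 / (4 * E\<^sup>2))"
    unfolding sin_exp_eq E(2) E_def[symmetric] using E(1) by (simp add: field_simps power2_eq_square)
  then show ?thesis unfolding E(3) by simp
qed

lemma not_Ints_if_Im: "Im w \<noteq> 0 \<Longrightarrow> w \<notin> \<int>"
  by (auto elim!: Ints_cases)

lemma sin_pi_times_nonzero:
  fixes w :: complex
  assumes "w \<notin> \<int>"
  shows "sin (of_real pi * w) \<noteq> 0"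
proof
  assume "sin (of_real pi * w) = 0"
  then obtain k where "of_real pi * w = of_int k * of_real pi" by (auto simp: sin_eq_0)
  then have "w = of_int k" by simp
  with assms show False by simp
qed

lemma Im_pos_nonzero: "Im z > 0 \<Longrightarrow> z \<noteq> 0"
  by auto

lemma inverse_shift_tendsto_0: "(\<lambda>n. 1 / (of_nat n + c :: complex)) \<longlonglongrightarrow> 0"
  by (intro tendsto_divide_0[OF tendsto_const] tendsto_add_filterlim_at_infinity'[OF tendsto_of_nat tendsto_const])

text \<open>
  The arguments move to \<open>-\<i> \<infinity>\<close>, where the cotangent tends to \<open>\<i>\<close>. This limit is the whole
  discrepancy between the two orders of summation in \<open>eisenstein_exchange\<close>.
\<close>

lemma tendsto_cot_lower:
  assumes z: "Im z > 0"
  shows "(\<lambda>n. of_real pi * cot (of_real pi * ((of_nat n + 1/2) / z))) \<longlonglongrightarrow> of_real pi * \<i>"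
proof -
  define e where "e = exp (- 2 * \<i> * of_real pi / z)"
  have "Re (- 2 * \<i> * of_real pi / z) = 2 * pi * Im (1 / z)"
    by (simp add: Re_divide Im_divide)
  also have "\<dots> < 0" using z by (simp add: Im_divide divide_simps mult_pos_neg pi_gt_zero add_nonneg_pos) 
  finally have e: "norm e < 1" unfolding e_def by simp
  have "(\<lambda>n. of_real pi * (\<i> * (1 + exp (- \<i> * of_real pi / z) * e ^ n) / (1 - exp (- \<i> * of_real pi / z) * e ^ n)))
      \<longlonglongrightarrow> of_real pi * (\<i> * (1 + exp (- \<i> * of_real pi / z) * 0) / (1 - exp (- \<i> * of_real pi / z) * 0))"
    by (intro tendsto_intros LIMSEQ_power_zero e) auto
  moreover have "of_real pi * (\<i> * (1 + exp (- \<i> * of_real pi / z) * e ^ n) / (1 - exp (- \<i> * of_real pi / z) * e ^ n)) =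
     of_real pi * cot (of_real pi * ((of_nat n + 1/2) / z))" for n
  proof -
    have "Im ((of_nat n + 1/2) / z) \<noteq> 0"
      using z by (auto simp: Im_divide divide_simps) (smt (verit, best) of_nat_0_le_iff zero_less_mult_iff sum_power2_eq_zero_iff)+
    then have "(of_nat n + 1/2) / z \<notin> \<int>"
      by (rule not_Ints_if_Im)
    then have "sin (of_real pi * ((of_nat n + 1/2) / z)) \<noteq> 0"
      by (rule sin_pi_times_nonzero)
    then have "cot (of_real pi * ((of_nat n + 1/2) / z)) = \<i> * (1 + exp (- 2 * \<i> * (of_real pi * ((of_nat n + 1/2) / z)))) / 
      (1 - exp (- 2 * \<i> * (of_real pi * ((of_nat n + 1/2) / z))))"
      by (rule cot_conv_exp)
    also have "- 2 * \<i> * (of_real pi * ((of_nat n + 1/2) / z)) = - \<i> * of_real pi / z + of_nat n * (- 2 * \<i> * of_real pi / z)"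
      using z by (simp add: divide_simps Im_pos_nonzero) (simp add: algebra_simps)?
    also have "exp (\<dots>) = exp (- \<i> * of_real pi / z) * e ^ n"
      unfolding e_def exp_of_nat_mult[symmetric] exp_add[symmetric] ..
    finally show ?thesis by simp
  qed
  ultimately show ?thesis by simp
qed

section \<open>The transformation law of the weight 2 Eisenstein series\<close>

text \<open>
  Both series are iterated sums of \<open>u m n = 1 / (m z + n)\<^sup>2 + 1 / (m z - n)\<^sup>2\<close> over \<open>m, n \<ge> 1\<close>, the first
  with \<open>n\<close> and the second with \<open>m\<close> as the inner index. The double series is not absolutely convergent.
  It becomes so after subtracting \<open>v m n = k m n - k m (n + 1)\<close>, for which both iterated sums
  telescope: they are \<open>\<Sum>\<^sub>m k m 0 = G 0\<close> and \<open>G 0 - lim G\<close>, where \<open>G n = \<Sum>\<^sub>m k m n\<close>, and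
  \<open>lim G = \<pi> \<i> / z\<close> by \<open>tendsto_cot_lower\<close>.
\<close>

lemma eisenstein_exchange:
  assumes z: "Im z > 0"
  shows "\<exists>X. (\<lambda>m. of_real pi ^ 2 / (sin (of_real pi * (of_nat (Suc m) * z)))\<^sup>2 - 1 / (of_nat (Suc m) * z)\<^sup>2) sums X
     \<and> (\<lambda>n. of_real pi ^ 2 / (z\<^sup>2 * (sin (of_real pi * (of_nat (Suc n) / z)))\<^sup>2) - 1 / (of_nat (Suc n))\<^sup>2) sums (X - of_real pi * \<i> / z)"
proof -
  define c where "c = norm z - \<bar>Re z\<bar>"
  define u where "u = (\<lambda>m n. 1 / (of_nat (Suc m) * z + of_nat (Suc n))\<^sup>2 + 1 / (of_nat (Suc m) * z - of_nat (Suc n))\<^sup>2)"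
  define k where "k = (\<lambda>m n. 1 / (of_nat (Suc m) * z + (of_nat n + 1/2)) - 1 / (of_nat (Suc m) * z - (of_nat n + 1/2)))"
  define v where "v = (\<lambda>m n. k m n - k m (Suc n))"
  define R where "R = (\<lambda>m. of_real pi ^ 2 / (sin (of_real pi * (of_nat (Suc m) * z)))\<^sup>2 - 1 / (of_nat (Suc m) * z)\<^sup>2)"
  define C where "C = (\<lambda>n. of_real pi ^ 2 / (z\<^sup>2 * (sin (of_real pi * (of_nat (Suc n) / z)))\<^sup>2) - 1 / (of_nat (Suc n))\<^sup>2)"
  define G where "G = (\<lambda>n. (of_real pi * cot (of_real pi * ((of_nat n + 1/2) / z)) - 1 / ((of_nat n + 1/2) / z)) / z)"
  have z0: "z \<noteq> 0" using z by auto
  have zn: "Im (1 / z) \<noteq> 0" using z by (simp add: Im_divide sum_power2_eq_zero_iff)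
  have inv_nonint: "of_real x / z \<notin> \<int>" if "x \<noteq> 0" for x
    using zn that by (intro not_Ints_if_Im) (auto simp: Im_divide divide_simps)
  have u_rows: "u m sums R m" for m
    unfolding u_def R_def
    by (rule sin_squared_partial_fractions) (use z in \<open>auto intro!: not_Ints_if_Im simp del: of_nat_Suc\<close>)
  have u_cols: "(\<lambda>m. u m n) sums C n" for n
  proof -
    have "of_nat (Suc n) / z \<notin> \<int>"
      using inv_nonint[of "real (Suc n)"] by simp
    from sums_divide[OF sin_squared_partial_fractions[OF this], of "z\<^sup>2"]
    have "(\<lambda>m. (1 / (of_nat (Suc n) / z + of_nat (Suc m))\<^sup>2 + 1 / (of_nat (Suc n) / z - of_nat (Suc m))\<^sup>2) / z\<^sup>2) sums
      ((of_real pi ^ 2 / (sin (of_real pi * (of_nat (Suc n) / z)))\<^sup>2 - 1 / (of_nat (Suc n) / z)\<^sup>2) / z\<^sup>2)" .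
    moreover have "(1 / (of_nat (Suc n) / z + of_nat (Suc m))\<^sup>2 + 1 / (of_nat (Suc n) / z - of_nat (Suc m))\<^sup>2) / z\<^sup>2 = u m n" for m
    proof -
      have "(of_nat (Suc n) / z + of_nat (Suc m))\<^sup>2 * z\<^sup>2 = (of_nat (Suc m) * z + of_nat (Suc n))\<^sup>2"
      proof -
        have "(of_nat (Suc n) / z + of_nat (Suc m)) * z = of_nat (Suc m) * z + of_nat (Suc n)"
          using z0 by (simp add: distrib_right del: of_nat_Suc)
        then show ?thesis unfolding power_mult_distrib[symmetric] by simp
      qed
      moreover have "(of_nat (Suc n) / z - of_nat (Suc m))\<^sup>2 * z\<^sup>2 = (of_nat (Suc m) * z - of_nat (Suc n))\<^sup>2"
      proof -
        have "(of_nat (Suc n) / z - of_nat (Suc m)) * z = - (of_nat (Suc m) * z - of_nat (Suc n))"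
          using z0 by (simp add: left_diff_distrib del: of_nat_Suc)
        then show ?thesis unfolding power_mult_distrib[symmetric] by (metis power2_minus)
      qed
      ultimately show ?thesis unfolding u_def add_divide_distrib divide_divide_eq_left by simp
    qed
    moreover have "(of_real pi ^ 2 / (sin (of_real pi * (of_nat (Suc n) / z)))\<^sup>2 - 1 / (of_nat (Suc n) / z)\<^sup>2) / z\<^sup>2 = C n"
      unfolding C_def diff_divide_distrib using z0 by (simp add: power_divide mult.commute del: of_nat_Suc)
    ultimately show ?thesis by simp
  qed
  have v_rows: "v m sums k m 0" for m
  proof -
    have "(\<lambda>n. 1 / (of_nat n + (of_nat (Suc m) * z + 1/2)) + 1 / (of_nat n + (1/2 - of_nat (Suc m) * z))) \<longlonglongrightarrow> 0 + 0"
      by (intro tendsto_add inverse_shift_tendsto_0)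
    moreover have "(\<lambda>n. 1 / (of_nat n + (of_nat (Suc m) * z + 1/2)) + 1 / (of_nat n + (1/2 - of_nat (Suc m) * z))) = k m"
    proof
      fix n
      have "of_nat n + (1/2 - of_nat (Suc m) * z) = - (of_nat (Suc m) * z - (of_nat n + 1/2))" by simp
      moreover have "of_nat n + (of_nat (Suc m) * z + 1/2) = of_nat (Suc m) * z + (of_nat n + 1/2)" by simp
      ultimately show "1 / (of_nat n + (of_nat (Suc m) * z + 1/2)) + 1 / (of_nat n + (1/2 - of_nat (Suc m) * z)) = k m n"
        unfolding k_def by (simp only: minus_divide_right[symmetric] diff_conv_add_uminus)
    qed
    ultimately have "k m \<longlonglongrightarrow> 0" by simp
    from telescope_sums'[OF this] show ?thesis unfolding v_def by simp
  qed
  have k_cols: "(\<lambda>m. k m n) sums G n" for n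
  proof -
    have "(of_nat n + 1/2) / z \<notin> \<int>"
      using inv_nonint[of "real n + 1/2"] by simp
    from sums_divide[OF cot_partial_fractions[OF this], of z]
    have "(\<lambda>m. (1 / (of_nat (Suc m) + (of_nat n + 1/2) / z) - 1 / (of_nat (Suc m) - (of_nat n + 1/2) / z)) / z) sums G n"
      unfolding G_def .
    moreover have "(1 / (of_nat (Suc m) + (of_nat n + 1/2) / z) - 1 / (of_nat (Suc m) - (of_nat n + 1/2) / z)) / z = k m n" for m
    proof -
      have "(a + x / z) * z = a * z + x" "(a - x / z) * z = a * z - x" for a x
        using z0 by (simp_all add: distrib_right left_diff_distrib)
      then have "(of_nat (Suc m) + (of_nat n + 1/2) / z) * z = of_nat (Suc m) * z + (of_nat n + 1/2)"
        "(of_nat (Suc m) - (of_nat n + 1/2) / z) * z = of_nat (Suc m) * z - (of_nat n + 1/2)"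
        by blast+
      then show ?thesis unfolding k_def diff_divide_distrib divide_divide_eq_left by simp
    qed
    ultimately show ?thesis by simp
  qed
  have v_cols: "(\<lambda>m. v m n) sums (G n - G (Suc n))" for n
    unfolding v_def by (intro sums_diff k_cols)
  have "G \<longlonglongrightarrow> (of_real pi * \<i> - 1 / 1 * 0) / z"
  proof -
    have "(\<lambda>n. (of_real pi * cot (of_real pi * ((of_nat n + 1/2) / z)) - z * (1 / (of_nat n + 1/2))) / z) \<longlonglongrightarrow> (of_real pi * \<i> - z * 0) / z"
      by (intro tendsto_intros tendsto_cot_lower inverse_shift_tendsto_0 z z0)
    then show ?thesis unfolding G_def by simp
  qed
  then have G_sums: "(\<lambda>n. G n - G (Suc n)) sums (G 0 - of_real pi * \<i> / z)"
    using telescope_sums' by fastforce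
  have bound: "norm (u m n - v m n) \<le> (1 / (4 * c\<^sup>2) * (1 / (real (Suc m))\<^sup>2)) * (1 / (real (Suc n))\<^sup>2)" for m n
  proof -
    define w1 where "w1 = of_nat (Suc m) * z + of_nat (Suc n)"
    define w2 where "w2 = of_nat (Suc m) * z - of_nat (Suc n)"
    have "u m n - v m n = (1 / w1\<^sup>2 - (1 / (w1 - 1/2) - 1 / (w1 + 1/2))) + (1 / w2\<^sup>2 - (1 / (w2 - 1/2) - 1 / (w2 + 1/2)))"
    proof -
      have e: "of_nat (Suc m) * z + (of_nat n + 1/2) = w1 - 1/2" "of_nat (Suc m) * z + (of_nat (Suc n) + 1/2) = w1 + 1/2"
         "of_nat (Suc m) * z - (of_nat n + 1/2) = w2 + 1/2" "of_nat (Suc m) * z - (of_nat (Suc n) + 1/2) = w2 - 1/2"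
        unfolding w1_def w2_def by (simp_all add: algebra_simps)
      show ?thesis unfolding u_def v_def k_def e w1_def[symmetric] w2_def[symmetric] by simp
    qed
    also have "norm \<dots> \<le> 1 / (8 * c\<^sup>2 * (real (Suc m))\<^sup>2 * (real (Suc n))\<^sup>2) + 1 / (8 * c\<^sup>2 * (real (Suc m))\<^sup>2 * (- real (Suc n))\<^sup>2)"
      using lattice_term_bound[OF z, of "real (Suc m)" "real (Suc n)"] lattice_term_bound[OF z, of "real (Suc m)" "- real (Suc n)"]
      unfolding c_def w1_def w2_def by (intro norm_triangle_mono) (simp_all del: of_nat_Suc)
    also have "\<dots> = (1 / (4 * c\<^sup>2) * (1 / (real (Suc m))\<^sup>2)) * (1 / (real (Suc n))\<^sup>2)"
      by (simp add: field_simps del: of_nat_Suc)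
    finally show ?thesis .
  qed
  have sq: "summable (\<lambda>n. 1 / (real (Suc n))\<^sup>2)"
    using inverse_squares_sums sums_summable by (simp add: add.commute)
  obtain S where S: "(\<lambda>m. R m - k m 0) sums S" "(\<lambda>n. C n - (G n - G (Suc n))) sums S"
    using sums_swap_order[OF bound summable_mult[OF sq] _ sq _ sums_diff[OF u_rows v_rows] sums_diff[OF u_cols v_cols]]
    by auto
  have "R sums (S + G 0)"
    using sums_add[OF S(1) k_cols[of 0]] by simp
  moreover have "C sums (S + G 0 - of_real pi * \<i> / z)"
    using sums_add[OF S(2) G_sums] by (simp add: algebra_simps)
  ultimately show ?thesis unfolding R_def C_def by blast
qed

text \<open>
  Both series are iterated sums of \<open>n q\<^bsup>n m\<^esup>\<close> over \<open>m, n \<ge> 1\<close>.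
\<close>

lemma lambert_series_double_sum:
  fixes q :: complex
  assumes q: "norm q < 1"
  shows "\<exists>S. (\<lambda>m. q ^ Suc m / (1 - q ^ Suc m)\<^sup>2) sums S \<and> (\<lambda>n. of_nat (Suc n) * q ^ Suc n / (1 - q ^ Suc n)) sums S"
proof (rule sums_swap_order)
  define f where "f = (\<lambda>m n. of_nat (Suc n) * q ^ (Suc n * Suc m))"
  have lt: "norm (q ^ Suc m) < 1" for m
    using q by (simp add: norm_power power_less_one_iff del: power_Suc)
  show "f m sums (q ^ Suc m / (1 - q ^ Suc m)\<^sup>2)" for m
  proof -
    have "q ^ Suc m * (of_nat (Suc n) * (q ^ Suc m) ^ n) = f m n" for n
      unfolding f_def by (simp only: mult.commute[of "Suc n"] power_mult) (simp add: mult_ac)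
    then show ?thesis
      using sums_mult[OF geometric_deriv_sums[OF lt[of m]], of "q ^ Suc m"] by simp
  qed
  show "(\<lambda>m. f m n) sums (of_nat (Suc n) * q ^ Suc n / (1 - q ^ Suc n))" for n
  proof -
    have "of_nat (Suc n) * q ^ Suc n * (q ^ Suc n) ^ m = f m n" for m
      unfolding f_def by (simp only: power_mult) (simp add: mult_ac)
    then show ?thesis
      using sums_mult[OF geometric_sums[OF lt[of n]], of "of_nat (Suc n) * q ^ Suc n"] by simp
  qed
  show "summable (\<lambda>m. norm q ^ m)" using q by (simp add: summable_geometric)
  show "summable (\<lambda>n. real (Suc n) * norm q ^ n)" 
    using geometric_deriv_sums[of "norm q"] q sums_summable by fastforce
  show "norm (f m n) \<le> norm q ^ m * (real (Suc n) * norm q ^ n)" for m n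
  proof -
    have "norm q ^ (Suc n * Suc m) \<le> norm q ^ (m + n)" 
      using q by (intro power_decreasing) auto
    then have "real (Suc n) * norm q ^ (Suc n * Suc m) \<le> real (Suc n) * norm q ^ (m + n)"
      by (intro mult_left_mono) auto
    then show ?thesis unfolding f_def by (simp add: norm_mult norm_power power_add mult_ac del: of_nat_Suc power_Suc mult_Suc mult_Suc_right)
  qed
qed auto

definition lambert :: "complex \<Rightarrow> complex" where
  "lambert q = (\<Sum>n. of_nat (Suc n) * q ^ Suc n / (1 - q ^ Suc n))"

lemma norm_exp_nome:
  assumes "Im z > 0"
  shows "norm (exp (2 * of_real pi * \<i> * z)) < 1"
  using assms by simp

text \<open>
  The transformation law of \<open>E\<^sub>2 = 1 - 24 \<Sum>\<^sub>n n q\<^sup>n / (1 - q\<^sup>n)\<close>. The inner sums in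
  \<open>eisenstein_exchange\<close> are values of \<open>\<pi>\<^sup>2 / sin\<^sup>2\<close>, hence \<open>- 4 \<pi>\<^sup>2 q\<^sup>m / (1 - q\<^sup>m)\<^sup>2\<close> with \<open>q\<close> taken at \<open>z\<close>
  for one order of summation and at \<open>- 1 / z\<close> for the other one.
\<close>

lemma lambert_inversion:
  assumes z: "Im z > 0"
  shows "lambert (exp (2 * of_real pi * \<i> * (- 1 / z))) / z\<^sup>2 = 
      lambert (exp (2 * of_real pi * \<i> * z)) - 1 / 24 + 1 / (24 * z\<^sup>2) + \<i> / (4 * of_real pi * z)"
proof -
  define q where "q = exp (2 * of_real pi * \<i> * z)"
  define p where "p = exp (2 * of_real pi * \<i> * (- 1 / z))"
  have z0: "z \<noteq> 0" using z by auto
  have "Im (- 1 / z) > 0"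
    using z by (simp add: Im_divide sum_power2_gt_zero_iff)
  then have p: "norm p < 1" unfolding p_def by (rule norm_exp_nome)
  have q: "norm q < 1" unfolding q_def using z by (rule norm_exp_nome)
  have *: "(\<lambda>m. x ^ Suc m / (1 - x ^ Suc m)\<^sup>2) sums lambert x" if "norm x < 1" for x
    using lambert_series_double_sum[OF that] unfolding lambert_def by (auto simp: sums_iff)
  have expq: "exp (2 * of_real pi * \<i> * (of_nat n * w)) = exp (2 * of_real pi * \<i> * w) ^ n" for n w
    unfolding exp_of_nat_mult[symmetric] by (simp add: mult_ac)
  obtain X where X: "(\<lambda>m. of_real pi ^ 2 / (sin (of_real pi * (of_nat (Suc m) * z)))\<^sup>2 - 1 / (of_nat (Suc m) * z)\<^sup>2) sums X"
     "(\<lambda>n. of_real pi ^ 2 / (z\<^sup>2 * (sin (of_real pi * (of_nat (Suc n) / z)))\<^sup>2) - 1 / (of_nat (Suc n))\<^sup>2) sums (X - of_real pi * \<i> / z)"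
    using eisenstein_exchange[OF z] by blast
  have sq: "(\<lambda>n. 1 / (of_nat (Suc n))\<^sup>2 :: complex) sums (of_real pi ^ 2 / 6)"
    using sums_of_real[OF inverse_squares_sums, where 'a = complex] by (simp add: add.commute)
  have 1: "(\<lambda>m. of_real pi ^ 2 / (sin (of_real pi * (of_nat (Suc m) * z)))\<^sup>2) sums (- 4 * of_real pi ^ 2 * lambert q)"
    unfolding sin_squared_conv_exp expq unfolding q_def[symmetric] by (intro sums_mult * q)
  have "(\<lambda>m. of_real pi ^ 2 / (sin (of_real pi * (of_nat (Suc m) * (- 1 / z))))\<^sup>2) sums (- 4 * of_real pi ^ 2 * lambert p)"
    unfolding sin_squared_conv_exp expq unfolding p_def[symmetric] by (intro sums_mult * p)
  from sums_divide[OF this, of "z\<^sup>2"]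
  have 2: "(\<lambda>n. of_real pi ^ 2 / (z\<^sup>2 * (sin (of_real pi * (of_nat (Suc n) / z)))\<^sup>2)) sums (- 4 * of_real pi ^ 2 * lambert p / z\<^sup>2)"
    by (simp add: mult.commute del: of_nat_Suc)
  have "X = - 4 * of_real pi ^ 2 * lambert q - of_real pi ^ 2 / 6 / z\<^sup>2"
  proof (rule sums_unique2[OF X(1)])
    show "(\<lambda>m. of_real pi ^ 2 / (sin (of_real pi * (of_nat (Suc m) * z)))\<^sup>2 - 1 / (of_nat (Suc m) * z)\<^sup>2)
        sums (- 4 * of_real pi ^ 2 * lambert q - of_real pi ^ 2 / 6 / z\<^sup>2)"
      using sums_diff[OF 1 sums_divide[OF sq, of "z\<^sup>2"]] by (simp add: power_mult_distrib del: of_nat_Suc)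
  qed
  moreover have "X - of_real pi * \<i> / z = - 4 * of_real pi ^ 2 * lambert p / z\<^sup>2 - of_real pi ^ 2 / 6"
    by (rule sums_unique2[OF X(2) sums_diff[OF 2 sq]])
  ultimately have "- 4 * of_real pi ^ 2 * lambert p / z\<^sup>2 - of_real pi ^ 2 / 6 = - 4 * of_real pi ^ 2 * lambert q - of_real pi ^ 2 / 6 / z\<^sup>2 - of_real pi * \<i> / z"
    by simp
  then have "- 4 * of_real pi ^ 2 * (lambert p / z\<^sup>2) = - 4 * of_real pi ^ 2 * lambert q + of_real pi ^ 2 / 6 - of_real pi ^ 2 / 6 / z\<^sup>2 - of_real pi * \<i> / z"
    by (simp add: algebra_simps)
  also have "\<dots> = - 4 * of_real pi ^ 2 * (lambert q - 1 / 24 + 1 / (24 * z\<^sup>2) + \<i> / (4 * of_real pi * z))"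
    using z0 by (simp add: field_simps power2_eq_square)
  finally have "lambert p / z\<^sup>2 = lambert q - 1 / 24 + 1 / (24 * z\<^sup>2) + \<i> / (4 * of_real pi * z)"
    by (subst (asm) mult_left_cancel) auto
  then show ?thesis unfolding p_def q_def .
qed

section \<open>Dedekind sums and their reciprocity law\<close>

definition dedekind_sum :: "int \<Rightarrow> int \<Rightarrow> rat" where
  "dedekind_sum h k = (\<Sum>j = 1..k - 1. B1 (of_int j / of_int k) * B1 (of_int (h * j) / of_int k))"

lemma dedekind_s_fraction:
  assumes "k > 0" "coprime h k"
  shows "dedekind_s (of_int h / of_int k) = dedekind_sum h k"
proof -
  have "quotient_of (of_int h / of_int k) = (h, k)"
    unfolding Fract_of_int_quotient[symmetric] quotient_of_Fract 
    using assms by (simp add: Rat.normalize_def)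
  then show ?thesis unfolding dedekind_s_def dedekind_sum_def by simp
qed

lemma B1_fraction:
  assumes "k > 0"
  shows "B1 (of_int m / of_int k) = of_int (m mod k) / of_int k - 1/2"
proof -
  have "(of_int m :: rat) = of_int k * of_int (m div k) + of_int (m mod k)"
    by (simp only: of_int_mult[symmetric] of_int_add[symmetric] mult_div_mod_eq)
  from arg_cong[OF this, of "\<lambda>x. x / of_int k"]
  have "(of_int m / of_int k :: rat) = of_int (m div k) + of_int (m mod k) / of_int k"
    using assms by (simp only: add_divide_distrib) simp
  moreover have "B1 (of_int m / of_int k) = of_int m / of_int k - of_int (m div k) - 1/2"
    unfolding B1_def floor_divide_of_int_eq ..
  ultimately show ?thesis by linarith
qed

lemma dedekind_sum_conv_mod:
  assumes "k > 0"
  shows "dedekind_sum h k = (\<Sum>j = 1..k - 1. (of_int j / of_int k - 1/2) * (of_int (h * j mod k) / of_int k - 1/2))"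
  unfolding dedekind_sum_def
  by (intro sum.cong refl) (use assms in \<open>simp add: B1_fraction del: of_int_mult\<close>)

lemma dedekind_sum_mod:
  assumes "k > 0" "h mod k = h' mod k"
  shows "dedekind_sum h k = dedekind_sum h' k"
proof -
  have "h * j mod k = h' * j mod k" for j
    using assms(2) by (metis mod_mult_left_eq)
  then show ?thesis unfolding dedekind_sum_conv_mod[OF assms(1)] by simp
qed

lemma coprime_mult_mod_neq_0:
  fixes h k j :: int
  assumes "coprime h k" "0 < j" "j < k"
  shows "h * j mod k \<noteq> 0"
proof
  assume "h * j mod k = 0"
  then have "k dvd j" using assms(1) by (metis coprime_commute coprime_dvd_mult_right_iff dvd_eq_mod_eq_0)
  then show False using assms(2,3) zdvd_not_zless by blast
qed

lemma dedekind_sum_uminus: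
  assumes "k > 0" "coprime h k"
  shows "dedekind_sum (- h) k = - dedekind_sum h k"
proof -
  have "(of_int (- h * j mod k) / of_int k - 1/2 :: rat) = - (of_int (h * j mod k) / of_int k - 1/2)" if "j \<in> {1..k-1}" for j
  proof -
    have "h * j mod k \<noteq> 0" using coprime_mult_mod_neq_0[OF assms(2), of j] that by auto
    then have "- h * j mod k = k - h * j mod k"
      by (simp add: zmod_zminus1_eq_if)
    then have "(of_int (- h * j mod k) :: rat) = of_int k - of_int (h * j mod k)" by simp
    then show ?thesis using assms(1) by (simp add: diff_divide_distrib)
  qed
  then show ?thesis
    unfolding dedekind_sum_conv_mod[OF assms(1)] sum_negf[symmetric]
    by (intro sum.cong refl) (simp only: mult_minus_right)
qed

text \<open>
  Multiplication by a unit permutes the nonzero residues.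
\<close>

lemma sum_residues:
  fixes h k :: int
  assumes "coprime h k"
  shows "(\<Sum>j = 1..k - 1. g (h * j mod k)) = (\<Sum>j = 1..k - 1. g j)"
proof (rule sum.reindex_bij_betw)
  have inj: "inj_on (\<lambda>j. h * j mod k) {1..k - 1}"
  proof (rule inj_onI)
    fix i j assume ij: "i \<in> {1..k - 1}" "j \<in> {1..k - 1}" "h * i mod k = h * j mod k"
    then have "k dvd h * (i - j)" by (simp add: mod_eq_dvd_iff right_diff_distrib)
    then have "k dvd i - j" using assms by (metis coprime_commute coprime_dvd_mult_right_iff)
    moreover have "\<bar>i - j\<bar> < k" using ij by auto
    ultimately show "i = j" using dvd_imp_le_int[of "i - j" k] by force
  qed
  have "(\<lambda>j. h * j mod k) ` {1..k - 1} \<subseteq> {1..k - 1}"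
  proof safe
    fix j assume j: "j \<in> {1..k - 1}"
    then have "h * j mod k \<noteq> 0" "k > 0" using coprime_mult_mod_neq_0[OF assms, of j] by auto
    then show "h * j mod k \<in> {1..k - 1}"
      using pos_mod_sign[of k "h * j"] pos_mod_bound[of k "h * j"] unfolding atLeastAtMost_iff by linarith
  qed
  then have "(\<lambda>j. h * j mod k) ` {1..k - 1} = {1..k - 1}"
    using inj by (intro endo_inj_surj) auto
  then show "bij_betw (\<lambda>j. h * j mod k) {1..k - 1} {1..k - 1}"
    using inj by (simp add: bij_betw_def)
qed

lemma sum_first_powers_int:
  fixes k :: int
  assumes "k \<ge> 1"
  shows "2 * (\<Sum>j = 1..k - 1. j) = k * (k - 1)"
    and "6 * (\<Sum>j = 1..k - 1. j\<^sup>2) = k * (k - 1) * (2 * k - 1)"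
    and "(\<Sum>j = 1..k - 1. 2 * j - 1) = (k - 1)\<^sup>2"
proof -
  have "2 * (\<Sum>j = 1..k - 1. j) = k * (k - 1) \<and> 6 * (\<Sum>j = 1..k - 1. j\<^sup>2) = k * (k - 1) * (2 * k - 1) \<and>
    (\<Sum>j = 1..k - 1. 2 * j - 1) = (k - 1)\<^sup>2"
    using assms
  proof (induction k rule: int_ge_induct)
    case (step i)
    have "{1..i + 1 - 1} = insert i {1..i - 1}" using step by auto
    with step show ?case by (simp add: algebra_simps power2_eq_square)
  qed simp
  then show "2 * (\<Sum>j = 1..k - 1. j) = k * (k - 1)"
    and "6 * (\<Sum>j = 1..k - 1. j\<^sup>2) = k * (k - 1) * (2 * k - 1)"
    and "(\<Sum>j = 1..k - 1. 2 * j - 1) = (k - 1)\<^sup>2" by auto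
qed

lemma sum_quotients:
  fixes h k :: int
  assumes "k \<ge> 1" "coprime h k"
  shows "2 * (\<Sum>j = 1..k - 1. h * j div k) = (h - 1) * (k - 1)"
proof -
  have "(\<Sum>j = 1..k - 1. h * j mod k) + k * (\<Sum>j = 1..k - 1. h * j div k) = h * (\<Sum>j = 1..k - 1. j)"
    by (simp only: sum_distrib_left sum.distrib[symmetric] mod_mult_div_eq)
  then have "k * (2 * (\<Sum>j = 1..k - 1. h * j div k)) = (h - 1) * (2 * (\<Sum>j = 1..k - 1. j))"
    using sum_residues[OF assms(2), of "\<lambda>x. x"] by (simp add: algebra_simps)
  also have "\<dots> = k * ((h - 1) * (k - 1))"
    unfolding sum_first_powers_int(1)[OF assms(1)] by simp
  finally show ?thesis using assms(1) by simp
qed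

lemma int_div_less_iff:
  fixes n k i :: int
  assumes "k > 0"
  shows "n div k < i \<longleftrightarrow> n < i * k"
proof -
  have "n div k < i \<longleftrightarrow> of_int n / of_int k < (of_int i :: rat)"
    unfolding floor_divide_of_int_eq[symmetric, where 'a = rat] by (rule floor_less_iff)
  also have "\<dots> \<longleftrightarrow> of_int n < (of_int (i * k) :: rat)"
    using assms by (simp add: divide_less_eq)
  finally show ?thesis by (simp only: of_int_less_iff)
qed

text \<open>
  Write \<open>\<lfloor>h j / k\<rfloor>\<^sup>2\<close> as the sum of the first \<open>\<lfloor>h j / k\<rfloor>\<close> odd numbers and exchange the order
  of summation over the lattice points \<open>(i, j)\<close> below the diagonal of the \<open>h \<times> k\<close> rectangle.
\<close>

lemma sum_square_quotients:
  fixes h k :: int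
  assumes h: "h \<ge> 1" and k: "k \<ge> 1" and co: "coprime h k"
  shows "2 * (\<Sum>j = 1..k - 1. (h * j div k)\<^sup>2) = 2 * (k - 1) * (h - 1)\<^sup>2 + (h - 1) * (k - 1) - 4 * (\<Sum>i = 1..h - 1. i * (k * i div h))"
proof -
  have "(\<Sum>j = 1..k - 1. (h * j div k)\<^sup>2) = (\<Sum>j = 1..k - 1. \<Sum>i = 1..h - 1. if i * k \<le> h * j then 2 * i - 1 else 0)"
  proof (rule sum.cong[OF refl])
    fix j assume j: "j \<in> {1..k - 1}"
    have q0: "h * j div k \<ge> 0" using j h k by (simp add: pos_imp_zdiv_nonneg_iff)
    have "h * j < h * k" using j h by auto
    then have q1: "h * j div k \<le> h - 1" using k int_div_less_iff[of k "h * j" h] by simp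
    have "{i \<in> {1..h - 1}. i * k \<le> h * j} = {1..(h * j div k + 1) - 1}"
    proof -
      have "i * k \<le> h * j \<longleftrightarrow> i \<le> h * j div k" for i
        using k int_div_less_iff[of k "h * j" i] by linarith
      with q1 show ?thesis by (intro set_eqI) (simp, linarith)
    qed
    then have "(\<Sum>i = 1..h - 1. if i * k \<le> h * j then 2 * i - 1 else 0) = (\<Sum>i = 1..(h * j div k + 1) - 1. 2 * i - 1)"
      by (subst sum.inter_filter[symmetric]) simp_all
    also have "\<dots> = (h * j div k)\<^sup>2"
      using sum_first_powers_int(3)[of "h * j div k + 1"] q0 by simp
    finally show "(h * j div k)\<^sup>2 = (\<Sum>i = 1..h - 1. if i * k \<le> h * j then 2 * i - 1 else 0)" ..
  qed
  also have "\<dots> = (\<Sum>i = 1..h - 1. \<Sum>j = 1..k - 1. if i * k \<le> h * j then 2 * i - 1 else 0)"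
    by (rule sum.swap)
  also have "\<dots> = (\<Sum>i = 1..h - 1. (2 * i - 1) * (k - 1 - k * i div h))"
  proof (rule sum.cong[OF refl])
    fix i assume i: "i \<in> {1..h - 1}"
    have ne: "k * i mod h \<noteq> 0" using coprime_mult_mod_neq_0[of k h i] co i by (auto simp: coprime_commute)
    have q0: "k * i div h \<ge> 0" using i h k by (simp add: pos_imp_zdiv_nonneg_iff)
    have "k * i < h * k" using i k by auto
    then have q1: "k * i div h < k" using h int_div_less_iff[of h "k * i" k] by (simp add: mult.commute)
    have "{j \<in> {1..k - 1}. i * k \<le> h * j} = {k * i div h + 1..k - 1}"
    proof -
      have "i * k \<le> h * j \<longleftrightarrow> k * i div h < j" for j
      proof -
        have "k * i div h < j \<longleftrightarrow> k * i < j * h" using h by (intro int_div_less_iff) auto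
        moreover have "k * i \<noteq> j * h" using ne by auto
        ultimately show ?thesis by (auto simp: mult.commute)
      qed
      with q0 show ?thesis by (intro set_eqI) (simp, linarith)
    qed
    then have "(\<Sum>j = 1..k - 1. if i * k \<le> h * j then 2 * i - 1 else 0) = (\<Sum>j = k * i div h + 1..k - 1. 2 * i - 1)"
      by (subst sum.inter_filter[symmetric]) simp_all
    also have "\<dots> = (2 * i - 1) * (k - 1 - k * i div h)"
      using q1 by simp
    finally show "(\<Sum>j = 1..k - 1. if i * k \<le> h * j then 2 * i - 1 else 0) = (2 * i - 1) * (k - 1 - k * i div h)" .
  qed
  also have "\<dots> = (k - 1) * (\<Sum>i = 1..h - 1. 2 * i - 1) - 2 * (\<Sum>i = 1..h - 1. i * (k * i div h)) + (\<Sum>i = 1..h - 1. k * i div h)"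
  proof -
    have "(2 * i - 1) * (k - 1 - k * i div h) = (k - 1) * (2 * i - 1) - 2 * (i * (k * i div h)) + k * i div h" for i
      by (simp add: algebra_simps)
    then have "(\<Sum>i = 1..h - 1. (2 * i - 1) * (k - 1 - k * i div h)) = 
      (\<Sum>i = 1..h - 1. (k - 1) * (2 * i - 1) - 2 * (i * (k * i div h)) + k * i div h)" by simp
    then show ?thesis unfolding sum.distrib sum_subtractf[of "\<lambda>i. (k - 1) * (2 * i - 1)"] sum_distrib_left[symmetric] .
  qed
  also have "(\<Sum>i = 1..h - 1. 2 * i - 1) = (h - 1)\<^sup>2"
    by (rule sum_first_powers_int(3)[OF h])
  finally have "2 * (\<Sum>j = 1..k - 1. (h * j div k)\<^sup>2) = 2 * (k - 1) * (h - 1)\<^sup>2 - 4 * (\<Sum>i = 1..h - 1. i * (k * i div h)) + 2 * (\<Sum>i = 1..h - 1. k * i div h)"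
    by simp
  also have "2 * (\<Sum>i = 1..h - 1. k * i div h) = (k - 1) * (h - 1)"
    using co by (intro sum_quotients[OF h]) (simp add: coprime_commute)
  finally show ?thesis by simp
qed

text \<open>
  Square \<open>h j mod k = h j - k \<lfloor>h j / k\<rfloor>\<close> and sum over \<open>j\<close>; the left-hand side is \<open>\<Sum>\<^sub>j j\<^sup>2\<close> by
  \<open>sum_residues\<close>.
\<close>

lemma sum_index_quotients:
  fixes h k :: int
  assumes k: "k \<ge> 1" and co: "coprime h k"
  shows "2 * h * k * (\<Sum>j = 1..k - 1. j * (h * j div k)) = (h\<^sup>2 - 1) * (\<Sum>j = 1..k - 1. j\<^sup>2) + k\<^sup>2 * (\<Sum>j = 1..k - 1. (h * j div k)\<^sup>2)"
proof -
  have "(\<Sum>j = 1..k - 1. j\<^sup>2) = (\<Sum>j = 1..k - 1. (h * j mod k)\<^sup>2)"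
    by (rule sum_residues[OF co, symmetric])
  also have "\<dots> = (\<Sum>j = 1..k - 1. h\<^sup>2 * j\<^sup>2 - 2 * h * k * (j * (h * j div k)) + k\<^sup>2 * (h * j div k)\<^sup>2)"
  proof (rule sum.cong[OF refl])
    fix j 
    have "(h * j mod k)\<^sup>2 = (h * j - k * (h * j div k))\<^sup>2" by (simp add: minus_mult_div_eq_mod)
    then show "(h * j mod k)\<^sup>2 = h\<^sup>2 * j\<^sup>2 - 2 * h * k * (j * (h * j div k)) + k\<^sup>2 * (h * j div k)\<^sup>2"
      by (simp add: power2_eq_square algebra_simps)
  qed
  also have "\<dots> = h\<^sup>2 * (\<Sum>j = 1..k - 1. j\<^sup>2) - 2 * h * k * (\<Sum>j = 1..k - 1. j * (h * j div k)) + k\<^sup>2 * (\<Sum>j = 1..k - 1. (h * j div k)\<^sup>2)"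
    by (simp add: sum.distrib sum_subtractf sum_distrib_left)
  finally show ?thesis by (simp add: algebra_simps)
qed

text \<open>
  A Dedekind sum is elementary up to the one sum \<open>\<Sum>\<^sub>j j \<lfloor>h j / k\<rfloor>\<close>.
\<close>

lemma dedekind_sum_closed:
  fixes h k :: int
  assumes k: "k \<ge> 1" and co: "coprime h k"
  shows "dedekind_sum h k * of_int k = of_int h * (of_int k - 1) * (2 * of_int k - 1) / 6 
    - of_int (\<Sum>j = 1..k - 1. j * (h * j div k)) - of_int k * (of_int k - 1) / 4"
proof -
  have k0: "of_int k \<noteq> (0::rat)" using k by simp
  have "dedekind_sum h k * of_int k = (\<Sum>j = 1..k - 1. (of_int h * of_int (j\<^sup>2) / of_int k - of_int (j * (h * j div k)) - of_int j / 2 - of_int (h * j mod k) / 2 + of_int k / 4))"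
    unfolding dedekind_sum_conv_mod[OF order.strict_trans2[OF zero_less_one k]] sum_distrib_right
  proof (rule sum.cong[OF refl])
    fix j
    have r: "of_int (h * j mod k) = of_int h * of_int j - of_int k * (of_int (h * j div k) :: rat)"
      by (metis minus_mult_div_eq_mod of_int_diff of_int_mult)
    show "(of_int j / of_int k - 1 / 2) * (of_int (h * j mod k) / of_int k - 1 / 2) * of_int k =
         of_int h * of_int (j\<^sup>2) / of_int k - of_int (j * (h * j div k)) - of_int j / 2 - of_int (h * j mod k) / 2 + (of_int k / 4 :: rat)"
      unfolding r using k0 by (simp add: field_simps power2_eq_square)
  qed
  also have "\<dots> = of_int h * of_int (\<Sum>j = 1..k - 1. j\<^sup>2) / of_int k - of_int (\<Sum>j = 1..k - 1. j * (h * j div k)) 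
     - of_int (\<Sum>j = 1..k - 1. j) / 2 - of_int (\<Sum>j = 1..k - 1. h * j mod k) / 2 + of_int (k - 1) * of_int k / 4"
    using k by (simp add: sum.distrib sum_subtractf sum_distrib_left sum_divide_distrib)
  also have "(\<Sum>j = 1..k - 1. h * j mod k) = (\<Sum>j = 1..k - 1. j)"
    by (rule sum_residues[OF co])
  also have "of_int (\<Sum>j = 1..k - 1. j) = (of_int k * (of_int k - 1) / 2 :: rat)"
    using arg_cong[OF sum_first_powers_int(1)[OF k], of "of_int :: int \<Rightarrow> rat"] by simp
  also have "of_int (\<Sum>j = 1..k - 1. j\<^sup>2) = (of_int k * (of_int k - 1) * (2 * of_int k - 1) / 6 :: rat)"
    using arg_cong[OF sum_first_powers_int(2)[OF k], of "of_int :: int \<Rightarrow> rat"] by simp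
  also have "of_int h * (of_int k * (of_int k - 1) * (2 * of_int k - 1) / 6) / of_int k = (of_int h * (of_int k - 1) * (2 * of_int k - 1) / 6 :: rat)"
    using k0 by simp
  finally show ?thesis by (simp only: of_int_diff of_int_1) (simp add: field_simps)
qed

text \<open>
  By \<open>dedekind_sum_closed\<close> this amounts to a formula for \<open>h X + k Y\<close>, where \<open>X\<close> and \<open>Y\<close> are the sums
  \<open>\<Sum>\<^sub>j j \<lfloor>h j / k\<rfloor>\<close> and \<open>\<Sum>\<^sub>i i \<lfloor>k i / h\<rfloor>\<close>. The lemmas \<open>sum_index_quotients\<close> and
  \<open>sum_square_quotients\<close> express the sum of the \<open>\<lfloor>h j / k\<rfloor>\<^sup>2\<close> through \<open>X\<close> and through \<open>Y\<close>, respectively.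
\<close>

theorem dedekind_reciprocity:
  fixes h k :: int
  assumes h: "h > 0" and k: "k > 0" and co: "coprime h k"
  shows "dedekind_sum h k + dedekind_sum k h = - 1/4 + (of_int h / of_int k + of_int k / of_int h + 1 / (of_int h * of_int k)) / 12"
proof -
  have h1: "h \<ge> 1" and k1: "k \<ge> 1" and co': "coprime k h" using h k co by (auto simp: coprime_commute)
  define X where "X = (\<Sum>j = 1..k - 1. j * (h * j div k))"
  define Y where "Y = (\<Sum>i = 1..h - 1. i * (k * i div h))"
  define H K where "H = (of_int h :: rat)" and "K = (of_int k :: rat)"
  have H: "H \<noteq> 0" and K: "K \<noteq> 0" using h k unfolding H_def K_def by auto
  have "12 * (2 * h * k * X) = 2 * (h\<^sup>2 - 1) * (6 * (\<Sum>j = 1..k - 1. j\<^sup>2)) + 6 * k\<^sup>2 * (2 * (\<Sum>j = 1..k - 1. (h * j div k)\<^sup>2))"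
    unfolding X_def sum_index_quotients[OF k1 co] by (simp add: algebra_simps)
  also have "\<dots> = 2 * (h\<^sup>2 - 1) * (k * (k - 1) * (2 * k - 1)) + 6 * k\<^sup>2 * (2 * (k - 1) * (h - 1)\<^sup>2 + (h - 1) * (k - 1) - 4 * Y)"
    unfolding sum_first_powers_int(2)[OF k1] sum_square_quotients[OF h1 k1 co] Y_def ..
  finally have "k * (24 * (h * X + k * Y)) = k * (2 * (h\<^sup>2 - 1) * ((k - 1) * (2 * k - 1)) + 6 * k * (2 * (k - 1) * (h - 1)\<^sup>2 + (h - 1) * (k - 1)))"
    by (simp add: algebra_simps power2_eq_square)
  then have "24 * (h * X + k * Y) = 2 * (h\<^sup>2 - 1) * ((k - 1) * (2 * k - 1)) + 6 * k * (2 * (k - 1) * (h - 1)\<^sup>2 + (h - 1) * (k - 1))"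
    using k by simp
  from arg_cong[OF this, of "of_int :: int \<Rightarrow> rat"]
  have XY: "24 * (H * of_int X + K * of_int Y) = 2 * (H\<^sup>2 - 1) * ((K - 1) * (2 * K - 1)) + 6 * K * (2 * (K - 1) * (H - 1)\<^sup>2 + (H - 1) * (K - 1))"
    unfolding H_def K_def by simp
  have 1: "dedekind_sum h k * K = H * (K - 1) * (2 * K - 1) / 6 - of_int X - K * (K - 1) / 4"
    unfolding H_def K_def X_def by (rule dedekind_sum_closed[OF k1 co])
  have 2: "dedekind_sum k h * H = K * (H - 1) * (2 * H - 1) / 6 - of_int Y - H * (H - 1) / 4"
    unfolding H_def K_def Y_def by (rule dedekind_sum_closed[OF h1 co'])
  have "24 * ((dedekind_sum h k + dedekind_sum k h) * (H * K)) = 24 * H * (dedekind_sum h k * K) + 24 * K * (dedekind_sum k h * H)"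
    by (simp add: algebra_simps)
  also have "\<dots> = 4 * H * H * (K - 1) * (2 * K - 1) - 6 * H * K * (K - 1) + 4 * K * K * (H - 1) * (2 * H - 1) - 6 * H * K * (H - 1)
      - 24 * (H * of_int X + K * of_int Y)"
    unfolding 1 2 by (simp add: field_simps)
  also have "\<dots> = 24 * ((- 1/4 + (H / K + K / H + 1 / (H * K)) / 12) * (H * K))"
  proof -
    define W where "W = H / K + K / H + 1 / (H * K)"
    have W: "W * (H * K) = H * H + K * K + 1"
      unfolding W_def using H K by (simp add: distrib_right)
    have "24 * ((- 1/4 + W / 12) * (H * K)) = - 6 * (H * K) + 2 * (W * (H * K))"
      by (simp add: algebra_simps)
    then have "24 * ((- 1/4 + (H / K + K / H + 1 / (H * K)) / 12) * (H * K)) = - 6 * (H * K) + 2 * (H * H + K * K + 1)"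
      unfolding W_def[symmetric] W .
    then show ?thesis unfolding XY by (simp add: algebra_simps power2_eq_square)
  qed
  finally have "(dedekind_sum h k + dedekind_sum k h) * (H * K) = (- 1/4 + (H / K + K / H + 1 / (H * K)) / 12) * (H * K)"
    by (simp only: mult_cancel_left) simp
  then show ?thesis using H K unfolding H_def[symmetric] K_def[symmetric] by (simp only: mult_cancel_right) simp
qed

section \<open>The logarithm of the Dedekind eta function\<close>

definition euler_log :: "complex \<Rightarrow> complex" where
  "euler_log q = (\<Sum>n. Ln (1 - q ^ Suc n))"

lemma one_minus_power_nonzero:
  fixes q :: complex
  assumes "norm q < 1"
  shows "1 - q ^ Suc n \<noteq> 0"
proof
  assume "1 - q ^ Suc n = 0"
  then have "norm (q ^ Suc n) = 1" by simp
  moreover have "norm (q ^ Suc n) < 1"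
    using assms unfolding norm_power by (intro power_less_one_iff[THEN iffD2]) auto
  ultimately show False by linarith
qed

lemma one_minus_power_not_nonpos:
  fixes q :: complex
  assumes "norm q < 1"
  shows "1 - q ^ Suc n \<notin> \<real>\<^sub>\<le>\<^sub>0"
proof
  assume "1 - q ^ Suc n \<in> \<real>\<^sub>\<le>\<^sub>0"
  then have "Re (1 - q ^ Suc n) \<le> 0" by (auto simp: complex_nonpos_Reals_iff)
  then have "Re (q ^ Suc n) \<ge> 1" by simp
  moreover have "norm (q ^ Suc n) < 1"
    using assms unfolding norm_power by (intro power_less_one_iff[THEN iffD2]) auto
  ultimately show False using complex_Re_le_cmod[of "q ^ Suc n"] by linarith
qed

text \<open>
  Near a point of the disc, \<open>\<bar>Ln (1 - q\<^sup>n)\<bar> \<le> 2 r\<^sup>n\<close> for some \<open>r < 1\<close> and all large \<open>n\<close>, so the series can be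
  differentiated termwise. The derivative is multiplied by \<open>q\<close> because \<open>q\<close> times it is a Lambert series,
  and the chain rule for \<open>q = exp (2 \<pi> \<i> z)\<close> produces exactly this factor.
\<close>

lemma euler_log_series:
  assumes q: "norm q < 1"
  shows euler_log_sums: "(\<lambda>n. Ln (1 - q ^ Suc n)) sums euler_log q"
    and has_field_derivative_euler_log_aux: "\<exists>D. (euler_log has_field_derivative D) (at q) \<and> q * D = - lambert q"
proof -
  define f where "f = (\<lambda>n (x::complex). Ln (1 - x ^ Suc n))"
  define f' where "f' = (\<lambda>n (x::complex). inverse (1 - x ^ Suc n) * (- (of_nat (Suc n) * x ^ n)))"
  have "\<exists>g g'. \<forall>x \<in> ball 0 1. ((\<lambda>n. f n x) sums g x) \<and> ((\<lambda>n. f' n x) sums g' x) \<and> (g has_field_derivative g' x) (at x)"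
  proof (rule series_and_derivative_comparison_complex)
    show "(f n has_field_derivative f' n x) (at x)" if "x \<in> ball 0 1" for n x
      unfolding f_def f'_def using that one_minus_power_not_nonpos[of x n]
      by (auto intro!: derivative_eq_intros simp del: power_Suc of_nat_Suc simp: field_simps)
    fix x :: complex assume "x \<in> ball 0 1"
    then have x: "norm x < 1" by simp
    define r where "r = (1 + norm x) / 2"
    have r: "0 < r" "norm x < r" "r < 1" using x unfolding r_def by (auto simp: add_pos_nonneg)
    have "(\<lambda>n. r ^ Suc n) \<longlonglongrightarrow> 0"
      using r LIMSEQ_power_zero[of r] by (intro LIMSEQ_Suc) auto
    then have ev: "eventually (\<lambda>n. r ^ Suc n < 1/2) sequentially"
      by (rule order_tendstoD) auto
    have "\<forall>\<^sub>F n in sequentially. \<forall>y\<in>ball x (r - norm x) \<inter> ball 0 1. cmod (f n y) \<le> cmod (of_real (2 * r ^ Suc n))"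
      using ev
    proof eventually_elim
      case (elim n)
      show ?case
      proof
        fix y assume y: "y \<in> ball x (r - norm x) \<inter> ball 0 1"
        then have "norm y < r" using norm_triangle_sub[of y x] by (auto simp: dist_norm norm_minus_commute)
        then have le: "norm (y ^ Suc n) \<le> r ^ Suc n"
          unfolding norm_power by (intro power_mono) auto
        then have "norm (- (y ^ Suc n)) < 1/2" using elim by simp
        from norm_Ln_le[OF this] have "norm (f n y) \<le> 2 * norm (y ^ Suc n)"
          unfolding f_def by simp
        also have "\<dots> \<le> 2 * r ^ Suc n" using le by simp
        also have "\<dots> \<le> cmod (of_real (2 * r ^ Suc n))" by (simp only: norm_of_real abs_ge_self)
        finally show "cmod (f n y) \<le> cmod (of_real (2 * r ^ Suc n))" .
      qed
    qed
    moreover have "summable (\<lambda>n. of_real (2 * r ^ Suc n) :: complex)"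
      unfolding summable_of_real_iff using r by (intro summable_mult) (simp add: summable_mult)
    ultimately show "\<exists>d h. 0 < d \<and> summable h \<and> range h \<subseteq> \<real>\<^sub>\<ge>\<^sub>0 \<and> (\<forall>\<^sub>F n in sequentially. \<forall>y\<in>ball x d \<inter> ball 0 1. cmod (f n y) \<le> cmod (h n))"
      using r by (intro exI[of _ "r - norm x"] exI[of _ "\<lambda>n. of_real (2 * r ^ Suc n)"]) auto
  qed (rule open_ball)
  then obtain g g' where gg: "\<forall>x \<in> ball 0 1. ((\<lambda>n. f n x) sums g x) \<and> ((\<lambda>n. f' n x) sums g' x) \<and> (g has_field_derivative g' x) (at x)"
    by blast
  have g: "(\<lambda>n. f n x) sums g x"
    "(\<lambda>n. f' n x) sums g' x" "(g has_field_derivative g' x) (at x)" if "norm x < 1" for x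
    using gg that by auto
  have eq: "g x = euler_log x" if "norm x < 1" for x
    using g(1)[OF that] unfolding f_def euler_log_def by (simp add: sums_iff)
  show "(\<lambda>n. Ln (1 - q ^ Suc n)) sums euler_log q"
    using g(1)[OF q] eq[OF q] unfolding f_def by simp
  have "(euler_log has_field_derivative g' q) (at q)"
    by (rule has_field_derivative_transform_within_open[OF g(3)[OF q], of "ball 0 1"]) (use q eq in auto)
  moreover have "q * g' q = - lambert q"
  proof -
    have "(\<lambda>n. - (q * f' n q)) sums (- (q * g' q))"
      using g(2)[OF q] by (intro sums_minus sums_mult)
    moreover have "- (q * f' n q) = of_nat (Suc n) * q ^ Suc n / (1 - q ^ Suc n)" for n
      unfolding f'_def by (simp add: divide_inverse)
    ultimately have "lambert q = - (q * g' q)"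
      unfolding lambert_def by (simp add: sums_iff)
    then show ?thesis by simp
  qed
  ultimately show "\<exists>D. (euler_log has_field_derivative D) (at q) \<and> q * D = - lambert q" by blast
qed

definition log_eta :: "complex \<Rightarrow> complex" where
  "log_eta z = of_real pi * \<i> * z / 12 + euler_log (exp (2 * of_real pi * \<i> * z))"

lemma dedekind_eta_conv_exp:
  assumes "Im z > 0"
  shows "dedekind_eta z = exp (log_eta z)"
proof -
  define q where "q = exp (2 * of_real pi * \<i> * z)"
  have q: "norm q < 1" unfolding q_def by (rule norm_exp_nome[OF assms])
  have "(\<Prod>n. exp (Ln (1 - q ^ Suc n))) = exp (euler_log q)"
    using prodinf_exp[OF sums_summable[OF euler_log_sums[OF q]]] unfolding euler_log_def .
  moreover have "exp (Ln (1 - q ^ Suc n)) = 1 - exp (2 * of_real pi * \<i> * of_nat (Suc n) * z)" for n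
  proof -
    have "exp (2 * of_real pi * \<i> * of_nat (Suc n) * z) = q ^ Suc n"
      unfolding q_def exp_of_nat_mult[symmetric] by (simp only: mult_ac)
    then show ?thesis using one_minus_power_nonzero[OF q, of n] by (simp del: power_Suc)
  qed
  ultimately show ?thesis
    unfolding dedekind_eta_def log_eta_def exp_add q_def by (simp add: mult_ac)
qed

lemma has_field_derivative_log_eta:
  assumes "Im z > 0"
  shows "(log_eta has_field_derivative of_real pi * \<i> * (1 / 12 - 2 * lambert (exp (2 * of_real pi * \<i> * z)))) (at z)"
proof -
  define q where "q = exp (2 * of_real pi * \<i> * z)"
  have q: "norm q < 1" unfolding q_def by (rule norm_exp_nome[OF assms])
  obtain D where D: "(euler_log has_field_derivative D) (at q)" "q * D = - lambert q"
    using has_field_derivative_euler_log_aux[OF q] by blast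
  have "((\<lambda>z. exp (2 * of_real pi * \<i> * z)) has_field_derivative q * (2 * of_real pi * \<i>)) (at z)"
    unfolding q_def by (auto intro!: derivative_eq_intros)
  from DERIV_chain2[where f = euler_log, OF D(1)[unfolded q_def] this]
  have "((\<lambda>z. euler_log (exp (2 * of_real pi * \<i> * z))) has_field_derivative D * (q * (2 * of_real pi * \<i>))) (at z)" .
  moreover have "D * (q * (2 * of_real pi * \<i>)) = - 2 * of_real pi * \<i> * lambert q"
  proof -
    have "D * (q * (2 * of_real pi * \<i>)) = (q * D) * (2 * of_real pi * \<i>)" by (simp only: mult_ac)
    then show ?thesis unfolding D(2) by simp
  qed
  ultimately have "((\<lambda>z. euler_log (exp (2 * of_real pi * \<i> * z))) has_field_derivative - 2 * of_real pi * \<i> * lambert q) (at z)"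
    by simp
  moreover have "((\<lambda>z. of_real pi * \<i> * z / 12) has_field_derivative of_real pi * \<i> / 12) (at z)"
    by (auto intro!: derivative_eq_intros)
  ultimately have "((\<lambda>z. of_real pi * \<i> * z / 12 + euler_log (exp (2 * of_real pi * \<i> * z))) has_field_derivative
     (of_real pi * \<i> / 12 + - 2 * of_real pi * \<i> * lambert q)) (at z)"
    by (intro DERIV_add)
  then show ?thesis unfolding log_eta_def[abs_def] q_def by (simp add: algebra_simps)
qed

lemma Im_neg_inverse_pos: "Im z > 0 \<Longrightarrow> Im (- 1 / z) > 0"
  by (simp add: Im_divide sum_power2_gt_zero_iff)

text \<open>
  By \<open>lambert_inversion\<close> the derivatives of both sides agree on the upper half-plane; the constant of
  integration is found at the fixed point \<open>\<i>\<close>.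
\<close>

theorem log_eta_inversion:
  assumes z: "Im z > 0"
  shows "log_eta (- 1 / z) = log_eta z + Ln z / 2 - of_real pi * \<i> / 4"
proof -
  define F where "F = (\<lambda>z. log_eta (- 1 / z) - log_eta z - Ln z / 2)"
  have "\<exists>c. \<forall>w\<in>{w. Im w > 0}. F w = c"
  proof (rule has_field_derivative_zero_constant)
    show "convex {w. Im w > 0}" by (rule convex_halfspace_Im_gt)
    fix w assume "w \<in> {w. Im w > 0}"
    then have w: "Im w > 0" by simp
    then have w0: "w \<noteq> 0" "w \<notin> \<real>\<^sub>\<le>\<^sub>0" by (auto simp: complex_nonpos_Reals_iff)
    define A where "A = lambert (exp (2 * of_real pi * \<i> * w))"
    define B where "B = lambert (exp (2 * of_real pi * \<i> * (- 1 / w)))"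
    have AB: "B / w\<^sup>2 = A - 1 / 24 + 1 / (24 * w\<^sup>2) + \<i> / (4 * of_real pi * w)"
      unfolding A_def B_def by (rule lambert_inversion[OF w])
    have "((\<lambda>w. - 1 / w) has_field_derivative 1 / w\<^sup>2) (at w)"
      using w0 by (auto intro!: derivative_eq_intros simp: power2_eq_square)
    from DERIV_chain2[where f = log_eta, OF has_field_derivative_log_eta[OF Im_neg_inverse_pos[OF w]] this]
    have 1: "((\<lambda>w. log_eta (- 1 / w)) has_field_derivative of_real pi * \<i> * (1 / 12 - 2 * B) * (1 / w\<^sup>2)) (at w)"
      unfolding B_def .
    have 2: "(log_eta has_field_derivative of_real pi * \<i> * (1 / 12 - 2 * A)) (at w)"
      unfolding A_def by (rule has_field_derivative_log_eta[OF w])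
    have 3: "((\<lambda>w. Ln w / 2) has_field_derivative 1 / (2 * w)) (at w)"
      using w0 by (auto intro!: derivative_eq_intros simp: field_simps)
    have "(F has_field_derivative of_real pi * \<i> * (1 / 12 - 2 * B) * (1 / w\<^sup>2) - of_real pi * \<i> * (1 / 12 - 2 * A) - 1 / (2 * w)) (at w)"
      unfolding F_def by (intro DERIV_diff 1 2 3)
    moreover have "of_real pi * \<i> * (1 / 12 - 2 * B) * (1 / w\<^sup>2) = of_real pi * \<i> * (1 / (12 * w\<^sup>2) - 2 * (B / w\<^sup>2))"
      by (simp add: left_diff_distrib right_diff_distrib diff_divide_distrib)
    moreover have "of_real pi * \<i> * (1 / (12 * w\<^sup>2) - 2 * (B / w\<^sup>2)) - of_real pi * \<i> * (1 / 12 - 2 * A) - 1 / (2 * w) = 0"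
      unfolding AB using w0 by (simp add: field_simps)
    ultimately have "(F has_field_derivative 0) (at w)" by simp
    then show "(F has_field_derivative 0) (at w within {w. Im w > 0})"
      by (rule has_field_derivative_at_within)
  qed
  then obtain c where c: "\<And>w. Im w > 0 \<Longrightarrow> F w = c" by auto
  have "F z = F \<i>" using c[OF z] c[of \<i>] by simp
  also have "\<dots> = - of_real pi * \<i> / 4" unfolding F_def by (simp add: divide_i)
  finally show ?thesis unfolding F_def by (simp add: algebra_simps)
qed

lemma log_eta_translation:
  "log_eta (z + of_int t) = log_eta z + of_real pi * \<i> * of_int t / 12"
proof -
  have "exp (2 * of_real pi * \<i> * (z + of_int t)) = exp (2 * of_real pi * \<i> * z)"
  proof -
    have "exp (2 * of_real pi * \<i> * of_int t) = 1"
      using exp_integer_2pi[of "of_int t"] by (simp add: mult_ac)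
    then show ?thesis by (simp add: distrib_left exp_add)
  qed
  then show ?thesis unfolding log_eta_def by (simp add: field_simps)
qed

text \<open>
  The arguments of \<open>w\<close> and \<open>v\<close> add up to a value strictly between \<open>\<pi>\<close> and \<open>2 \<pi>\<close>, which exceeds
  the principal argument of \<open>- (w v)\<close> by \<open>\<pi>\<close>.
\<close>

lemma Ln_upper_product:
  assumes w: "Im w > 0" and v: "Im v > 0" and wv: "Im (w * v) < 0"
  shows "Ln w + Ln v = Ln (- (w * v)) + of_real pi * \<i>"
proof -
  have nz: "w \<noteq> 0" "v \<noteq> 0" using w v by auto
  have *: "0 < Im (Ln w)" "Im (Ln w) < pi" "0 < Im (Ln v)" "Im (Ln v) < pi"
    using w v Im_Ln_pos_lt_imp by (auto simp: Im_Ln_pos_lt[OF nz(1)] Im_Ln_pos_lt[OF nz(2)])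
  have "exp (Ln w + Ln v - of_real pi * \<i>) = - (w * v)"
    using nz by (simp add: exp_diff exp_add)
  then have "Ln (- (w * v)) = Ln w + Ln v - of_real pi * \<i>"
    using * by (intro Ln_unique) auto
  then show ?thesis by simp
qed

lemma Im_moebius_int_pos:
  fixes a b c d :: int
  assumes det: "a * d - b * c = 1" and z: "Im z > 0"
  shows "Im ((of_int a * z + of_int b) / (of_int c * z + of_int d)) > 0"
proof -
  have "Im ((of_int a * z + of_int b) / (of_int c * z + of_int d)) = of_int (a * d - b * c) * Im z / (norm (of_int c * z + of_int d))\<^sup>2"
    unfolding Im_divide cmod_power2 by (simp add: algebra_simps)
  moreover have "norm (of_int c * z + of_int d) \<noteq> 0"
  proof
    assume "norm (of_int c * z + of_int d) = 0"
    then have *: "of_int c * z + of_int d = 0" by simp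
    from arg_cong[OF this, of Im] z have "c = 0" by simp
    with * det show False by simp
  qed
  ultimately show ?thesis using z det by (simp add: divide_pos_pos)
qed

text \<open>
  Induction on \<open>c\<close> along the Euclidean algorithm for \<open>(a, c)\<close>. A translation reduces \<open>a\<close> modulo \<open>c\<close>. If the
  result \<open>a0\<close> is nonzero, an inversion replaces the bottom row \<open>(c, d)\<close> by \<open>(a0, b0)\<close> with
  \<open>0 < a0 < c\<close>, and the change of the constant is the reciprocity law. If it is zero, then \<open>c = 1\<close> and
  the formula is the inversion formula itself. All values of \<open>Ln\<close> are taken in the upper half-plane,
  which keeps track of the branch.
\<close>

theorem log_eta_transformation:
  fixes a b c d :: int
  assumes "c > 0" "a * d - b * c = 1" "Im z > 0"
  shows "log_eta ((of_int a * z + of_int b) / (of_int c * z + of_int d)) = 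
    log_eta z + Ln (of_int c * z + of_int d) / 2
     + of_real pi * \<i> * (of_rat ((of_int a + of_int d) / (12 * of_int c) - dedekind_sum a c) - 1 / 4)"
  using assms
proof (induction "nat c" arbitrary: a b c d rule: less_induct)
  case less
  define t where "t = a div c"
  define a0 where "a0 = a mod c"
  define b0 where "b0 = b - d * t"
  have a: "a = a0 + c * t" unfolding a0_def t_def by simp
  have b: "b = b0 + d * t" unfolding b0_def by simp
  have det0: "a0 * d - b0 * c = 1" using less.prems(2) unfolding a b by (simp add: algebra_simps)
  have a0: "0 \<le> a0" "a0 < c" using less.prems(1) unfolding a0_def by auto
  define w where "w = of_int c * z + of_int d"
  define v where "v = of_int a0 * z + of_int b0"
  have w: "Im w > 0" using less.prems unfolding w_def by simp
  then have w0: "w \<noteq> 0" by auto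
  have "of_int a * z + of_int b = v + w * of_int t"
    unfolding a b v_def w_def by (simp add: algebra_simps)
  then have "(of_int a * z + of_int b) / w = v / w + of_int t"
    using w0 by (simp add: add_divide_distrib)
  then have 1: "log_eta ((of_int a * z + of_int b) / w) = log_eta (v / w) + of_real pi * \<i> * of_int t / 12"
    by (simp add: log_eta_translation)
  have ds: "dedekind_sum a c = dedekind_sum a0 c"
    by (rule dedekind_sum_mod) (use less.prems in \<open>auto simp: a0_def\<close>)
  have 2: "(of_int a + of_int d) / (12 * of_int c) = (of_int a0 + of_int d) / (12 * of_int c) + (of_int t / 12 :: rat)"
    unfolding a using less.prems(1) by (simp add: field_simps)
  have "log_eta (v / w) = log_eta z + Ln w / 2
     + of_real pi * \<i> * (of_rat ((of_int a0 + of_int d) / (12 * of_int c) - dedekind_sum a0 c) - 1 / 4)"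
  proof (cases "a0 = 0")
    case True
    then have "c * (- b0) = 1" using det0 by (simp add: mult.commute)
    then have "c = 1 \<and> - b0 = 1" unfolding pos_zmult_eq_1_iff[OF less.prems(1)] .
    then have "c = 1" "b0 = - 1" by auto
    then have "v / w = - 1 / w" "w = z + of_int d" using True unfolding v_def w_def by simp_all
    moreover have "dedekind_sum a0 c = 0" unfolding dedekind_sum_def \<open>c = 1\<close> by simp
    moreover have "log_eta (- 1 / w) = (log_eta z + of_real pi * \<i> * of_int d / 12) + Ln w / 2 - of_real pi * \<i> / 4"
      unfolding log_eta_inversion[OF w] using log_eta_translation[of z d] \<open>w = z + of_int d\<close> by simp
    ultimately show ?thesis
      using True \<open>c = 1\<close> by (simp add: of_rat_divide right_diff_distrib)
  next
    case False
    then have a00: "a0 > 0" using a0 by simp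
    \<comment> \<open>The image of \<open>z\<close> under the matrix with bottom row \<open>(a0, b0)\<close> that the inversion maps to \<open>v / w\<close>.\<close>
    define u where "u = (of_int (- c) * z + of_int (- d)) / v"
    have v: "Im v > 0" using a00 less.prems unfolding v_def by simp
    then have v0: "v \<noteq> 0" by auto
    have det1: "(- c) * b0 - (- d) * a0 = 1" using det0 by (simp add: algebra_simps)
    have u: "Im u > 0" unfolding u_def v_def by (rule Im_moebius_int_pos[OF det1 less.prems(3)])
    have IH: "log_eta u = log_eta z + Ln v / 2
       + of_real pi * \<i> * (of_rat ((of_int (- c) + of_int b0) / (12 * of_int a0) - dedekind_sum (- c) a0) - 1 / 4)"
      unfolding u_def v_def using less.hyps[OF _ a00 det1 less.prems(3)] a0 a00 by simp
    have uv: "u * v = - w" unfolding u_def w_def using v0 by simp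
    then have "u = - w / v" using v0 by (metis nonzero_mult_div_cancel_right)
    then have "v / w = - 1 / u" by simp
    then have vw: "log_eta (v / w) = log_eta u + Ln u / 2 - of_real pi * \<i> / 4"
      using log_eta_inversion[OF u] by simp
    have Lu: "Ln u = Ln w + of_real pi * \<i> - Ln v"
      using Ln_upper_product[OF u v] uv w by (simp add: eq_diff_eq)
    have "log_eta u + Ln u / 2 = log_eta z + (Ln w + of_real pi * \<i>) / 2
       + of_real pi * \<i> * (of_rat ((of_int (- c) + of_int b0) / (12 * of_int a0) - dedekind_sum (- c) a0) - 1 / 4)"
      unfolding IH Lu by (simp add: add_divide_distrib diff_divide_distrib)
    also have "(of_int (- c) + of_int b0) / (12 * of_int a0) - dedekind_sum (- c) a0 = 
       (of_int a0 + of_int d) / (12 * of_int c) - dedekind_sum a0 c - 1/4"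
    proof -
      have co: "coprime a0 c"
      proof (rule coprimeI)
        fix e assume "e dvd a0" "e dvd c"
        then have "e dvd a0 * d - b0 * c" by simp
        then show "e dvd 1" using det0 by simp
      qed
      have m1: "dedekind_sum (- c) a0 = - dedekind_sum c a0"
        by (rule dedekind_sum_uminus[OF a00]) (use co in \<open>simp add: coprime_commute\<close>)
      have m2: "dedekind_sum c a0 = - 1/4 + (of_int a0 / of_int c + of_int c / of_int a0 + 1 / (of_int a0 * of_int c)) / 12 - dedekind_sum a0 c"
        using dedekind_reciprocity[OF a00 less.prems(1) co] by (simp add: algebra_simps)
      have "(1::rat) = of_int a0 * of_int d - of_int b0 * of_int c"
        using arg_cong[OF det0, of "of_int :: int \<Rightarrow> rat"] by simp
      then have m3: "(1::rat) / (of_int a0 * of_int c) = of_int d / of_int c - of_int b0 / of_int a0"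
        using a00 less.prems(1) by (simp add: field_simps)
      have m4: "(of_int (- c) + of_int b0) / (12 * of_int a0) = (of_int b0 / of_int a0 - of_int c / of_int a0) / (12::rat)"
        "(of_int a0 + of_int d) / (12 * of_int c) = (of_int a0 / of_int c + of_int d / of_int c) / (12::rat)"
        by (simp_all add: diff_divide_distrib[symmetric] add_divide_distrib[symmetric])
      show ?thesis unfolding m4 m1 m2 m3 by (simp only: add_divide_distrib diff_divide_distrib)
    qed
    finally show ?thesis unfolding vw by (simp add: of_rat_diff of_rat_add of_rat_divide add_divide_distrib algebra_simps)
  qed
  then show ?case
    unfolding w_def[symmetric] 1 ds 2 by (simp add: of_rat_add of_rat_diff of_rat_divide algebra_simps)
qed

section \<open>Constant terms at the cusp\<close>

lemma Ray_in_upper_half_plane: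
  "z \<in> upper_half_plane \<Longrightarrow> t \<ge> 0 \<Longrightarrow> z + \<i> * of_real t \<in> upper_half_plane"
  by (simp add: upper_half_plane_def)

lemma open_upper_half_plane: "open upper_half_plane"
  unfolding upper_half_plane_def by (rule open_halfspace_Im_gt)

lemma convex_upper_half_plane: "convex upper_half_plane"
  unfolding upper_half_plane_def by (rule convex_halfspace_Im_gt)

lemma i_in_upper_half_plane: "\<i> \<in> upper_half_plane"
  by (simp add: upper_half_plane_def)

text \<open>
  Factor \<open>exp (2 \<pi> \<i> (z + \<i> t) n / N) = exp (2 \<pi> \<i> z n / N) s\<^sup>n\<close> with \<open>0 < s \<le> 1\<close>; every term with \<open>n \<ge> 1\<close>
  contains at least one factor \<open>s\<close>, and the rest converges absolutely.
\<close>

lemma q_expansion_decay: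
  assumes f: "has_q_expansion f N a" and z: "z \<in> upper_half_plane"
  shows "\<exists>K c. c > 0 \<and> (\<forall>t\<ge>0. norm (f (z + \<i> * of_real t) - a 0) \<le> K * exp (- c * t))"
proof -
  have N: "N > 0" using f by (simp add: has_q_expansion_def)
  define e where "e = (\<lambda>w::complex. exp (2 * of_real pi * \<i> * w / of_nat N))"
  have sums: "(\<lambda>n. a n * e w ^ n) sums f w" if "w \<in> upper_half_plane" for w
  proof -
    have "e w ^ n = exp (2 * of_real pi * \<i> * of_nat n * w / of_nat N)" for n
      unfolding e_def exp_of_nat_mult[symmetric] by (simp add: mult_ac)
    then show ?thesis using f that unfolding has_q_expansion_def by simp
  qed
  define c where "c = 2 * pi / N"
  have c: "c > 0" unfolding c_def using N by simp
  have norm_e: "norm (e w) = exp (- c * Im w)" for w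
    unfolding e_def c_def by (simp add: Re_divide_of_nat)
  have e_add: "e (z + \<i> * of_real t) = e z * of_real (exp (- c * t))" for t
    unfolding e_def c_def exp_of_real[symmetric] exp_add[symmetric] by (simp add: algebra_simps diff_divide_distrib)
  \<comment> \<open>Halving \<open>z\<close> enlarges the modulus of the nome; convergence there makes the series at \<open>z\<close> absolutely convergent.\<close>
  have z2: "z / 2 \<in> upper_half_plane" using z by (simp add: upper_half_plane_def)
  have "norm (e z) < norm (e (z / 2))"
    unfolding norm_e using c z by (simp add: upper_half_plane_def)
  then have "summable (\<lambda>n. norm (a n * e z ^ n))"
    using powser_insidea[of a "e (z / 2)" "e z"] sums[OF z2] sums_summable by blast
  then have summ: "summable (\<lambda>n. norm (a (Suc n) * e z ^ Suc n))"
    by (subst summable_Suc_iff)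
  define K where "K = (\<Sum>n. norm (a (Suc n) * e z ^ Suc n))"
  have "norm (f (z + \<i> * of_real t) - a 0) \<le> K * exp (- c * t)" if t: "t \<ge> 0" for t
  proof -
    define s where "s = exp (- c * t)"
    have s: "0 < s" "s \<le> 1" unfolding s_def using c t by auto
    have "(\<lambda>n. a n * (e z * of_real s) ^ n) sums f (z + \<i> * of_real t)"
      using sums[OF Ray_in_upper_half_plane[OF z t]] unfolding e_add s_def .
    then have "(\<lambda>n. a (Suc n) * (e z * of_real s) ^ Suc n) sums (f (z + \<i> * of_real t) - a 0)"
      by (subst sums_Suc_iff) simp
    then have eq: "f (z + \<i> * of_real t) - a 0 = (\<Sum>n. a (Suc n) * (e z * of_real s) ^ Suc n)"
      by (simp add: sums_iff)
    have "norm (\<Sum>n. a (Suc n) * (e z * of_real s) ^ Suc n) \<le> (\<Sum>n. norm (a (Suc n) * e z ^ Suc n) * s)"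
    proof (rule norm_suminf_le)
      fix n
      have "s ^ Suc n \<le> s" using s by (simp add: mult_left_le power_le_one)
      then show "norm (a (Suc n) * (e z * of_real s) ^ Suc n) \<le> norm (a (Suc n) * e z ^ Suc n) * s"
        using s by (simp add: power_mult_distrib norm_mult norm_power mult.assoc mult_left_mono del: power_Suc)
    qed (intro summable_mult2 summ)
    also have "\<dots> = K * s" unfolding K_def by (rule suminf_mult2[OF summ, symmetric])
    finally show ?thesis unfolding eq s_def .
  qed
  with c show ?thesis by blast
qed

lemma exp_decay_tendsto_0: "c > 0 \<Longrightarrow> ((\<lambda>t. K * exp (- c * t)) \<longlongrightarrow> (0::real)) at_top"
  by (intro tendsto_mult_right_zero filterlim_compose[OF exp_at_bot]
      filterlim_tendsto_neg_mult_at_bot[OF tendsto_const _ filterlim_ident]) auto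

lemma q_expansion_tendsto:
  assumes f: "has_q_expansion f N a" and z: "z \<in> upper_half_plane"
  shows "((\<lambda>t. f (z + \<i> * of_real t)) \<longlongrightarrow> a 0) at_top"
proof -
  obtain K c where c: "c > 0" and K: "\<And>t. t \<ge> 0 \<Longrightarrow> norm (f (z + \<i> * of_real t) - a 0) \<le> K * exp (- c * t)"
    using q_expansion_decay[OF assms] by blast
  have "((\<lambda>t. f (z + \<i> * of_real t) - a 0) \<longlongrightarrow> 0) at_top"
    by (rule Lim_null_comparison[OF _ exp_decay_tendsto_0[OF c, of K]])
       (use K in \<open>auto intro: eventually_at_top_linorderI[of 0]\<close>)
  then show ?thesis by (simp add: LIM_zero_iff)
qed

text \<open>
  All expansions of \<open>f\<close>, of whatever width, have the same constant term, because it is the limit of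
  \<open>f\<close> along a vertical ray.
\<close>

lemma const_term_eq:
  assumes f: "has_q_expansion f N a"
  shows "const_term f = a 0"
  unfolding const_term_def
proof (rule the_equality)
  show "\<exists>N' a'. has_q_expansion f N' a' \<and> a 0 = a' 0" using f by blast
  fix c assume "\<exists>N a. has_q_expansion f N a \<and> c = a 0"
  then obtain N' a' where a': "has_q_expansion f N' a'" "c = a' 0" by blast
  show "c = a 0"
    unfolding a'(2)
    by (rule tendsto_unique[OF _ q_expansion_tendsto[OF a'(1) i_in_upper_half_plane] q_expansion_tendsto[OF f i_in_upper_half_plane]]) simp
qed

text \<open>
  The expansion of \<open>f (P z / Q + s)\<close> in the width \<open>N Q\<close> is supported on the multiples of \<open>P\<close>. The case
  \<open>P = Q\<close>, \<open>s = 0\<close> re-expands \<open>f\<close> in a larger width, which allows to bring two forms to a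
  common width.
\<close>

lemma q_expansion_affine:
  assumes f: "has_q_expansion f N a" and P: "P > 0" and Q: "Q > 0"
  shows "has_q_expansion (\<lambda>z. f (of_nat P / of_nat Q * z + of_real s)) (N * Q)
           (\<lambda>m. if P dvd m then a (m div P) * exp (2 * of_real pi * \<i> * of_nat (m div P) * of_real s / of_nat N) else 0)"
  unfolding has_q_expansion_def
proof (intro conjI ballI)
  show "0 < N * Q" using f Q by (simp add: has_q_expansion_def)
  fix z assume z: "z \<in> upper_half_plane"
  define w where "w = of_nat P / of_nat Q * z + of_real s"
  have w: "w \<in> upper_half_plane" 
    using z P Q unfolding w_def upper_half_plane_def by (simp add: Im_divide_of_nat)
  have N: "N > 0" using f by (simp add: has_q_expansion_def)
  let ?b = "\<lambda>m. (if P dvd m then a (m div P) * exp (2 * of_real pi * \<i> * of_nat (m div P) * of_real s / of_nat N) else 0)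
      * exp (2 * of_real pi * \<i> * of_nat m * z / of_nat (N * Q))"
  have "strict_mono (\<lambda>n. P * n)" using P by (intro strict_monoI) simp
  moreover have "?b m = 0" if "m \<notin> range (\<lambda>n. P * n)" for m
  proof -
    have "\<not> P dvd m" using that by (auto elim: dvdE)
    then show ?thesis by simp
  qed
  moreover have "(\<lambda>n. ?b (P * n)) sums f w"
  proof -
    have "?b (P * n) = a n * exp (2 * of_real pi * \<i> * of_nat n * w / of_nat N)" for n
    proof -
      have "2 * of_real pi * \<i> * of_nat n * w / of_nat N = 
        2 * of_real pi * \<i> * of_nat n * of_real s / of_nat N + 2 * of_real pi * \<i> * of_nat (P * n) * z / of_nat (N * Q)"
        unfolding w_def using N Q by (simp add: field_simps)
      then show ?thesis using P by (simp only: exp_add) simp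
    qed
    then show ?thesis using f w unfolding has_q_expansion_def by simp
  qed
  ultimately show "?b sums f (of_nat P / of_nat Q * z + of_real s)"
    unfolding w_def[symmetric] by (subst (asm) sums_mono_reindex) 
qed

lemma q_expansion_cmult:
  "has_q_expansion f N a \<Longrightarrow> has_q_expansion (\<lambda>z. c * f z) N (\<lambda>n. c * a n)"
  unfolding has_q_expansion_def by (auto simp: mult.assoc intro!: sums_mult)

lemma q_expansion_diff:
  assumes f: "has_q_expansion f N a" and g: "has_q_expansion g M b"
  shows "\<exists>L c. has_q_expansion (\<lambda>z. f z - g z) L c \<and> c 0 = a 0 - b 0"
proof -
  have pos: "N > 0" "M > 0" using f g by (auto simp: has_q_expansion_def)
  obtain a' where a': "has_q_expansion f (N * M) a'" "a' 0 = a 0"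
    using q_expansion_affine[OF f pos(2) pos(2), of 0] pos by auto
  obtain b' where b': "has_q_expansion g (N * M) b'" "b' 0 = b 0"
    using q_expansion_affine[OF g pos(1) pos(1), of 0] pos by (auto simp: mult.commute)
  have "has_q_expansion (\<lambda>z. f z - g z) (N * M) (\<lambda>n. a' n - b' n)"
    using a' b' unfolding has_q_expansion_def by (auto simp: left_diff_distrib intro!: sums_diff)
  with a' b' show ?thesis by (intro exI[of _ "N * M"] exI[of _ "\<lambda>n. a' n - b' n"]) auto
qed

text \<open>
  \<open>F\<close> is a primitive of \<open>f\<close>, and \<open>f\<close> has a q-expansion with constant term \<open>A\<close>. Then \<open>F z = A z + C + o(1)\<close>
  at the cusp, and \<open>C\<close>, the constant term of the primitive, is the quantity that \<open>GV\<close> measures.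
\<close>

definition cusp_primitive :: "(complex \<Rightarrow> complex) \<Rightarrow> (complex \<Rightarrow> complex) \<Rightarrow> complex \<Rightarrow> complex \<Rightarrow> bool" where
  "cusp_primitive F f A C \<longleftrightarrow>
     (\<forall>z\<in>upper_half_plane. (F has_field_derivative f z) (at z)) \<and>
     (\<exists>N a. has_q_expansion f N a \<and> a 0 = A) \<and>
     (\<forall>z\<in>upper_half_plane. ((\<lambda>t. F (z + \<i> * of_real t) - A * (z + \<i> * of_real t)) \<longlongrightarrow> C) at_top)"

lemma cusp_primitive_const_term: "cusp_primitive F f A C \<Longrightarrow> const_term f = A"
  unfolding cusp_primitive_def using const_term_eq by blast

lemma cusp_primitive_diff:
  assumes "cusp_primitive F f A C" "cusp_primitive G g B D"
  shows "cusp_primitive (\<lambda>z. F z - G z) (\<lambda>z. f z - g z) (A - B) (C - D)"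
  unfolding cusp_primitive_def
proof (intro conjI ballI)
  show "\<exists>N a. has_q_expansion (\<lambda>z. f z - g z) N a \<and> a 0 = A - B"
    using assms q_expansion_diff unfolding cusp_primitive_def by metis
  fix z assume z: "z \<in> upper_half_plane"
  show "((\<lambda>z. F z - G z) has_field_derivative f z - g z) (at z)"
    using assms z unfolding cusp_primitive_def by (intro DERIV_diff) auto
  have "((\<lambda>t. (F (z + \<i> * of_real t) - A * (z + \<i> * of_real t)) - (G (z + \<i> * of_real t) - B * (z + \<i> * of_real t))) \<longlongrightarrow> C - D) at_top"
    using assms z unfolding cusp_primitive_def by (intro tendsto_diff) auto
  then show "((\<lambda>t. F (z + \<i> * of_real t) - G (z + \<i> * of_real t) - (A - B) * (z + \<i> * of_real t)) \<longlongrightarrow> C - D) at_top"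
    by (simp add: algebra_simps)
qed

lemma cusp_primitive_cmult:
  assumes "cusp_primitive F f A C"
  shows "cusp_primitive (\<lambda>z. c * F z) (\<lambda>z. c * f z) (c * A) (c * C)"
  unfolding cusp_primitive_def
proof (intro conjI ballI)
  show "\<exists>N a. has_q_expansion (\<lambda>z. c * f z) N a \<and> a 0 = c * A"
    using assms q_expansion_cmult unfolding cusp_primitive_def by metis
  fix z assume z: "z \<in> upper_half_plane"
  show "((\<lambda>z. c * F z) has_field_derivative c * f z) (at z)"
    using assms z unfolding cusp_primitive_def by (intro DERIV_cmult) auto
  have "((\<lambda>t. c * (F (z + \<i> * of_real t) - A * (z + \<i> * of_real t))) \<longlongrightarrow> c * C) at_top"
    using assms z unfolding cusp_primitive_def by (intro tendsto_mult_left) auto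
  then show "((\<lambda>t. c * F (z + \<i> * of_real t) - c * A * (z + \<i> * of_real t)) \<longlongrightarrow> c * C) at_top"
    by (simp add: algebra_simps)
qed

lemma cusp_primitive_add_const:
  assumes "cusp_primitive F f A C"
  shows "cusp_primitive (\<lambda>z. k + F z) f A (k + C)"
  unfolding cusp_primitive_def
proof (intro conjI ballI)
  show "\<exists>N a. has_q_expansion f N a \<and> a 0 = A"
    using assms unfolding cusp_primitive_def by blast
  fix z assume z: "z \<in> upper_half_plane"
  show "((\<lambda>z. k + F z) has_field_derivative f z) (at z)"
    using assms z unfolding cusp_primitive_def by (auto intro!: derivative_eq_intros)
  have "((\<lambda>t. k + (F (z + \<i> * of_real t) - A * (z + \<i> * of_real t))) \<longlongrightarrow> k + C) at_top"
    using assms z unfolding cusp_primitive_def by (intro tendsto_add tendsto_const) auto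
  then show "((\<lambda>t. k + F (z + \<i> * of_real t) - A * (z + \<i> * of_real t)) \<longlongrightarrow> k + C) at_top"
    by (simp add: algebra_simps)
qed

lemma cusp_primitive_affine:
  assumes F: "cusp_primitive F f A C" and P: "P > 0" and Q: "Q > 0"
  defines "r \<equiv> of_nat P / of_nat Q"
  shows "cusp_primitive (\<lambda>z. F (r * z + of_real s)) (\<lambda>z. r * f (r * z + of_real s)) (r * A) (C + A * of_real s)"
  unfolding cusp_primitive_def
proof (intro conjI ballI)
  obtain N a where a: "has_q_expansion f N a" "a 0 = A"
    using F unfolding cusp_primitive_def by blast
  show "\<exists>N a. has_q_expansion (\<lambda>z. r * f (r * z + of_real s)) N a \<and> a 0 = r * A"
    using q_expansion_cmult[OF q_expansion_affine[OF a(1) P Q, of s], of r, folded r_def] a(2) by force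
  define \<rho> where "\<rho> = real P / real Q"
  have r: "r = of_real \<rho>" "\<rho> > 0" unfolding r_def \<rho>_def using P Q by auto
  fix z assume z: "z \<in> upper_half_plane"
  define w where "w = r * z + of_real s"
  have w: "w \<in> upper_half_plane" 
    using z r unfolding w_def upper_half_plane_def by simp
  have "(F has_field_derivative f w) (at w)" using F w unfolding cusp_primitive_def by blast
  moreover have "((\<lambda>z. r * z + of_real s) has_field_derivative r) (at z)"
    by (auto intro!: derivative_eq_intros)
  ultimately show "((\<lambda>z. F (r * z + of_real s)) has_field_derivative r * f (r * z + of_real s)) (at z)"
    unfolding w_def using DERIV_chain2[of F] by (metis mult.commute)
  have "filterlim (\<lambda>t. \<rho> * t) at_top at_top"
    using r(2) by (intro filterlim_tendsto_pos_mult_at_top[OF tendsto_const] filterlim_ident) auto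
  moreover have "((\<lambda>t. F (w + \<i> * of_real t) - A * (w + \<i> * of_real t)) \<longlongrightarrow> C) at_top"
    using F w unfolding cusp_primitive_def by blast
  ultimately have "((\<lambda>t. F (w + \<i> * of_real (\<rho> * t)) - A * (w + \<i> * of_real (\<rho> * t))) \<longlongrightarrow> C) at_top"
    by (rule filterlim_compose[rotated])
  then have "((\<lambda>t. F (w + \<i> * of_real (\<rho> * t)) - A * (w + \<i> * of_real (\<rho> * t)) + A * of_real s) \<longlongrightarrow> C + A * of_real s) at_top"
    by (intro tendsto_add tendsto_const)
  moreover have "F (w + \<i> * of_real (\<rho> * t)) - A * (w + \<i> * of_real (\<rho> * t)) + A * of_real s = 
     F (r * (z + \<i> * of_real t) + of_real s) - r * A * (z + \<i> * of_real t)" for t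
  proof -
    have "w + \<i> * of_real (\<rho> * t) = r * (z + \<i> * of_real t) + of_real s"
      unfolding w_def r(1) by (simp add: algebra_simps)
    then show ?thesis by (simp add: algebra_simps)
  qed
  ultimately show "((\<lambda>t. F (r * (z + \<i> * of_real t) + of_real s) - r * A * (z + \<i> * of_real t)) \<longlongrightarrow> C + A * of_real s) at_top"
    by simp
qed

text \<open>
  Used to recognise \<open>GV_mu\<close> and its slash transforms: their q-expansions are those of the derivatives
  of functions that agree with the given primitive on the upper half-plane.
\<close>

lemma cusp_primitive_transfer:
  assumes F: "cusp_primitive F f A C" and eq: "\<And>z. z \<in> upper_half_plane \<Longrightarrow> F z = G z"
    and G: "\<And>z. z \<in> upper_half_plane \<Longrightarrow> (G has_field_derivative g z) (at z)"
  shows "cusp_primitive G g A C"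
  unfolding cusp_primitive_def
proof (intro conjI ballI)
  have fg: "f z = g z" if z: "z \<in> upper_half_plane" for z
  proof (rule DERIV_unique[OF _ G[OF z]])
    show "(G has_field_derivative f z) (at z)"
      by (rule has_field_derivative_transform_within_open[OF _ open_upper_half_plane z eq])
         (use F z in \<open>auto simp: cusp_primitive_def\<close>)
  qed
  then show "\<exists>N a. has_q_expansion g N a \<and> a 0 = A"
    using F unfolding cusp_primitive_def has_q_expansion_def by auto
  fix z assume z: "z \<in> upper_half_plane"
  show "(G has_field_derivative g z) (at z)" by (rule G[OF z])
  have "((\<lambda>t. F (z + \<i> * of_real t) - A * (z + \<i> * of_real t)) \<longlongrightarrow> C) at_top"
    using F z unfolding cusp_primitive_def by blast
  then show "((\<lambda>t. G (z + \<i> * of_real t) - A * (z + \<i> * of_real t)) \<longlongrightarrow> C) at_top"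
    by (rule Lim_transform_eventually)
       (use eq Ray_in_upper_half_plane[OF z] in \<open>auto intro!: eventually_at_top_linorderI[of 0]\<close>)
qed

text \<open>
  Fundamental theorem of calculus on \<open>[0, k]\<close> and dominated convergence for \<open>k \<longlonglongrightarrow> \<infinity>\<close>; the majorant is
  supplied by \<open>q_expansion_decay\<close>.
\<close>

lemma ray_integral_cusp_primitive:
  assumes F: "cusp_primitive F f A C" and z: "z \<in> upper_half_plane"
  shows "ray_integral z (\<lambda>w. f w - A) = C - (F z - A * z)"
proof -
  define G where "G = (\<lambda>t. F (z + \<i> * of_real t) - A * (z + \<i> * of_real t))"
  define g where "g = (\<lambda>t. (f (z + \<i> * of_real t) - A) * \<i>)"
  obtain N a where a: "has_q_expansion f N a" "a 0 = A"
    using F unfolding cusp_primitive_def by blast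
  obtain K c where c: "c > 0" and K: "\<And>t. t \<ge> 0 \<Longrightarrow> norm (f (z + \<i> * of_real t) - A) \<le> K * exp (- c * t)"
    using q_expansion_decay[OF a(1) z] a(2) by blast
  have dG: "(G has_vector_derivative g t) (at t within S)" if "t \<ge> 0" for t S
  proof -
    have "(F has_field_derivative f (z + \<i> * of_real t)) (at (z + \<i> * of_real t))"
      using F Ray_in_upper_half_plane[OF z that] unfolding cusp_primitive_def by blast
    then have "((\<lambda>w. F w - A * w) has_field_derivative f (z + \<i> * of_real t) - A) (at (z + \<i> * of_real t))"
      by (auto intro!: derivative_eq_intros)
    moreover have "((\<lambda>t. z + \<i> * of_real t) has_vector_derivative \<i>) (at t within S)"
      by (auto intro!: derivative_eq_intros)
    ultimately have "(((\<lambda>w. F w - A * w) \<circ> (\<lambda>t. z + \<i> * of_real t)) has_vector_derivative \<i> * (f (z + \<i> * of_real t) - A)) (at t within S)"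
      by (rule field_vector_diff_chain_within[rotated, OF has_field_derivative_at_within])
    then show ?thesis unfolding G_def g_def o_def by (simp add: mult.commute)
  qed
  have "(g has_integral (C - G 0)) {0..}"
  proof (rule has_integral_dominated_convergence)
    fix k :: nat
    have "(g has_integral (G (real k) - G 0)) {0..real k}"
      by (rule fundamental_theorem_of_calculus) (use dG in auto)
    then show "((\<lambda>t. if t \<in> {0..real k} then g t else 0) has_integral (G (real k) - G 0)) {0..}"
      by (subst has_integral_restrict) auto
    show "\<forall>t\<in>{0..}. norm (if t \<in> {0..real k} then g t else 0) \<le> K * exp (- c * t)"
    proof
      fix t :: real assume "t \<in> {0..}"
      then have "norm (g t) \<le> K * exp (- c * t)" using K[of t] unfolding g_def by (simp add: norm_mult)
      then show "norm (if t \<in> {0..real k} then g t else 0) \<le> K * exp (- c * t)"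
        by (smt (verit) norm_ge_zero norm_zero)
    qed
  next
    show "(\<lambda>t. K * exp (- c * t)) integrable_on {0..}"
      using integrable_on_exp_minus_to_infinity[OF c, of 0] by (intro integrable_on_mult_right) auto
    show "\<forall>t\<in>{0..}. (\<lambda>k. if t \<in> {0..real k} then g t else 0) \<longlonglongrightarrow> g t"
    proof
      fix t :: real assume t: "t \<in> {0..}"
      have "eventually (\<lambda>k. real k \<ge> t) sequentially"
        using filterlim_real_sequentially unfolding filterlim_at_top by blast
      then have "eventually (\<lambda>k. g t = (if t \<in> {0..real k} then g t else 0)) sequentially"
        by eventually_elim (use t in auto)
      then show "(\<lambda>k. if t \<in> {0..real k} then g t else 0) \<longlonglongrightarrow> g t"
        by (rule Lim_transform_eventually[OF tendsto_const])
    qed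
    have "(G \<longlongrightarrow> C) at_top" using F z unfolding G_def cusp_primitive_def by blast
    from filterlim_compose[OF this filterlim_real_sequentially]
    show "(\<lambda>k. G (real k) - G 0) \<longlonglongrightarrow> C - G 0" by (intro tendsto_diff tendsto_const)
  qed
  from integral_unique[OF this] show ?thesis 
    unfolding ray_integral_def g_def G_def by (simp only: of_real_0 mult_zero_right add_0_right)
qed

text \<open>
  With \<open>f = \<mu>\<^bsub>\<gamma>1\<^esub>\<close>, \<open>f' = \<mu>\<^bsub>\<gamma>1\<^esub> | \<gamma>2\<close>, \<open>M' = M \<circ> \<gamma>2\<close> and \<open>w = \<gamma>2 z\<close> the left-hand side is the definition of
  \<open>GV\<close> at the base point \<open>z\<close>; all values at \<open>z\<close> and \<open>w\<close> cancel.
\<close>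

lemma GV_value:
  assumes M: "cusp_primitive M f A C" and M': "cusp_primitive M' f' A' C'"
    and z: "z \<in> upper_half_plane" and w: "w \<in> upper_half_plane" and zw: "M' z = M w"
  shows "contour_integral (linepath z w) f + z * const_term (\<lambda>z. f z - f' z)
     + ray_integral z (\<lambda>z. drop_const f' z - drop_const f z) = C' - C"
proof -
  have "(f has_contour_integral M (pathfinish (linepath z w)) - M (pathstart (linepath z w))) (linepath z w)"
  proof (rule contour_integral_primitive[where S = upper_half_plane])
    show "(M has_field_derivative f x) (at x within upper_half_plane)" if "x \<in> upper_half_plane" for x
      using M that unfolding cusp_primitive_def by (blast intro: has_field_derivative_at_within)
    show "path_image (linepath z w) \<subseteq> upper_half_plane"
      using closed_segment_subset[OF z w convex_upper_half_plane] by simp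
  qed simp
  then have 1: "contour_integral (linepath z w) f = M w - M z"
    by (simp add: contour_integral_unique)
  have 2: "const_term (\<lambda>z. f z - f' z) = A - A'"
    by (rule cusp_primitive_const_term[OF cusp_primitive_diff[OF M M']])
  have "(\<lambda>z. drop_const f' z - drop_const f z) = (\<lambda>z. (f' z - f z) - (A' - A))"
    unfolding drop_const_def cusp_primitive_const_term[OF M] cusp_primitive_const_term[OF M'] by auto
  then have 3: "ray_integral z (\<lambda>z. drop_const f' z - drop_const f z) = (C' - C) - ((M' z - M z) - (A' - A) * z)"
    using ray_integral_cusp_primitive[OF cusp_primitive_diff[OF M' M] z] by simp
  show ?thesis unfolding 1 2 3 zw by (simp add: algebra_simps)
qed

text \<open>
  The q-expansion of the derivative is obtained without computing its coefficients: as a function of \<open>q\<close>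
  it is holomorphic in the unit disc, hence equal to its Taylor series at \<open>0\<close>.
\<close>

lemma cusp_primitive_log_eta:
  "cusp_primitive log_eta (\<lambda>z. of_real pi * \<i> * (1 / 12 - 2 * lambert (exp (2 * of_real pi * \<i> * z)))) (of_real pi * \<i> / 12) 0"
  unfolding cusp_primitive_def
proof (intro conjI ballI)
  define h where "h = (\<lambda>w. of_real pi * \<i> * (1 / 12 + 2 * (w * deriv euler_log w)))"
  have euler: "euler_log field_differentiable (at w)" "w * deriv euler_log w = - lambert w" if "norm w < 1" for w
    using has_field_derivative_euler_log_aux[OF that] DERIV_imp_deriv 
    by (auto simp: field_differentiable_def)
  have "euler_log holomorphic_on ball 0 1"
    unfolding holomorphic_on_def using euler(1) field_differentiable_at_within by fastforce
  then have "h holomorphic_on ball 0 1"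
    unfolding h_def by (intro holomorphic_intros holomorphic_deriv) auto
  then have pow: "(\<lambda>n. (deriv ^^ n) h 0 / fact n * w ^ n) sums h w" if "norm w < 1" for w
    using holomorphic_power_series[of h 0 1 w] that by simp
  show "\<exists>N a. has_q_expansion (\<lambda>z. of_real pi * \<i> * (1 / 12 - 2 * lambert (exp (2 * of_real pi * \<i> * z)))) N a \<and> a 0 = of_real pi * \<i> / 12"
  proof (intro exI conjI)
    show "has_q_expansion (\<lambda>z. of_real pi * \<i> * (1 / 12 - 2 * lambert (exp (2 * of_real pi * \<i> * z)))) 1 (\<lambda>n. (deriv ^^ n) h 0 / fact n)"
      unfolding has_q_expansion_def
    proof (intro conjI ballI)
      fix z assume z: "z \<in> upper_half_plane"
      define q where "q = exp (2 * of_real pi * \<i> * z)"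
      have q: "norm q < 1" unfolding q_def using z by (intro norm_exp_nome) (simp add: upper_half_plane_def)
      have "exp (2 * of_real pi * \<i> * of_nat n * z / of_nat 1) = q ^ n" for n
        unfolding q_def exp_of_nat_mult[symmetric] by (simp add: mult_ac)
      moreover have "h q = of_real pi * \<i> * (1 / 12 - 2 * lambert q)"
        unfolding h_def euler(2)[OF q] by simp
      ultimately show "(\<lambda>n. (deriv ^^ n) h 0 / fact n * exp (2 * of_real pi * \<i> * of_nat n * z / of_nat 1)) sums
         (of_real pi * \<i> * (1 / 12 - 2 * lambert (exp (2 * of_real pi * \<i> * z))))"
        using pow[OF q] unfolding q_def[symmetric] by simp
    qed simp
    show "(deriv ^^ 0) h 0 / fact 0 = of_real pi * \<i> / 12" by (simp add: h_def)
  qed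
  fix z assume z: "z \<in> upper_half_plane"
  show "(log_eta has_field_derivative of_real pi * \<i> * (1 / 12 - 2 * lambert (exp (2 * of_real pi * \<i> * z)))) (at z)"
    using z by (intro has_field_derivative_log_eta) (simp add: upper_half_plane_def)
  have "isCont euler_log 0"
    using euler(1)[of 0] by (intro field_differentiable_imp_continuous_at) simp
  moreover have "euler_log 0 = 0" by (simp add: euler_log_def)
  ultimately have "(euler_log \<longlongrightarrow> 0) (nhds 0)"
    by (metis isCont_def tendsto_nhds_iff)
  moreover have "((\<lambda>t. exp (2 * of_real pi * \<i> * (z + \<i> * of_real t))) \<longlongrightarrow> 0) at_top"
  proof (rule tendsto_norm_zero_cancel)
    have "norm (exp (2 * of_real pi * \<i> * (z + \<i> * of_real t))) = exp (- 2 * pi * Im z) * exp (- (2 * pi) * t)" for t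
      by (simp add: exp_add[symmetric] algebra_simps)
    then show "((\<lambda>t. norm (exp (2 * of_real pi * \<i> * (z + \<i> * of_real t)))) \<longlongrightarrow> 0) at_top"
      using exp_decay_tendsto_0[of "2 * pi" "exp (- 2 * pi * Im z)"] by simp
  qed
  ultimately have "((\<lambda>t. euler_log (exp (2 * of_real pi * \<i> * (z + \<i> * of_real t)))) \<longlongrightarrow> 0) at_top"
    by (rule filterlim_compose)
  then show "((\<lambda>t. log_eta (z + \<i> * of_real t) - of_real pi * \<i> / 12 * (z + \<i> * of_real t)) \<longlongrightarrow> 0) at_top"
    unfolding log_eta_def by simp
qed

section \<open>Automorphy factors and the Petersson cocycle\<close>

unbundle no fps_syntax

lemma log_lower_eqI:
  assumes "exp w = z" "- pi \<le> Im w" "Im w < pi"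
  shows "log_lower z = w"
  unfolding log_lower_def
proof (rule the_equality)
  fix v assume v: "exp v = z \<and> - pi \<le> Im v \<and> Im v < pi"
  then have "exp v = exp w" using assms by simp
  then obtain n :: int where n: "v = w + of_int (2 * n) * of_real pi * \<i>"
    by (auto simp: exp_eq)
  then have "Im v = Im w + 2 * of_int n * pi" by simp
  with v assms have "\<bar>of_int n * (2 * pi)\<bar> < 1 * (2 * pi)" unfolding abs_less_iff by linarith
  then have "\<bar>of_int n :: real\<bar> < 1" unfolding abs_mult by simp
  then show "v = w" using n by simp
qed (use assms in auto)

lemma log_lower_nonreal:
  assumes "Im z \<noteq> 0"
  shows "log_lower z = Ln z"
proof (rule log_lower_eqI)
  have z: "z \<noteq> 0" using assms by auto
  show "exp (Ln z) = z" using z by simp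
  show "- pi \<le> Im (Ln z)" using mpi_less_Im_Ln[OF z] by simp
  have "Im (Ln z) \<noteq> pi" using Im_Ln_eq_pi[OF z] assms by auto
  then show "Im (Ln z) < pi" using Im_Ln_le_pi[OF z] by simp
qed

lemma log_lower_of_real_pos: "x > 0 \<Longrightarrow> log_lower (of_real x) = of_real (ln x)"
  by (rule log_lower_eqI) (auto simp: exp_of_real)

lemma log_lower_exists:
  assumes "z \<noteq> 0"
  shows "\<exists>w. exp w = z \<and> - pi \<le> Im w \<and> Im w < pi"
proof (cases "Im (Ln z) < pi")
  case True
  then show ?thesis using assms mpi_less_Im_Ln[OF assms] by (intro exI[of _ "Ln z"]) auto
next
  case False
  then have "Im (Ln z) = pi" using Im_Ln_le_pi[OF assms] by simp
  moreover have "exp (2 * of_real pi * \<i>) = 1" by (metis exp_two_pi_i mult.commute)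
  ultimately show ?thesis using assms by (intro exI[of _ "Ln z - 2 * of_real pi * \<i>"]) (auto simp: exp_diff)
qed

lemma
  assumes "z \<noteq> 0"
  shows exp_log_lower: "exp (log_lower z) = z"
    and Im_log_lower: "- pi \<le> Im (log_lower z)" "Im (log_lower z) < pi"
  using log_lower_exists[OF assms] log_lower_eqI by metis+

lemma log_lower_mult_of_real:
  assumes "x > 0" "w \<noteq> 0"
  shows "log_lower (of_real x * w) = of_real (ln x) + log_lower w"
  by (rule log_lower_eqI) (use assms Im_log_lower[of w] in \<open>auto simp: exp_add exp_log_lower exp_of_real\<close>)

lemma mobius_conv: "mobius g z = (of_real (g $ 1 $ 1) * z + of_real (g $ 1 $ 2)) / autj g z"
  unfolding mobius_def moebius_def autj_def ..

lemma matrix_mult_2: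
  fixes A B :: "'a::comm_semiring_1^2^2"
  shows "(A ** B) $ i $ j = A $ i $ 1 * B $ 1 $ j + A $ i $ 2 * B $ 2 $ j"
  by (simp add: matrix_matrix_mult_def sum_2)

lemma real_matrix_nth: "real_matrix \<gamma> $ i $ j = of_rat (\<gamma> $ i $ j)"
  by (simp add: real_matrix_def map_matrix_def)

lemma real_matrix_mult: "real_matrix (A ** B) = real_matrix A ** real_matrix B"
  by (simp add: vec_eq_iff real_matrix_nth matrix_mult_2 of_rat_add of_rat_mult)

lemma det_real_matrix: "det (real_matrix \<gamma>) = of_rat (det \<gamma>)"
  by (simp add: det_2 real_matrix_nth of_rat_mult of_rat_diff)

lemma det_real_matrix_SL2Q: "\<gamma> \<in> SL2Q \<Longrightarrow> det (real_matrix \<gamma>) = 1"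
  by (simp add: det_real_matrix SL2Q_def)

lemma SL2Q_mult: "A \<in> SL2Q \<Longrightarrow> B \<in> SL2Q \<Longrightarrow> A ** B \<in> SL2Q"
  by (simp add: SL2Q_def det_mul)

context
  fixes g :: "real^2^2"
  assumes det: "det g = 1"
begin

lemma autj_nonzero:
  assumes "z \<in> upper_half_plane"
  shows "autj g z \<noteq> 0"
proof
  assume 0: "autj g z = 0"
  then have "Im (autj g z) = 0" by simp
  then have "g $ 2 $ 1 = 0" using assms by (simp add: autj_def upper_half_plane_def)
  moreover from this have "g $ 2 $ 2 = 0" using 0 by (simp add: autj_def)
  ultimately show False using det by (simp add: det_2)
qed

lemma mobius_in_upper_half_plane:
  assumes z: "z \<in> upper_half_plane"
  shows "mobius g z \<in> upper_half_plane"
proof -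
  have "Im (mobius g z) = det g * Im z / (norm (autj g z))\<^sup>2"
    unfolding mobius_conv Im_divide cmod_power2 autj_def det_2 by (simp add: algebra_simps)
  then show ?thesis using z det autj_nonzero[OF z] by (simp add: upper_half_plane_def)
qed

lemma has_field_derivative_mobius:
  assumes z: "z \<in> upper_half_plane"
  shows "(mobius g has_field_derivative 1 / (autj g z)\<^sup>2) (at z)"
proof -
  have d: "of_real (g $ 1 $ 1) * of_real (g $ 2 $ 2) - of_real (g $ 1 $ 2) * of_real (g $ 2 $ 1) = (1 :: complex)"
    unfolding of_real_mult[symmetric] of_real_diff[symmetric] using det by (simp add: det_2)
  have "((\<lambda>z. (of_real (g $ 1 $ 1) * z + of_real (g $ 1 $ 2)) / autj g z) has_field_derivative
     (of_real (g $ 1 $ 1) * autj g z - (of_real (g $ 1 $ 1) * z + of_real (g $ 1 $ 2)) * of_real (g $ 2 $ 1)) / (autj g z * autj g z)) (at z)"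
    unfolding autj_def using autj_nonzero[OF z] 
    by (auto intro!: derivative_eq_intros simp: autj_def)
  also have "of_real (g $ 1 $ 1) * autj g z - (of_real (g $ 1 $ 1) * z + of_real (g $ 1 $ 2)) * of_real (g $ 2 $ 1) = 1"
    using d unfolding autj_def by (simp add: algebra_simps)
  finally show ?thesis unfolding mobius_conv[abs_def, symmetric] by (simp add: power2_eq_square mobius_conv[abs_def])
qed

lemma has_field_derivative_log_lower_autj:
  assumes z: "z \<in> upper_half_plane"
  shows "((\<lambda>z. log_lower (autj g z)) has_field_derivative of_real (g $ 2 $ 1) / autj g z) (at z)"
proof (cases "g $ 2 $ 1 = 0")
  case True
  then show ?thesis by (simp add: autj_def)
next
  case False
  then have im: "Im (autj g w) \<noteq> 0" if "w \<in> upper_half_plane" for w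
    using that by (simp add: autj_def upper_half_plane_def)
  have "((\<lambda>z. Ln (autj g z)) has_field_derivative of_real (g $ 2 $ 1) / autj g z) (at z)"
    using im[OF z] unfolding autj_def by (auto intro!: derivative_eq_intros simp: complex_nonpos_Reals_iff divide_inverse mult.commute)
  then show ?thesis
    by (rule has_field_derivative_transform_within_open[OF _ open_upper_half_plane z])
       (use im log_lower_nonreal in auto)
qed

end

lemma autj_mult:
  assumes "det g2 = 1" and z: "z \<in> upper_half_plane"
  shows "autj (g1 ** g2) z = autj g1 (mobius g2 z) * autj g2 z"
proof -
  have "autj g1 (mobius g2 z) * autj g2 z = of_real (g1 $ 2 $ 1) * (mobius g2 z * autj g2 z) + of_real (g1 $ 2 $ 2) * autj g2 z"
    unfolding autj_def[of g1] by (simp add: algebra_simps)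
  also have "mobius g2 z * autj g2 z = of_real (g2 $ 1 $ 1) * z + of_real (g2 $ 1 $ 2)"
    unfolding mobius_conv using autj_nonzero[OF assms] by simp
  finally show ?thesis unfolding autj_def matrix_mult_2 by (simp add: algebra_simps)
qed

lemma mobius_mult:
  assumes d1: "det g1 = 1" and d2: "det g2 = 1" and z: "z \<in> upper_half_plane"
  shows "mobius (g1 ** g2) z = mobius g1 (mobius g2 z)"
proof -
  have j2: "autj g2 z \<noteq> 0" by (rule autj_nonzero[OF d2 z])
  have "(of_real (g1 $ 1 $ 1) * mobius g2 z + of_real (g1 $ 1 $ 2)) * autj g2 z = 
      of_real (g1 $ 1 $ 1) * (mobius g2 z * autj g2 z) + of_real (g1 $ 1 $ 2) * autj g2 z"
    by (simp add: algebra_simps)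
  also have "mobius g2 z * autj g2 z = of_real (g2 $ 1 $ 1) * z + of_real (g2 $ 1 $ 2)"
    unfolding mobius_conv using j2 by simp
  also have "of_real (g1 $ 1 $ 1) * (of_real (g2 $ 1 $ 1) * z + of_real (g2 $ 1 $ 2)) + of_real (g1 $ 1 $ 2) * autj g2 z = 
     of_real ((g1 ** g2) $ 1 $ 1) * z + of_real ((g1 ** g2) $ 1 $ 2)"
    unfolding autj_def matrix_mult_2 by (simp add: algebra_simps)
  finally show ?thesis
    unfolding mobius_conv[of "g1 ** g2"] mobius_conv[of g1 "mobius g2 z"] autj_mult[OF d2 z] using j2 
    by (metis nonzero_mult_divide_mult_cancel_right)
qed

text \<open>
  By the cocycle property of the automorphy factor, \<open>exp (2 \<pi> \<i> e) = 1\<close>, so the expression takes integer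
  values; being continuous on the connected upper half-plane, it is constant.
\<close>

lemma petersson_e_at:
  assumes d1: "det g1 = 1" and d2: "det g2 = 1"
  shows "\<exists>n::int. petersson_e g1 g2 = of_int n \<and> (\<forall>z\<in>upper_half_plane. petersson_at z g1 g2 = of_int n)"
proof -
  have d12: "det (g1 ** g2) = 1" using d1 d2 by (simp add: det_mul)
  have int: "petersson_at z g1 g2 \<in> \<int>" if z: "z \<in> upper_half_plane" for z
  proof -
    have nz: "autj g2 z \<noteq> 0" "autj g1 (mobius g2 z) \<noteq> 0" "autj (g1 ** g2) z \<noteq> 0"
      using autj_nonzero d1 d2 d12 mobius_in_upper_half_plane z by auto
    have "exp (2 * of_real pi * \<i> * petersson_at z g1 g2) = 
       exp (log_lower (autj g2 z) + log_lower (autj g1 (mobius g2 z)) - log_lower (autj (g1 ** g2) z))"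
      unfolding petersson_at_def by simp
    also have "\<dots> = 1"
      using nz autj_mult[OF d2 z, of g1] by (simp add: exp_add exp_diff exp_log_lower)
    finally have "exp (2 * of_real pi * \<i> * petersson_at z g1 g2) = exp 0" by simp
    then obtain n :: int where "2 * of_real pi * \<i> * petersson_at z g1 g2 = 0 + of_real (of_int (2 * n) * pi) * \<i>"
      unfolding exp_eq by blast
    then have "petersson_at z g1 g2 = of_int n" by simp
    then show ?thesis by simp
  qed
  have cont: "continuous_on upper_half_plane (\<lambda>z. log_lower (autj g z))" if "det g = 1" for g
    using has_field_derivative_log_lower_autj[OF that] by (meson DERIV_continuous_on has_field_derivative_at_within)
  have contm: "continuous_on upper_half_plane (mobius g2)"
    using has_field_derivative_mobius[OF d2] by (meson DERIV_continuous_on has_field_derivative_at_within)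
  have "continuous_on upper_half_plane (\<lambda>z. log_lower (autj g1 (mobius g2 z)))"
    using continuous_on_compose2[OF cont[OF d1] contm] mobius_in_upper_half_plane[OF d2] by blast
  then have "continuous_on upper_half_plane (\<lambda>z. petersson_at z g1 g2)"
    unfolding petersson_at_def by (intro continuous_intros cont d2 d12)
  moreover have "\<exists>e>0. \<forall>y. y \<in> upper_half_plane \<and> petersson_at y g1 g2 \<noteq> petersson_at x g1 g2 \<longrightarrow> e \<le> norm (petersson_at y g1 g2 - petersson_at x g1 g2)"
    if x: "x \<in> upper_half_plane" for x
  proof (intro exI[of _ 1] conjI allI impI)
    fix y assume y: "y \<in> upper_half_plane \<and> petersson_at y g1 g2 \<noteq> petersson_at x g1 g2"
    obtain m n where "petersson_at y g1 g2 = of_int m" "petersson_at x g1 g2 = of_int n"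
      using int[OF x] int[of y] y by (auto elim!: Ints_cases)
    moreover from this y have "\<bar>m - n\<bar> \<ge> 1" by auto
    then have "norm (of_int (m - n) :: complex) \<ge> 1" unfolding norm_of_int by linarith
    ultimately show "1 \<le> norm (petersson_at y g1 g2 - petersson_at x g1 g2)" by simp
  qed simp
  ultimately have "(\<lambda>z. petersson_at z g1 g2) constant_on upper_half_plane"
    by (rule continuous_discrete_range_constant[OF convex_connected[OF convex_upper_half_plane]])
  then obtain v where v: "\<And>z. z \<in> upper_half_plane \<Longrightarrow> petersson_at z g1 g2 = v"
    unfolding constant_on_def by blast
  have e: "petersson_e g1 g2 = v"
    unfolding petersson_e_def
  proof (rule the_equality)
    show "\<forall>z\<in>upper_half_plane. petersson_at z g1 g2 = v" using v by blast
    show "x = v" if "\<forall>z\<in>upper_half_plane. petersson_at z g1 g2 = x" for x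
      using that v[OF i_in_upper_half_plane] i_in_upper_half_plane by metis
  qed
  have "v \<in> \<int>"
    using int[OF i_in_upper_half_plane] unfolding v[OF i_in_upper_half_plane] .
  then obtain n where n: "v = of_int n" by (rule Ints_cases)
  show ?thesis
  proof (intro exI conjI ballI)
    show "petersson_e g1 g2 = of_int n" using e n by simp
    show "petersson_at z g1 g2 = of_int n" if "z \<in> upper_half_plane" for z
      using v[OF that] n by simp
  qed
qed

section \<open>Primitives of the weight 2 forms\<close>

definition eta_primitive :: "real^2^2 \<Rightarrow> complex \<Rightarrow> complex" where
  "eta_primitive g z = (2 * log_eta (mobius g z) - 2 * log_eta z - log_lower (autj g z)) / (of_real pi * \<i>)"

text \<open>
  The failure of \<open>M\<close> to be a cocycle is the failure of \<open>log j\<close> to be one, which the Petersson cocycle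
  measures.
\<close>

lemma eta_primitive_cocycle:
  assumes d1: "det g1 = 1" and d2: "det g2 = 1" and z: "z \<in> upper_half_plane"
  shows "eta_primitive g1 (mobius g2 z) = eta_primitive (g1 ** g2) z - eta_primitive g2 z - 2 * petersson_e g1 g2"
proof -
  obtain n :: int where "petersson_e g1 g2 = of_int n" "petersson_at z g1 g2 = of_int n"
    using petersson_e_at[OF d1 d2] z by blast
  then have e: "petersson_e g1 g2 = petersson_at z g1 g2" by simp
  show ?thesis
    unfolding e petersson_at_def eta_primitive_def mobius_mult[OF d1 d2 z]
    by (simp add: add_divide_distrib diff_divide_distrib)
qed

lemma modular_Delta_conv_exp: "z \<in> upper_half_plane \<Longrightarrow> modular_Delta z = exp (24 * log_eta z)"
  unfolding modular_Delta_def upper_half_plane_def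
  by (simp add: dedekind_eta_conv_exp exp_of_nat_mult[symmetric])

text \<open>
  On the upper half-plane \<open>\<Delta>|\<gamma> / \<Delta> = exp (12 \<pi> \<i> M\<^sub>\<gamma>)\<close>, as \<open>\<Delta> = exp (24 L)\<close>.
\<close>

lemma has_field_derivative_eta_primitive:
  assumes \<gamma>: "\<gamma> \<in> SL2Q" and z: "z \<in> upper_half_plane"
  shows "(eta_primitive (real_matrix \<gamma>) has_field_derivative GV_mu \<gamma> z) (at z)"
proof -
  define g where "g = real_matrix \<gamma>"
  have det: "det g = 1" unfolding g_def by (rule det_real_matrix_SL2Q[OF \<gamma>])
  define F where "F = (\<lambda>w. slash 12 modular_Delta \<gamma> w / modular_Delta w)"
  have F: "F w = exp (12 * of_real pi * \<i> * eta_primitive g w)" if w: "w \<in> upper_half_plane" for w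
  proof -
    have j: "autj g w \<noteq> 0" by (rule autj_nonzero[OF det w])
    have m: "mobius g w \<in> upper_half_plane" by (rule mobius_in_upper_half_plane[OF det w])
    have "12 * of_real pi * \<i> * eta_primitive g w = 24 * log_eta (mobius g w) - 24 * log_eta w - 12 * log_lower (autj g w)"
    proof -
      have "(of_real pi * \<i>) * eta_primitive g w = 2 * log_eta (mobius g w) - 2 * log_eta w - log_lower (autj g w)"
        unfolding eta_primitive_def times_divide_eq_right by (rule nonzero_mult_div_cancel_left) simp
      then have "12 * of_real pi * \<i> * eta_primitive g w = 12 * (2 * log_eta (mobius g w) - 2 * log_eta w - log_lower (autj g w))"
        by (simp only: mult.assoc)
      also have "\<dots> = 24 * log_eta (mobius g w) - 24 * log_eta w - 12 * log_lower (autj g w)"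
        by (simp add: right_diff_distrib)
      finally show ?thesis .
    qed
    then have "exp (12 * of_real pi * \<i> * eta_primitive g w) = 
       modular_Delta (mobius g w) / modular_Delta w / exp (12 * log_lower (autj g w))"
      by (simp only: exp_diff modular_Delta_conv_exp w m)
    also have "exp (12 * log_lower (autj g w)) = autj g w ^ 12"
      using exp_of_nat_mult[of 12 "log_lower (autj g w)"] j by (simp add: exp_log_lower)
    finally show ?thesis
      unfolding F_def slash_def g_def[symmetric] det using j by (simp add: power_int_minus field_simps)
  qed
  have m: "mobius g z \<in> upper_half_plane" by (rule mobius_in_upper_half_plane[OF det z])
  define L' where "L' = (\<lambda>z. of_real pi * \<i> * (1 / 12 - 2 * lambert (exp (2 * of_real pi * \<i> * z))))"
  have L': "(log_eta has_field_derivative L' w) (at w)" if "w \<in> upper_half_plane" for w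
    using that unfolding L'_def upper_half_plane_def by (intro has_field_derivative_log_eta) simp
  define D where "D = (2 * (L' (mobius g z) * (1 / (autj g z)\<^sup>2)) - 2 * L' z - of_real (g $ 2 $ 1) / autj g z) / (of_real pi * \<i>)"
  have D: "(eta_primitive g has_field_derivative D) (at z)"
    unfolding eta_primitive_def[abs_def] D_def
    by (intro DERIV_cdivide DERIV_diff DERIV_cmult L' z has_field_derivative_log_lower_autj[OF det z]
         DERIV_chain2[where f = log_eta, OF L'[OF m] has_field_derivative_mobius[OF det z]])
  have "((\<lambda>w. exp (12 * of_real pi * \<i> * eta_primitive g w)) has_field_derivative F z * (12 * of_real pi * \<i> * D)) (at z)"
    unfolding F[OF z] by (intro DERIV_chain2[OF DERIV_exp] DERIV_cmult D)
  then have "(F has_field_derivative F z * (12 * of_real pi * \<i> * D)) (at z)"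
    by (rule has_field_derivative_transform_within_open[OF _ open_upper_half_plane z]) (use F in auto)
  then have "deriv F z = F z * (12 * of_real pi * \<i> * D)" by (rule DERIV_imp_deriv)
  moreover have "F z \<noteq> 0" unfolding F[OF z] by simp
  ultimately have "GV_mu \<gamma> z = D"
    unfolding GV_mu_def Let_def F_def[symmetric] by simp
  then show ?thesis using D unfolding g_def by simp
qed

lemma has_field_derivative_eta_primitive_mobius:
  assumes \<gamma>: "\<gamma>1 \<in> SL2Q" "\<gamma>2 \<in> SL2Q" and z: "z \<in> upper_half_plane"
  shows "((\<lambda>z. eta_primitive (real_matrix \<gamma>1) (mobius (real_matrix \<gamma>2) z)) has_field_derivative slash 2 (GV_mu \<gamma>1) \<gamma>2 z) (at z)"
proof -
  have det: "det (real_matrix \<gamma>2) = 1" by (rule det_real_matrix_SL2Q[OF \<gamma>(2)])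
  have m: "mobius (real_matrix \<gamma>2) z \<in> upper_half_plane" by (rule mobius_in_upper_half_plane[OF det z])
  have "slash 2 (GV_mu \<gamma>1) \<gamma>2 z = GV_mu \<gamma>1 (mobius (real_matrix \<gamma>2) z) * (1 / (autj (real_matrix \<gamma>2) z)\<^sup>2)"
    unfolding slash_def det by (simp add: power_int_minus field_simps)
  then show ?thesis
    using DERIV_chain2[where f = "eta_primitive (real_matrix \<gamma>1)", OF has_field_derivative_eta_primitive[OF \<gamma>(1) m] has_field_derivative_mobius[OF det z]]
    by simp
qed

section \<open>The function Phi as a constant term\<close>

lemma of_real_of_rat_eq: "of_real (of_rat r) = (of_rat r :: complex)"
  by (cases r) (simp add: of_rat_rat)

text \<open>
  For \<open>c > 0\<close> this is \<open>log_eta_transformation\<close>. For \<open>c < 0\<close> it is applied to \<open>-\<sigma>\<close>; the change of the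
  argument of \<open>j\<close> by \<open>\<pi>\<close> turns the constant \<open>-1/4\<close> into \<open>+1/4\<close>. For \<open>c = 0\<close> and \<open>d = -1\<close> the choice
  \<open>log (-1) = - \<pi> \<i>\<close> contributes the term \<open>(1 - sgn d) / 4\<close>.
\<close>

lemma eta_primitive_SL2Z:
  assumes \<sigma>: "\<sigma> \<in> SL2Z" and z: "z \<in> upper_half_plane"
  shows "eta_primitive (real_matrix \<sigma>) z = of_rat (2 * Phi_SL2Z \<sigma>)"
proof -
  have I: "\<sigma> $ i $ j \<in> \<int>" for i j using \<sigma> by (simp add: SL2Z_def)
  obtain a where a: "\<sigma> $ 1 $ 1 = of_int a" using I[of 1 1] by (rule Ints_cases)
  obtain b where b: "\<sigma> $ 1 $ 2 = of_int b" using I[of 1 2] by (rule Ints_cases)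
  obtain c where c: "\<sigma> $ 2 $ 1 = of_int c" using I[of 2 1] by (rule Ints_cases)
  obtain d where d: "\<sigma> $ 2 $ 2 = of_int d" using I[of 2 2] by (rule Ints_cases)
  note abcd = a b c d
  have "of_int (a * d - b * c) = (of_int 1 :: rat)"
    using \<sigma> unfolding SL2Z_def det_2 by (simp add: abcd)
  then have det: "a * d - b * c = 1" unfolding of_int_eq_iff .
  have Imz: "Im z > 0" using z by (simp add: upper_half_plane_def)
  define g where "g = real_matrix \<sigma>"
  have j: "autj g z = of_int c * z + of_int d"
    unfolding g_def autj_def real_matrix_nth abcd by simp
  have m: "mobius g z = (of_int a * z + of_int b) / (of_int c * z + of_int d)"
    unfolding mobius_conv j unfolding g_def real_matrix_nth abcd by simp
  have co: "coprime a c"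
  proof (rule coprimeI)
    fix e assume "e dvd a" "e dvd c"
    then have "e dvd a * d - b * c" by simp
    then show "e dvd 1" using det by simp
  qed
  have pii: "(of_real pi * \<i> * x) / (of_real pi * \<i>) = x" for x :: complex by simp
  consider "c = 0" | "c > 0" | "c < 0" by linarith
  then show ?thesis
  proof cases
    case 1
    then have "a * d = 1" using det by simp
    then consider "a = 1" "d = 1" | "a = -1" "d = -1" by (auto simp: zmult_eq_1_iff)
    then show ?thesis
    proof cases
      case 1
      have "log_lower 1 = 0" using log_lower_of_real_pos[of 1] by simp
      then have "eta_primitive g z = (of_real pi * \<i> * (of_int b / 6)) / (of_real pi * \<i>)"
        unfolding eta_primitive_def j m using 1 \<open>c = 0\<close> log_eta_translation[of z b] by (simp add: algebra_simps)
      moreover have P: "Phi_SL2Z \<sigma> = of_int b / 12"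
        unfolding Phi_SL2Z_def Let_def abcd using 1 \<open>c = 0\<close> by simp
      ultimately show ?thesis unfolding pii g_def P by (simp add: of_rat_divide of_rat_mult)
    next
      case 2
      have l: "log_lower (- 1) = - of_real pi * \<i>"
        by (rule log_lower_eqI) (auto simp: exp_minus mult.commute)
      have m2: "(of_int a * z + of_int b) / (of_int c * z + of_int d) = z + of_int (- b)"
        using 2 \<open>c = 0\<close> by simp
      have t2: "log_eta (z + of_int (- b)) = log_eta z - of_real pi * \<i> * of_int b / 12"
        unfolding log_eta_translation by simp
      have "eta_primitive g z = (of_real pi * \<i> * (1 - of_int b / 6)) / (of_real pi * \<i>)"
        unfolding eta_primitive_def j m m2 t2 using 2 \<open>c = 0\<close> l by (simp add: algebra_simps)
      moreover have "Phi_SL2Z \<sigma> = 1 / 2 - of_int b / 12"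
        unfolding Phi_SL2Z_def Let_def abcd using 2 \<open>c = 0\<close> by simp
      ultimately show ?thesis unfolding pii g_def by (simp add: of_rat_divide of_rat_diff of_rat_mult right_diff_distrib)
    qed
  next
    case 2
    then have "Im (autj g z) \<noteq> 0" unfolding j using Imz by simp
    then have l: "log_lower (autj g z) = Ln (of_int c * z + of_int d)"
      unfolding j by (rule log_lower_nonreal)
    define X where "X = (of_int a + of_int d) / (12 * of_int c) - dedekind_sum a c"
    have "eta_primitive g z = (of_real pi * \<i> * (2 * (of_rat X - 1 / 4))) / (of_real pi * \<i>)"
      unfolding eta_primitive_def l m log_eta_transformation[OF 2 det Imz] X_def[symmetric] by (simp add: algebra_simps)
    moreover have "Phi_SL2Z \<sigma> = X - 1 / 4"
      unfolding Phi_SL2Z_def Let_def abcd X_def using 2 dedekind_s_fraction[OF 2 co] by simp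
    ultimately show ?thesis unfolding pii g_def by (simp add: of_rat_divide of_rat_diff of_rat_mult)
  next
    case 3
    define w where "w = of_int (- c) * z + of_int (- d)"
    have c: "- c > 0" using 3 by simp
    have w: "Im w > 0" unfolding w_def using c Imz by (simp add: mult_neg_pos)
    have jw: "autj g z = - w" unfolding j w_def by simp
    then have "log_lower (autj g z) = Ln (- w)"
      using w by (simp add: log_lower_nonreal)
    also have "\<dots> = Ln w - of_real pi * \<i>"
    proof -
      have "w \<noteq> 0" using w by auto
      then show ?thesis using Ln_minus[of w] w by (simp add: mult.commute)
    qed
    finally have l: "log_lower (autj g z) = Ln w - of_real pi * \<i>" .
    have m': "mobius g z = (of_int (- a) * z + of_int (- b)) / w"
    proof -
      have "(of_int (- a) * z + of_int (- b)) / w = (- (of_int a * z + of_int b)) / (- (of_int c * z + of_int d))"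
        unfolding w_def by simp
      then show ?thesis unfolding m by (simp only: minus_divide_divide)
    qed
    define X where "X = (of_int (- a) + of_int (- d)) / (12 * of_int (- c)) - dedekind_sum (- a) (- c)"
    have det': "(- a) * (- d) - (- b) * (- c) = 1" using det by simp
    have "eta_primitive g z = (of_real pi * \<i> * (2 * (of_rat X + 1 / 4))) / (of_real pi * \<i>)"
      unfolding eta_primitive_def l m' unfolding w_def log_eta_transformation[OF c det' Imz] X_def[symmetric] by (simp add: algebra_simps)
    moreover have "Phi_SL2Z \<sigma> = X + 1 / 4"
    proof -
      have "dedekind_s (of_int a / of_int (- c)) = dedekind_sum a (- c)"
        by (rule dedekind_s_fraction[OF c]) (use co in simp)
      moreover have "dedekind_sum (- a) (- c) = - dedekind_sum a (- c)"
        by (rule dedekind_sum_uminus[OF c]) (use co in simp)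
      moreover have "(of_int (- a) + of_int (- d)) / (12 * of_int (- c)) = (of_int a + of_int d) / (12 * of_int c :: rat)"
        using 3 by (simp add: field_simps)
      ultimately show ?thesis
        unfolding Phi_SL2Z_def Let_def abcd X_def using 3 by simp
    qed
    ultimately show ?thesis unfolding pii g_def by (simp add: of_rat_divide of_rat_add of_rat_mult)
  qed
qed

lemma pos_rat_fraction:
  fixes r :: rat
  assumes "r > 0"
  shows "\<exists>P Q. P > 0 \<and> Q > 0 \<and> r = of_nat P / of_nat Q"
proof -
  obtain p q where pq: "quotient_of r = (p, q)" by (cases "quotient_of r")
  have q: "q > 0" by (rule quotient_of_denom_pos[OF pq])
  have r: "r = of_int p / of_int q" by (rule quotient_of_div[OF pq])
  then have "p > 0" using assms q by (simp add: zero_less_divide_iff)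
  then show ?thesis using q r 
    by (intro exI[of _ "nat p"] exI[of _ "nat q"]) simp
qed

text \<open>
  \<open>M\<^sub>\<gamma> z = M\<^sub>\<sigma> (\<beta> z) + M\<^sub>\<beta> z\<close>, because \<open>j (\<beta>, z)\<close> is a positive real number. The first summand is a constant by
  \<open>eta_primitive_SL2Z\<close>; in the second one, the translation part \<open>b / d\<close> of \<open>\<beta>\<close> contributes
  \<open>b / (6 d) = 2 Phi_upper \<beta>\<close>, and the logarithm of \<open>d\<close> is purely imaginary after division by \<open>\<pi> \<i>\<close>.
\<close>

lemma cusp_primitive_factorization:
  assumes \<gamma>: "\<gamma> \<in> SL2Q" and \<sigma>: "\<sigma> \<in> SL2Z" and \<beta>: "\<beta> \<in> upper_pos" and eq: "\<gamma> = \<sigma> ** \<beta>"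
  shows "\<exists>A y. cusp_primitive (eta_primitive (real_matrix \<gamma>)) (GV_mu \<gamma>) A (of_rat (2 * (Phi_SL2Z \<sigma> + Phi_upper \<beta>)) + \<i> * of_real y)"
proof -
  define a b d where "a = \<beta> $ 1 $ 1" and "b = \<beta> $ 1 $ 2" and "d = \<beta> $ 2 $ 2"
  have \<beta>': "\<beta> $ 2 $ 1 = 0" "a > 0" "d > 0"
    using \<beta> unfolding upper_pos_def a_def d_def by auto
  have det\<sigma>: "det \<sigma> = 1" using \<sigma> by (simp add: SL2Z_def)
  then have "det \<beta> = 1" using \<gamma> eq by (simp add: SL2Q_def det_mul)
  then have d\<beta>: "det (real_matrix \<beta>) = 1" by (simp add: det_real_matrix)
  have d\<sigma>: "det (real_matrix \<sigma>) = 1" using det\<sigma> by (simp add: det_real_matrix)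
  obtain P Q where PQ: "P > 0" "Q > 0" "a / d = of_nat P / of_nat Q"
    using pos_rat_fraction[of "a / d"] \<beta>' by auto
  define r :: complex where "r = of_nat P / of_nat Q"
  define s :: real where "s = of_rat (b / d)"
  define \<delta> :: real where "\<delta> = of_rat d"
  have \<delta>: "\<delta> > 0" unfolding \<delta>_def using \<beta>' by simp
  have j: "autj (real_matrix \<beta>) z = of_real \<delta>" for z
    unfolding autj_def real_matrix_nth \<beta>' \<delta>_def d_def by simp
  have r: "r = of_real (of_rat a) / of_real \<delta>"
  proof -
    have "r = of_rat (of_nat P / of_nat Q)" unfolding r_def by (simp add: of_rat_divide)
    also have "\<dots> = of_rat (a / d)" unfolding PQ(3) ..
    also have "\<dots> = of_real (of_rat (a / d))" by (simp only: of_real_of_rat_eq)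
    also have "\<dots> = of_real (of_rat a) / of_real \<delta>" unfolding \<delta>_def by (simp add: of_rat_divide)
    finally show ?thesis .
  qed
  have m: "mobius (real_matrix \<beta>) z = r * z + of_real s" for z
    unfolding mobius_conv j r s_def \<delta>_def[symmetric] real_matrix_nth a_def[symmetric] b_def[symmetric]
    by (simp add: of_rat_divide \<delta>_def[symmetric] add_divide_distrib)
  define A0 where "A0 = of_real pi * \<i> / (12::complex)"
  define k where "k = of_rat (2 * Phi_SL2Z \<sigma>) - of_real (ln \<delta>) / (of_real pi * \<i>)"
  define c where "c = 2 / (of_real pi * \<i>)"
  have cp: "\<exists>f A. cusp_primitive (\<lambda>z. k + c * (log_eta (r * z + of_real s) - log_eta z)) f A (k + c * (0 + A0 * of_real s - 0))"
    using cusp_primitive_add_const[OF cusp_primitive_cmult[OF cusp_primitive_diff[OF cusp_primitive_affine[OF cusp_primitive_log_eta PQ(1,2), of s] cusp_primitive_log_eta], of c], of k]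
    unfolding r_def A0_def by blast
  have eqM: "k + c * (log_eta (r * z + of_real s) - log_eta z) = eta_primitive (real_matrix \<gamma>) z" if z: "z \<in> upper_half_plane" for z
  proof -
    have bz: "r * z + of_real s \<in> upper_half_plane"
      using mobius_in_upper_half_plane[OF d\<beta> z] unfolding m .
    have "log_lower (autj (real_matrix \<gamma>) z) = of_real (ln \<delta>) + log_lower (autj (real_matrix \<sigma>) (r * z + of_real s))"
      unfolding eq real_matrix_mult autj_mult[OF d\<beta> z] m j using log_lower_mult_of_real[OF \<delta> autj_nonzero[OF d\<sigma> bz]]
      by (simp add: mult.commute)
    moreover have "mobius (real_matrix \<gamma>) z = mobius (real_matrix \<sigma>) (r * z + of_real s)"
      unfolding eq real_matrix_mult mobius_mult[OF d\<sigma> d\<beta> z] m ..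
    ultimately have "eta_primitive (real_matrix \<gamma>) z = 
       eta_primitive (real_matrix \<sigma>) (r * z + of_real s) - of_real (ln \<delta>) / (of_real pi * \<i>) + c * (log_eta (r * z + of_real s) - log_eta z)"
      unfolding eta_primitive_def c_def by (simp add: add_divide_distrib diff_divide_distrib right_diff_distrib)
    then show ?thesis unfolding eta_primitive_SL2Z[OF \<sigma> bz] k_def by simp
  qed
  have C: "k + c * (0 + A0 * of_real s - 0) = of_rat (2 * (Phi_SL2Z \<sigma> + Phi_upper \<beta>)) + \<i> * of_real (ln \<delta> / pi)"
  proof -
    have "Phi_upper \<beta> = b / d / 12"
      unfolding Phi_upper_def b_def[symmetric] d_def[symmetric] using \<beta>' by simp
    then have h0: "of_rat (2 * Phi_upper \<beta>) = of_real s / (6 :: complex)"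
      unfolding s_def of_real_of_rat_eq by (simp add: of_rat_mult of_rat_divide)
    have h1: "c * (0 + A0 * of_real s - 0) = of_real s / 6"
      unfolding c_def A0_def by simp
    have h2: "- (of_real (ln \<delta>) / (of_real pi * \<i>)) = \<i> * of_real (ln \<delta> / pi)"
      by (simp add: field_simps)
    have "of_rat (2 * (Phi_SL2Z \<sigma> + Phi_upper \<beta>)) = of_rat (2 * Phi_SL2Z \<sigma>) + (of_rat (2 * Phi_upper \<beta>) :: complex)"
      by (simp only: distrib_left of_rat_add)
    then show ?thesis
      unfolding h0 h1 h2[symmetric] k_def by simp
  qed
  obtain f A where "cusp_primitive (\<lambda>z. k + c * (log_eta (r * z + of_real s) - log_eta z)) f A (of_rat (2 * (Phi_SL2Z \<sigma> + Phi_upper \<beta>)) + \<i> * of_real (ln \<delta> / pi))"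
    using cp unfolding C by blast
  then have "cusp_primitive (eta_primitive (real_matrix \<gamma>)) (GV_mu \<gamma>) A (of_rat (2 * (Phi_SL2Z \<sigma> + Phi_upper \<beta>)) + \<i> * of_real (ln \<delta> / pi))"
    by (rule cusp_primitive_transfer[OF _ eqM has_field_derivative_eta_primitive[OF \<gamma>]])
  then show ?thesis by blast
qed

text \<open>
  The first column of \<open>\<gamma>\<close> is a positive multiple \<open>r\<close> of a primitive integral vector \<open>(p, q')\<close>, which a Bezout
  relation completes to an integral matrix \<open>\<sigma>\<close> of determinant \<open>1\<close>; then \<open>\<beta> = \<sigma>\<^sup>-\<^sup>1 \<gamma>\<close>.
\<close>

lemma SL2Q_factorization:
  assumes \<gamma>: "\<gamma> \<in> SL2Q"
  shows "\<exists>\<sigma>\<in>SL2Z. \<exists>\<beta>\<in>upper_pos. \<gamma> = \<sigma> ** \<beta>"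
proof -
  define x where "x = \<gamma> $ 1 $ 1"
  define y where "y = \<gamma> $ 2 $ 1"
  have det: "x * \<gamma> $ 2 $ 2 - \<gamma> $ 1 $ 2 * y = 1" using \<gamma> by (simp add: SL2Q_def det_2 x_def y_def)
  obtain p1 q1 where 1: "quotient_of x = (p1, q1)" by (cases "quotient_of x")
  obtain p2 q2 where 2: "quotient_of y = (p2, q2)" by (cases "quotient_of y")
  have q: "q1 > 0" "q2 > 0" using quotient_of_denom_pos 1 2 by blast+
  have xy: "x = of_int p1 / of_int q1" "y = of_int p2 / of_int q2" using quotient_of_div 1 2 by blast+
  \<comment> \<open>Over the common denominator \<open>q1 q2\<close> the column has the numerators \<open>p1 q2\<close> and \<open>p2 q1\<close>.\<close>
  define h where "h = gcd (p1 * q2) (p2 * q1)"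
  have "p1 * q2 \<noteq> 0 \<or> p2 * q1 \<noteq> 0" using det xy q by auto
  then have h: "h > 0" unfolding h_def by (simp add: gcd_pos_int)
  obtain p where p: "p1 * q2 = h * p" unfolding h_def by (metis dvdE gcd_dvd1)
  obtain q' where q': "p2 * q1 = h * q'" unfolding h_def by (metis dvdE gcd_dvd2)
  have "gcd p q' = 1"
  proof -
    have "h * gcd p q' = h" using h unfolding h_def[symmetric] 
      by (metis abs_of_pos gcd_mult_distrib_int h_def p q')
    then show ?thesis using h by simp
  qed
  obtain u v where uv: "u * p + v * q' = 1"
    using bezout_int[of p q'] \<open>gcd p q' = 1\<close> by auto
  define r :: rat where "r = of_int h / (of_int q1 * of_int q2)"
  have r: "r > 0" unfolding r_def using h q by simp
  have xr: "x = of_int p * r"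
  proof -
    have "of_int p1 * of_int q2 = (of_int h * of_int p :: rat)" using arg_cong[OF p, of "of_int :: int \<Rightarrow> rat"] by simp
    then show ?thesis unfolding xy r_def using q by (simp add: field_simps)
  qed
  have yr: "y = of_int q' * r"
  proof -
    have "of_int p2 * of_int q1 = (of_int h * of_int q' :: rat)" using arg_cong[OF q', of "of_int :: int \<Rightarrow> rat"] by simp
    then show ?thesis unfolding xy r_def using q by (simp add: field_simps)
  qed
  have uv': "of_int u * of_int p + of_int v * of_int q' = (1 :: rat)"
    using arg_cong[OF uv, of "of_int :: int \<Rightarrow> rat"] by simp
  define \<sigma> :: "rat^2^2" where "\<sigma> = vector [vector [of_int p, - of_int v], vector [of_int q', of_int u]]"
  define t where "t = of_int u * \<gamma> $ 1 $ 2 + of_int v * \<gamma> $ 2 $ 2"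
  define \<beta> :: "rat^2^2" where "\<beta> = vector [vector [r, t], vector [0, 1 / r]]"
  have "\<sigma> \<in> SL2Z"
    unfolding SL2Z_def \<sigma>_def using uv' by (simp add: det_2 forall_2 mult.commute)
  moreover have "\<beta> \<in> upper_pos"
    unfolding upper_pos_def GL2Q_pos_def \<beta>_def using r by (simp add: det_2)
  moreover have "\<gamma> = \<sigma> ** \<beta>"
  proof -
    have d: "of_int p * \<gamma> $ 2 $ 2 - \<gamma> $ 1 $ 2 * of_int q' = 1 / r"
      using det r unfolding xr yr by (simp add: field_simps)
    have "of_int p * t - of_int v / r = \<gamma> $ 1 $ 2"
    proof -
      have "of_int p * t - of_int v * (1 / r) = \<gamma> $ 1 $ 2 * (of_int u * of_int p + of_int v * of_int q')"
        unfolding d[symmetric] t_def by (simp add: algebra_simps)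
      then show ?thesis unfolding uv' by simp
    qed
    moreover have "of_int q' * t + of_int u / r = \<gamma> $ 2 $ 2"
    proof -
      have "of_int q' * t + of_int u * (1 / r) = \<gamma> $ 2 $ 2 * (of_int u * of_int p + of_int v * of_int q')"
        unfolding d[symmetric] t_def by (simp add: algebra_simps)
      then show ?thesis unfolding uv' by simp
    qed
    ultimately show ?thesis
      using xr yr unfolding vec_eq_iff forall_2 matrix_mult_2 unfolding \<sigma>_def \<beta>_def x_def y_def by simp
  qed
  ultimately show ?thesis by blast
qed

lemma cusp_primitive_unique:
  assumes F: "cusp_primitive F f A C" and F': "cusp_primitive F f A' C'"
  shows "C = C'"
proof -
  have "A = A'" using cusp_primitive_const_term F F' by metis
  then show ?thesis
    using F F' i_in_upper_half_plane tendsto_unique[OF trivial_limit_at_top_linorder] unfolding cusp_primitive_def by blast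
qed

text \<open>
  The constant term of \<open>M\<^sub>\<gamma>\<close> does not refer to a factorization of \<open>\<gamma>\<close>, so by
  \<open>cusp_primitive_factorization\<close> all factorizations give the same value of \<open>Phi\<close>.
\<close>

lemma cusp_primitive_Phi:
  assumes \<gamma>: "\<gamma> \<in> SL2Q"
  shows "\<exists>A y. cusp_primitive (eta_primitive (real_matrix \<gamma>)) (GV_mu \<gamma>) A (of_rat (2 * Phi \<gamma>) + \<i> * of_real y)"
proof -
  obtain \<sigma> \<beta> where f: "\<sigma> \<in> SL2Z" "\<beta> \<in> upper_pos" "\<gamma> = \<sigma> ** \<beta>"
    using SL2Q_factorization[OF \<gamma>] by blast
  obtain A y where cp: "cusp_primitive (eta_primitive (real_matrix \<gamma>)) (GV_mu \<gamma>) A (of_rat (2 * (Phi_SL2Z \<sigma> + Phi_upper \<beta>)) + \<i> * of_real y)"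
    using cusp_primitive_factorization[OF \<gamma> f] by blast
  have "Phi \<gamma> = Phi_SL2Z \<sigma> + Phi_upper \<beta>"
    unfolding Phi_def
  proof (rule the_equality)
    show "\<forall>\<sigma>'\<in>SL2Z. \<forall>\<beta>'\<in>upper_pos. \<gamma> = \<sigma>' ** \<beta>' \<longrightarrow> Phi_SL2Z \<sigma> + Phi_upper \<beta> = Phi_SL2Z \<sigma>' + Phi_upper \<beta>'"
    proof (intro ballI impI)
      fix \<sigma>' \<beta>' assume f': "\<sigma>' \<in> SL2Z" "\<beta>' \<in> upper_pos" "\<gamma> = \<sigma>' ** \<beta>'"
      obtain A' y' where cp': "cusp_primitive (eta_primitive (real_matrix \<gamma>)) (GV_mu \<gamma>) A' (of_rat (2 * (Phi_SL2Z \<sigma>' + Phi_upper \<beta>')) + \<i> * of_real y')"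
        using cusp_primitive_factorization[OF \<gamma> f'] by blast
      have "of_real (of_rat (2 * (Phi_SL2Z \<sigma> + Phi_upper \<beta>))) + \<i> * of_real y = of_real (of_rat (2 * (Phi_SL2Z \<sigma>' + Phi_upper \<beta>'))) + \<i> * of_real y'"
        unfolding of_real_of_rat_eq by (rule cusp_primitive_unique[OF cp cp'])
      from arg_cong[OF this, of Re] show "Phi_SL2Z \<sigma> + Phi_upper \<beta> = Phi_SL2Z \<sigma>' + Phi_upper \<beta>'"
        by simp
    qed
  qed (use f in auto)
  then show ?thesis using cp by auto
qed

lemma Phi_coboundary:
  assumes \<gamma>: "\<gamma>1 \<in> SL2Q" "\<gamma>2 \<in> SL2Q"
  shows "of_real (1/2 * Re (GV \<gamma>1 \<gamma>2)) + petersson_e (real_matrix \<gamma>1) (real_matrix \<gamma>2)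
      = of_rat (Phi (\<gamma>1 ** \<gamma>2) - Phi \<gamma>1 - Phi \<gamma>2)"
proof -
  define g1 g2 where "g1 = real_matrix \<gamma>1" and "g2 = real_matrix \<gamma>2"
  have \<gamma>12: "\<gamma>1 ** \<gamma>2 \<in> SL2Q" by (rule SL2Q_mult[OF \<gamma>])
  have det: "det g1 = 1" "det g2 = 1" unfolding g1_def g2_def using \<gamma> by (auto intro: det_real_matrix_SL2Q)
  obtain n :: int where n: "petersson_e g1 g2 = of_int n" using petersson_e_at[OF det] by blast
  obtain A1 y1 where 1: "cusp_primitive (eta_primitive g1) (GV_mu \<gamma>1) A1 (of_rat (2 * Phi \<gamma>1) + \<i> * of_real y1)"
    using cusp_primitive_Phi[OF \<gamma>(1)] unfolding g1_def by blast
  obtain A2 y2 where 2: "cusp_primitive (eta_primitive g2) (GV_mu \<gamma>2) A2 (of_rat (2 * Phi \<gamma>2) + \<i> * of_real y2)"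
    using cusp_primitive_Phi[OF \<gamma>(2)] unfolding g2_def by blast
  obtain A12 y12 where 12: "cusp_primitive (eta_primitive (g1 ** g2)) (GV_mu (\<gamma>1 ** \<gamma>2)) A12 (of_rat (2 * Phi (\<gamma>1 ** \<gamma>2)) + \<i> * of_real y12)"
    using cusp_primitive_Phi[OF \<gamma>12] unfolding g1_def g2_def real_matrix_mult by blast
  define C1 where "C1 = of_rat (2 * Phi \<gamma>1) + \<i> * of_real y1"
  define C2 where "C2 = - 2 * of_int n + ((of_rat (2 * Phi (\<gamma>1 ** \<gamma>2)) + \<i> * of_real y12) - (of_rat (2 * Phi \<gamma>2) + \<i> * of_real y2))"
  have M': "cusp_primitive (\<lambda>z. eta_primitive g1 (mobius g2 z)) (slash 2 (GV_mu \<gamma>1) \<gamma>2) (A12 - A2) C2"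
    unfolding C2_def
  proof (rule cusp_primitive_transfer[OF cusp_primitive_add_const[OF cusp_primitive_diff[OF 12 2], of "- 2 * of_int n"]])
    fix z assume z: "z \<in> upper_half_plane"
    show "- 2 * of_int n + (eta_primitive (g1 ** g2) z - eta_primitive g2 z) = eta_primitive g1 (mobius g2 z)"
      unfolding eta_primitive_cocycle[OF det z] n by simp
    show "((\<lambda>z. eta_primitive g1 (mobius g2 z)) has_field_derivative slash 2 (GV_mu \<gamma>1) \<gamma>2 z) (at z)"
      unfolding g1_def g2_def by (rule has_field_derivative_eta_primitive_mobius[OF \<gamma> z])
  qed
  have GV_at: "GV_at z \<gamma>1 \<gamma>2 = C2 - C1" if z: "z \<in> upper_half_plane" for z
    unfolding GV_at_def g2_def[symmetric]
    by (rule GV_value[OF 1[folded C1_def] M' z mobius_in_upper_half_plane[OF det(2) z] refl])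
  have GV: "GV \<gamma>1 \<gamma>2 = C2 - C1"
    unfolding GV_def
  proof (rule the_equality)
    show "\<forall>z\<in>upper_half_plane. GV_at z \<gamma>1 \<gamma>2 = C2 - C1" using GV_at by blast
    show "x = C2 - C1" if "\<forall>z\<in>upper_half_plane. GV_at z \<gamma>1 \<gamma>2 = x" for x
      using that GV_at[OF i_in_upper_half_plane] i_in_upper_half_plane by metis
  qed
  have C1': "C1 = of_real (of_rat (2 * Phi \<gamma>1)) + \<i> * of_real y1"
    unfolding C1_def of_real_of_rat_eq ..
  have C2': "C2 = - 2 * of_int n + ((of_real (of_rat (2 * Phi (\<gamma>1 ** \<gamma>2))) + \<i> * of_real y12) - (of_real (of_rat (2 * Phi \<gamma>2)) + \<i> * of_real y2))"
    unfolding C2_def of_real_of_rat_eq ..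
  have "1/2 * Re (GV \<gamma>1 \<gamma>2) + of_int n = of_rat (Phi (\<gamma>1 ** \<gamma>2) - Phi \<gamma>1 - Phi \<gamma>2)"
    unfolding GV C1' C2' by (simp add: of_rat_diff of_rat_mult diff_divide_distrib)
  then have "of_real (1/2 * Re (GV \<gamma>1 \<gamma>2) + of_int n) = (of_real (of_rat (Phi (\<gamma>1 ** \<gamma>2) - Phi \<gamma>1 - Phi \<gamma>2)) :: complex)"
    by (rule arg_cong)
  then show ?thesis
    unfolding g1_def[symmetric] g2_def[symmetric] n of_real_of_rat_eq by simp
qed

section \<open>Homomorphisms on SL(2,Q) and uniqueness\<close>

definition mat2 :: "rat \<Rightarrow> rat \<Rightarrow> rat \<Rightarrow> rat \<Rightarrow> rat^2^2" where
  "mat2 a b c d = vector [vector [a, b], vector [c, d]]"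

lemma mat2_nth [simp]:
  "mat2 a b c d $ 1 $ 1 = a" "mat2 a b c d $ 1 $ 2 = b" "mat2 a b c d $ 2 $ 1 = c" "mat2 a b c d $ 2 $ 2 = d"
  by (simp_all add: mat2_def)

lemma mat2_eta: "mat2 (\<gamma> $ 1 $ 1) (\<gamma> $ 1 $ 2) (\<gamma> $ 2 $ 1) (\<gamma> $ 2 $ 2) = \<gamma>"
  by (simp add: vec_eq_iff forall_2)

lemma mat2_mult: "mat2 a b c d ** mat2 a' b' c' d' = mat2 (a*a' + b*c') (a*b' + b*d') (c*a' + d*c') (c*b' + d*d')"
  by (simp add: vec_eq_iff forall_2 matrix_mult_2)

lemma mat2_in_SL2Q: "mat2 a b c d \<in> SL2Q \<longleftrightarrow> a * d - b * c = 1"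
  by (simp add: SL2Q_def det_2)

text \<open>
  Conjugation by \<open>diag (2, 1/2)\<close> maps the upper unipotent matrix with entry \<open>x\<close> to the one with entry
  \<open>4 x\<close>, and conjugation by its inverse does the same for lower unipotent matrices. A
  homomorphism \<open>h\<close> to an abelian group is invariant under conjugation and additive in \<open>x\<close>, so \<open>4 h = h\<close> on unipotent matrices. These generate the group.
\<close>

lemma SL2Q_hom_trivial:
  fixes h :: "rat^2^2 \<Rightarrow> complex"
  assumes hom: "\<And>A B. A \<in> SL2Q \<Longrightarrow> B \<in> SL2Q \<Longrightarrow> h (A ** B) = h A + h B"
    and \<gamma>: "\<gamma> \<in> SL2Q"
  shows "h \<gamma> = 0"
proof -
  have one: "h (mat2 1 0 0 1) = 0"
    using hom[of "mat2 1 0 0 1" "mat2 1 0 0 1"] by (simp add: mat2_in_SL2Q mat2_mult)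
  have diag: "h (mat2 2 0 0 (1/2)) + h (mat2 (1/2) 0 0 2) = 0"
    using hom[of "mat2 2 0 0 (1/2)" "mat2 (1/2) 0 0 2"] one by (simp add: mat2_in_SL2Q mat2_mult)
  have U_add: "h (mat2 1 (x + y) 0 1) = h (mat2 1 x 0 1) + h (mat2 1 y 0 1)" for x y
    using hom[of "mat2 1 x 0 1" "mat2 1 y 0 1"] by (simp add: mat2_in_SL2Q mat2_mult add.commute)
  have L_add: "h (mat2 1 0 (x + y) 1) = h (mat2 1 0 x 1) + h (mat2 1 0 y 1)" for x y
    using hom[of "mat2 1 0 x 1" "mat2 1 0 y 1"] by (simp add: mat2_in_SL2Q mat2_mult)
  have U: "h (mat2 1 x 0 1) = 0" for x
  proof -
    have "h (mat2 2 0 0 (1/2) ** mat2 1 x 0 1 ** mat2 (1/2) 0 0 2) = h (mat2 2 0 0 (1/2)) + h (mat2 1 x 0 1) + h (mat2 (1/2) 0 0 2)"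
      by (simp add: hom SL2Q_mult mat2_in_SL2Q)
    then have "h (mat2 1 (4 * x) 0 1) = h (mat2 1 x 0 1)"
      using diag by (simp add: mat2_mult algebra_simps)
    moreover have "h (mat2 1 (4 * x) 0 1) = 4 * h (mat2 1 x 0 1)"
      using U_add[of x x] U_add[of "2 * x" "2 * x"] by simp
    ultimately show ?thesis by simp
  qed
  have L: "h (mat2 1 0 x 1) = 0" for x
  proof -
    have "h (mat2 (1/2) 0 0 2 ** mat2 1 0 x 1 ** mat2 2 0 0 (1/2)) = h (mat2 (1/2) 0 0 2) + h (mat2 1 0 x 1) + h (mat2 2 0 0 (1/2))"
      by (simp add: hom SL2Q_mult mat2_in_SL2Q)
    then have "h (mat2 1 0 (4 * x) 1) = h (mat2 1 0 x 1)"
      using diag by (simp add: mat2_mult algebra_simps)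
    moreover have "h (mat2 1 0 (4 * x) 1) = 4 * h (mat2 1 0 x 1)"
      using L_add[of x x] L_add[of "2 * x" "2 * x"] by simp
    ultimately show ?thesis by simp
  qed
  have main: "h (mat2 a b c d) = 0" if det: "a * d - b * c = 1" and c: "c \<noteq> 0" for a b c d
  proof -
    have "mat2 1 ((a - 1) / c) 0 1 ** mat2 1 0 c 1 ** mat2 1 ((d - 1) / c) 0 1 = mat2 a b c d"
    proof -
      have "(a - 1) / c * c = a - 1" "c * ((d - 1) / c) = d - 1" using c by simp_all
      moreover have "a * ((d - 1) / c) + (a - 1) / c = b"
        using c det by (simp add: field_simps)
      ultimately show ?thesis by (simp add: mat2_mult)
    qed
    moreover have "h (mat2 1 ((a - 1) / c) 0 1 ** mat2 1 0 c 1 ** mat2 1 ((d - 1) / c) 0 1) = 0"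
      by (simp add: hom SL2Q_mult mat2_in_SL2Q U L)
    ultimately show ?thesis by simp
  qed
  define a b c d where "a = \<gamma> $ 1 $ 1" and "b = \<gamma> $ 1 $ 2" and "c = \<gamma> $ 2 $ 1" and "d = \<gamma> $ 2 $ 2"
  have g: "\<gamma> = mat2 a b c d" unfolding a_def b_def c_def d_def mat2_eta ..
  have det: "a * d - b * c = 1" using \<gamma> unfolding g mat2_in_SL2Q .
  show ?thesis
  proof (cases "c = 0")
    case False
    then show ?thesis unfolding g by (rule main[OF det])
  next
    case True
    \<comment> \<open>Here \<open>d \<noteq> 0\<close>, and a lower unipotent factor moves it to the lower left entry.\<close>
    have "h (\<gamma> ** mat2 1 0 1 1) = h \<gamma> + h (mat2 1 0 1 1)"
      by (rule hom[OF \<gamma>]) (simp add: mat2_in_SL2Q)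
    moreover have "\<gamma> ** mat2 1 0 1 1 = mat2 (a + b) b d d" unfolding g mat2_mult using True by simp
    moreover have "h (mat2 (a + b) b d d) = 0"
      by (rule main) (use det True in \<open>auto simp: algebra_simps\<close>)
    ultimately show ?thesis using L by simp
  qed
qed

theorem theorem4:
  shows "(\<forall>\<gamma>1\<in>SL2Q. \<forall>\<gamma>2\<in>SL2Q.
            of_real (1/2 * Re (GV \<gamma>1 \<gamma>2)) + petersson_e (real_matrix \<gamma>1) (real_matrix \<gamma>2)
              = of_rat (Phi (\<gamma>1 ** \<gamma>2) - Phi \<gamma>1 - Phi \<gamma>2))
       \<and> (\<forall>\<phi> :: rat^2^2 \<Rightarrow> complex.
            (\<forall>\<gamma>1\<in>SL2Q. \<forall>\<gamma>2\<in>SL2Q.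
               of_real (1/2 * Re (GV \<gamma>1 \<gamma>2)) + petersson_e (real_matrix \<gamma>1) (real_matrix \<gamma>2)
                 = \<phi> (\<gamma>1 ** \<gamma>2) - \<phi> \<gamma>1 - \<phi> \<gamma>2)
            \<longrightarrow> (\<forall>\<gamma>\<in>SL2Q. \<phi> \<gamma> = of_rat (Phi \<gamma>)))"
proof (intro conjI ballI allI impI)
  fix \<gamma>1 \<gamma>2 assume "\<gamma>1 \<in> SL2Q" "\<gamma>2 \<in> SL2Q"
  then show "of_real (1/2 * Re (GV \<gamma>1 \<gamma>2)) + petersson_e (real_matrix \<gamma>1) (real_matrix \<gamma>2)
              = of_rat (Phi (\<gamma>1 ** \<gamma>2) - Phi \<gamma>1 - Phi \<gamma>2)"
    by (rule Phi_coboundary)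
next
  fix \<phi> :: "rat^2^2 \<Rightarrow> complex" and \<gamma>
  assume \<phi>: "\<forall>\<gamma>1\<in>SL2Q. \<forall>\<gamma>2\<in>SL2Q.
               of_real (1/2 * Re (GV \<gamma>1 \<gamma>2)) + petersson_e (real_matrix \<gamma>1) (real_matrix \<gamma>2)
                 = \<phi> (\<gamma>1 ** \<gamma>2) - \<phi> \<gamma>1 - \<phi> \<gamma>2"
    and \<gamma>: "\<gamma> \<in> SL2Q"
  have "\<phi> \<gamma> - of_rat (Phi \<gamma>) = 0"
  proof (rule SL2Q_hom_trivial[where h = "\<lambda>A. \<phi> A - of_rat (Phi A)", OF _ \<gamma>])
    fix A B assume AB: "A \<in> SL2Q" "B \<in> SL2Q"
    then have "\<phi> (A ** B) - \<phi> A - \<phi> B = of_rat (Phi (A ** B) - Phi A - Phi B)"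
      using \<phi> Phi_coboundary[OF AB] by metis
    then show "\<phi> (A ** B) - of_rat (Phi (A ** B)) = \<phi> A - of_rat (Phi A) + (\<phi> B - of_rat (Phi B))"
      by (simp add: of_rat_diff of_rat_add algebra_simps)
  qed
  then show "\<phi> \<gamma> = of_rat (Phi \<gamma>)" by simp
qed

end
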